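(* Let $z_0=(\tau_0,x_0)$, $z_0'=(\tau_0',x_0')$ be two points of the GRW spacetime $(I\times F,g^f=-d\tau^2+f^2g)$ with $n$-dimensional fiber $(F,g)$. Assume that $\gamma(t)=(\tau(t),\gamma_F(t))$ is a geodesic which joins them, $\gamma_F(t)$ being the reparametrization of a non-constant $F$-geodesic $\hat\gamma_F$, and that $z_0,z_0'$ are conjugate along $\gamma$ with multiplicity $m\in\{0,1,\dots,n\}$ ($m=0$ means not conjugate). (i) Then $x_0,x_0'$ are conjugate points of multiplicity $m'\in\{m,m-1\}$ along $\hat\gamma_F$ (at the corresponding points of the domain). In particular, if $z_0,z_0'$ are non-conjugate (along $\gamma$) then so are $x_0$ and $x_0'$ (along $\hat\gamma_F$). (ii) If $\gamma$ is a causal geodesic (or any geodesic without zeroes in $d\tau/dt$) then $m'=m$.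
   Context: $(F,g)$ is a Riemannian manifold, $I\subseteq\mathbb{R}$ an open interval, $f:I\to(0,\infty)$ smooth. The GRW spacetime is $I\times F$ with Lorentz metric $g^f=-d\tau^2+f(\tau)^2g$. For any geodesic $\gamma=(\tau,\gamma_F)$ of $g^f$, the component $\gamma_F$ is a pregeodesic of $(F,g)$, i.e. (if non-constant) a reparametrization of an $F$-geodesic $\hat\gamma_F$. The geodesic is causal if $g^f(\gamma',\gamma')\le0$. The multiplicity of conjugacy of two points along a geodesic is the dimension of the space of Jacobi fields along it vanishing at both corresponding parameter values; multiplicity $0$ means not conjugate (multiplicities are nonnegative, so $m=0$ forces $m'=0$). *)

theory Defs
  imports "HOL-Analysis.Analysis" "HOL-Library.Function_Algebras"
begin

section \<open>Pointwise vector space structure on functions\<close>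

instantiation "fun" :: (type, real_vector) real_vector
begin

definition scaleR_fun :: "real \<Rightarrow> ('a \<Rightarrow> 'b) \<Rightarrow> 'a \<Rightarrow> 'b" where
  "scaleR_fun r f = (\<lambda>x. r *\<^sub>R f x)"

instance
  by standard (auto simp: scaleR_fun_def fun_eq_iff scaleR_add_right scaleR_add_left)

end

section \<open>Smooth maps between open subsets of normed spaces\<close>

fun Ck_on :: "nat \<Rightarrow> 'a::real_normed_vector set \<Rightarrow> ('a \<Rightarrow> 'b::real_normed_vector) \<Rightarrow> bool" where
  "Ck_on 0 S f \<longleftrightarrow> continuous_on S f"
| "Ck_on (Suc k) S f \<longleftrightarrow>
     (\<forall>x\<in>S. f differentiable (at x)) \<and> (\<forall>v. Ck_on k S (\<lambda>x. frechet_derivative f (at x) v))"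

text \<open>To be used for open \<^term>\<open>S\<close> only.\<close>

definition smooth_on :: "'a::real_normed_vector set \<Rightarrow> ('a \<Rightarrow> 'b::real_normed_vector) \<Rightarrow> bool" where
  "smooth_on S f \<longleftrightarrow> (\<forall>k. Ck_on k S f)"

section \<open>Manifolds given by an indexed atlas\<close>

text \<open>
  A manifold modelled on the Euclidean space \<open>'e\<close> (so of dimension \<open>DIM('e)\<close>) is a topological
  space with an atlas indexed by the type \<open>'i\<close>. Indexing by a whole type is no restriction, as
  charts may be repeated. The values of \<open>chart M i\<close> outside \<open>chart_dom M i\<close> are irrelevant.
\<close>

record ('i, 'p, 'e) manifold =
  mtop :: "'p topology"
  chart_dom :: "'i \<Rightarrow> 'p set"
  chart :: "'i \<Rightarrow> 'p \<Rightarrow> 'e"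

definition transition :: "('i, 'p, 'e) manifold \<Rightarrow> 'i \<Rightarrow> 'i \<Rightarrow> 'e \<Rightarrow> 'e" where
  "transition M i j = chart M j \<circ> inv_into (chart_dom M i) (chart M i)"

definition smooth_manifold :: "('i, 'p, 'e::euclidean_space) manifold \<Rightarrow> bool" where
  "smooth_manifold M \<longleftrightarrow>
     Hausdorff_space (mtop M) \<and> second_countable (mtop M) \<and>
     (\<Union>i. chart_dom M i) = topspace (mtop M) \<and>
     (\<forall>i. openin (mtop M) (chart_dom M i) \<and>
          open (chart M i ` chart_dom M i) \<and>
          homeomorphic_map (subtopology (mtop M) (chart_dom M i))
            (top_of_set (chart M i ` chart_dom M i)) (chart M i)) \<and>
     (\<forall>i j. smooth_on (chart M i ` (chart_dom M i \<inter> chart_dom M j)) (transition M i j))"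

text \<open>
  A metric is given by its coordinate representations: \<open>g i x u v\<close> is the value on the tangent
  vectors with components \<open>u\<close> and \<open>v\<close> with respect to chart \<open>i\<close>, at the point with
  coordinates \<open>x\<close> in that chart.
\<close>

type_synonym ('i, 'e) metric = "'i \<Rightarrow> 'e \<Rightarrow> 'e \<Rightarrow> 'e \<Rightarrow> real"

definition riemannian_manifold ::
  "('i, 'p, 'e::euclidean_space) manifold \<Rightarrow> ('i, 'e) metric \<Rightarrow> bool" where
  "riemannian_manifold M g \<longleftrightarrow>
     smooth_manifold M \<and>
     (\<forall>i. \<forall>u v. smooth_on (chart M i ` chart_dom M i) (\<lambda>x. g i x u v)) \<and>
     (\<forall>i. \<forall>x\<in>chart M i ` chart_dom M i.
        bilinear (g i x) \<and> (\<forall>u v. g i x u v = g i x v u) \<and> (\<forall>u. u \<noteq> 0 \<longrightarrow> 0 < g i x u u)) \<and>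
     (\<forall>i j. \<forall>x\<in>chart M i ` (chart_dom M i \<inter> chart_dom M j). \<forall>u v.
        g i x u v = g j (transition M i j x)
                        (frechet_derivative (transition M i j) (at x) u)
                        (frechet_derivative (transition M i j) (at x) v))"

section \<open>Levi-Civita connection and curvature in a chart\<close>

text \<open>
  In the next two definitions, \<open>h\<close> is the coordinate representation of a nondegenerate metric of
  any signature in one chart. \<open>christoffel h x u v\<close> is the vector with components
  \<open>\<Gamma>\<^sup>k\<^sub>i\<^sub>j u\<^sup>i v\<^sup>j\<close>, defined by the Koszul formula; \<open>curvature h x u v w\<close> represents
  \<open>R(u,v)w = \<nabla>\<^sub>u \<nabla>\<^sub>v w - \<nabla>\<^sub>v \<nabla>\<^sub>u w - \<nabla>\<^sub>[\<^sub>u\<^sub>,\<^sub>v\<^sub>] w\<close>.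
\<close>

definition christoffel ::
  "('e::euclidean_space \<Rightarrow> 'e \<Rightarrow> 'e \<Rightarrow> real) \<Rightarrow> 'e \<Rightarrow> 'e \<Rightarrow> 'e \<Rightarrow> 'e" where
  "christoffel h x u v =
     (THE w. \<forall>z. 2 * h x w z =
        frechet_derivative (\<lambda>y. h y v z) (at x) u
      + frechet_derivative (\<lambda>y. h y u z) (at x) v
      - frechet_derivative (\<lambda>y. h y u v) (at x) z)"

definition curvature ::
  "('e::euclidean_space \<Rightarrow> 'e \<Rightarrow> 'e \<Rightarrow> real) \<Rightarrow> 'e \<Rightarrow> 'e \<Rightarrow> 'e \<Rightarrow> 'e \<Rightarrow> 'e" where
  "curvature h x u v w =
     frechet_derivative (\<lambda>y. christoffel h y v w) (at x) u
   - frechet_derivative (\<lambda>y. christoffel h y u w) (at x) v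
   + christoffel h x u (christoffel h x v w)
   - christoffel h x v (christoffel h x u w)"

section \<open>Vector fields along curves, geodesics and Jacobi fields\<close>

text \<open>
  Curves are parametrized by a nondegenerate interval \<open>J\<close>, not necessarily open; derivatives are
  taken within \<open>J\<close>. A vector field along a curve is the family of its component functions
  \<open>X i t\<close> in all charts, related by the transformation law of tangent vectors. Components are set
  to 0 where they make no sense, so that a field is determined uniquely by the function \<open>X\<close>.
\<close>

definition field_along ::
  "('i, 'p, 'e::euclidean_space) manifold \<Rightarrow> real set \<Rightarrow> (real \<Rightarrow> 'p) \<Rightarrow> ('i \<Rightarrow> real \<Rightarrow> 'e) \<Rightarrow> bool"
  where
  "field_along M J \<gamma> X \<longleftrightarrow>
     (\<forall>i t. \<not> (t \<in> J \<and> \<gamma> t \<in> chart_dom M i) \<longrightarrow> X i t = 0) \<and>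
     (\<forall>i j. \<forall>t\<in>J. \<gamma> t \<in> chart_dom M i \<inter> chart_dom M j \<longrightarrow>
        X j t = frechet_derivative (transition M i j) (at (chart M i (\<gamma> t))) (X i t))"

definition differentiable_field ::
  "('i, 'p, 'e::euclidean_space) manifold \<Rightarrow> real set \<Rightarrow> (real \<Rightarrow> 'p) \<Rightarrow> ('i \<Rightarrow> real \<Rightarrow> 'e) \<Rightarrow> bool"
  where
  "differentiable_field M J \<gamma> X \<longleftrightarrow>
     (\<forall>i. \<forall>t\<in>J. \<gamma> t \<in> chart_dom M i \<longrightarrow> X i differentiable (at t within J))"

definition differentiable_curve ::
  "('i, 'p, 'e::euclidean_space) manifold \<Rightarrow> real set \<Rightarrow> (real \<Rightarrow> 'p) \<Rightarrow> bool" where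
  "differentiable_curve M J \<gamma> \<longleftrightarrow>
     continuous_map (top_of_set J) (mtop M) \<gamma> \<and>
     (\<forall>i. \<forall>t\<in>J. \<gamma> t \<in> chart_dom M i \<longrightarrow> (chart M i \<circ> \<gamma>) differentiable (at t within J))"

definition velocity ::
  "('i, 'p, 'e::euclidean_space) manifold \<Rightarrow> real set \<Rightarrow> (real \<Rightarrow> 'p) \<Rightarrow> 'i \<Rightarrow> real \<Rightarrow> 'e" where
  "velocity M J \<gamma> i t =
     (if t \<in> J \<and> \<gamma> t \<in> chart_dom M i
      then vector_derivative (chart M i \<circ> \<gamma>) (at t within J) else 0)"

definition covariant_derivative ::
  "('i, 'p, 'e::euclidean_space) manifold \<Rightarrow> ('i, 'e) metric \<Rightarrow> real set \<Rightarrow> (real \<Rightarrow> 'p) \<Rightarrow>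
   ('i \<Rightarrow> real \<Rightarrow> 'e) \<Rightarrow> 'i \<Rightarrow> real \<Rightarrow> 'e" where
  "covariant_derivative M g J \<gamma> X i t =
     (if t \<in> J \<and> \<gamma> t \<in> chart_dom M i
      then vector_derivative (X i) (at t within J)
           + christoffel (g i) (chart M i (\<gamma> t)) (velocity M J \<gamma> i t) (X i t)
      else 0)"

text \<open>
  Twice differentiable solutions of the geodesic and the Jacobi equation are automatically smooth.
\<close>

definition geodesic ::
  "('i, 'p, 'e::euclidean_space) manifold \<Rightarrow> ('i, 'e) metric \<Rightarrow> real set \<Rightarrow> (real \<Rightarrow> 'p) \<Rightarrow> bool"
  where
  "geodesic M g J \<gamma> \<longleftrightarrow>
     differentiable_curve M J \<gamma> \<and>
     differentiable_field M J \<gamma> (velocity M J \<gamma>) \<and>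
     (\<forall>i. \<forall>t\<in>J. covariant_derivative M g J \<gamma> (velocity M J \<gamma>) i t = 0)"

definition jacobi_field ::
  "('i, 'p, 'e::euclidean_space) manifold \<Rightarrow> ('i, 'e) metric \<Rightarrow> real set \<Rightarrow> (real \<Rightarrow> 'p) \<Rightarrow>
   ('i \<Rightarrow> real \<Rightarrow> 'e) \<Rightarrow> bool" where
  "jacobi_field M g J \<gamma> X \<longleftrightarrow>
     field_along M J \<gamma> X \<and>
     differentiable_field M J \<gamma> X \<and>
     differentiable_field M J \<gamma> (covariant_derivative M g J \<gamma> X) \<and>
     (\<forall>i. \<forall>t\<in>J. \<gamma> t \<in> chart_dom M i \<longrightarrow>
        covariant_derivative M g J \<gamma> (covariant_derivative M g J \<gamma> X) i t
        + curvature (g i) (chart M i (\<gamma> t)) (X i t) (velocity M J \<gamma> i t) (velocity M J \<gamma> i t) = 0)"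

text \<open>
  The dimension refers to the vector space structure on functions above; the space of Jacobi fields
  along a geodesic is finite-dimensional, so the library convention for \<^const>\<open>dim\<close> on
  infinite-dimensional spaces does not matter.
\<close>

definition conjugate_multiplicity ::
  "('i, 'p, 'e::euclidean_space) manifold \<Rightarrow> ('i, 'e) metric \<Rightarrow> real set \<Rightarrow> (real \<Rightarrow> 'p) \<Rightarrow>
   real \<Rightarrow> real \<Rightarrow> nat" where
  "conjugate_multiplicity M g J \<gamma> a b =
     dim {X. jacobi_field M g J \<gamma> X \<and> (\<forall>i. X i a = 0) \<and> (\<forall>i. X i b = 0)}"

definition conjugate_along ::
  "('i, 'p, 'e::euclidean_space) manifold \<Rightarrow> ('i, 'e) metric \<Rightarrow> real set \<Rightarrow> (real \<Rightarrow> 'p) \<Rightarrow>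
   real \<Rightarrow> real \<Rightarrow> bool" where
  "conjugate_along M g J \<gamma> a b \<longleftrightarrow> conjugate_multiplicity M g J \<gamma> a b > 0"

definition causal_curve ::
  "('i, 'p, 'e::euclidean_space) manifold \<Rightarrow> ('i, 'e) metric \<Rightarrow> real set \<Rightarrow> (real \<Rightarrow> 'p) \<Rightarrow> bool"
  where
  "causal_curve M g J \<gamma> \<longleftrightarrow>
     (\<forall>i. \<forall>t\<in>J. \<gamma> t \<in> chart_dom M i \<longrightarrow>
        g i (chart M i (\<gamma> t)) (velocity M J \<gamma> i t) (velocity M J \<gamma> i t) \<le> 0)"

text \<open>
  As geodesics have constant speed, a reparametrization of one (with nonvanishing velocity) of class
  \<open>C\<^sup>2\<close> has a change of parameter of the same class, so it suffices to ask for differentiability.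
\<close>

definition reparametrization_of ::
  "(real \<Rightarrow> 'p) \<Rightarrow> real set \<Rightarrow> (real \<Rightarrow> real) \<Rightarrow> (real \<Rightarrow> 'p) \<Rightarrow> real set \<Rightarrow> bool" where
  "reparametrization_of \<beta> J r \<alpha> K \<longleftrightarrow>
     r ` J = K \<and>
     (\<forall>t\<in>J. r differentiable (at t within J) \<and> vector_derivative r (at t within J) \<noteq> 0) \<and>
     (\<forall>t\<in>J. \<beta> t = \<alpha> (r t))"

section \<open>Generalized Robertson-Walker spacetimes\<close>

definition grw_manifold ::
  "real set \<Rightarrow> ('i, 'p, 'e::euclidean_space) manifold \<Rightarrow> ('i, real \<times> 'p, real \<times> 'e) manifold" where
  "grw_manifold I F =
     \<lparr> mtop = prod_topology (top_of_set I) (mtop F),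
       chart_dom = (\<lambda>i. I \<times> chart_dom F i),
       chart = (\<lambda>i (\<tau>, p). (\<tau>, chart F i p)) \<rparr>"

definition grw_metric ::
  "(real \<Rightarrow> real) \<Rightarrow> ('i, 'e::euclidean_space) metric \<Rightarrow> ('i, real \<times> 'e) metric" where
  "grw_metric f g = (\<lambda>i (\<tau>, x) (a, u) (b, v). - (a * b) + (f \<tau>)\<^sup>2 * g i x u v)"

end

theory Submission
  imports Defs
begin

text \<open>
  Write \<open>\<gamma> = (\<tau>, \<beta>)\<close>, \<open>v = \<beta>'\<close>, \<open>\<sigma> = \<tau>'\<close> and \<open>e = g(v,v)\<close>. A field \<open>(\<alpha>, Y)\<close> along \<open>\<gamma>\<close> is a Jacobi field iff
  \<open>\<alpha>'' + 2 f f' g(DY,v) + (f f')' \<alpha> e = 0\<close> and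
  \<open>D\<^sup>2Y + R(Y,v)v + 2 (f'/f) \<sigma> DY + 2 ((f'/f) \<alpha>)' v = 0\<close>, the prime on the last bracket being \<open>d/dt\<close>.
  If \<open>\<alpha> = 0\<close>, the second equation says, after the change of parameter \<open>r\<close> (for which
  \<open>r'' = - 2 (f'/f) \<sigma> r'\<close>), that \<open>Y\<close> is a Jacobi field of the fiber; conversely a Jacobi field of the fiber
  vanishing at both ends is orthogonal to the fiber geodesic, so it lifts to a solution with \<open>\<alpha> = 0\<close>.
  Hence the multiplicities differ by the codimension of \<open>{\<alpha> = 0}\<close> in the space of Jacobi fields vanishing at both
  ends. Two first integrals, \<open>g\<^sup>f((\<alpha>,Y),\<gamma>') = 0\<close> and \<open>\<kappa> = g(DY,v)/e + 2 (f'/f) \<alpha>\<close>, combine to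
  \<open>\<alpha>' \<sigma> - \<alpha> \<sigma>' = \<kappa> f\<^sup>2 e\<close>. If \<open>\<sigma>\<close> has no zeros, then \<open>(\<alpha>/\<sigma>)'\<close> has constant sign and Rolle's theorem gives
  \<open>\<kappa> = 0\<close> and \<open>\<alpha> = 0\<close>. In general, \<open>\<alpha>'(a) = 0\<close> forces \<open>\<kappa> = 0\<close>, so that \<open>\<alpha>\<close> solves a linear homogeneous equation of
  second order with zero initial values; thus \<open>\<alpha>\<close> is determined by the single number \<open>\<alpha>'(a)\<close>.
  The codimension is at most 1, so the convention that \<^const>\<open>dim\<close> is 0 in infinite dimensions does no harm.
\<close>

section \<open>Calculus on intervals, mixed partial derivatives, dimensions\<close>

text \<open>The obstacle is that nothing lives on all of \<open>J\<close> at once: fields are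
  families of chart components, while the theorems of calculus want scalar functions on an interval.
  Hence inner products and the base component are packaged as chart independent functions, their
  derivatives are computed on the relatively open set of times at which the curve stays in one
  chart, and the analysis takes place in the scalar system \<open>tangential_jacobi\<close>. The
  first integrals arise as follows. The product of a Jacobi field with the velocity has constant
  derivative by skewness of the curvature, so two zeros make it vanish. The fiber part of the
  geodesic equation, \<open>D v = - 2 (f'/f) \<sigma> v\<close>, makes \<open>f^4 e\<close>
  constant, and \<open>\<kappa>\<close> is half of the logarithmic derivative of that constant under
  a variation through geodesics. The same equation, compared with \<open>v = r' T\<close> and
  \<open>D T = 0\<close>, yields the law for \<open>r''\<close>. Lifting and projecting are explicit
  and inverse to each other, so the count reduces to the kernel of the functional
  \<open>\<alpha>'(a)\<close>.\<close>

lemma at_within_interval_nontrivial: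
  fixes J :: "real set"
  assumes "is_interval J" "a \<in> J" "b \<in> J" "a \<noteq> b" "t \<in> J"
  shows "at t within J \<noteq> bot"
proof -
  have "connected J" using assms(1) by (simp add: is_interval_connected_1)
  moreover have "infinite J"
    using connected_finite_iff_sing[OF \<open>connected J\<close>] assms by auto
  ultimately have "t islimpt J"
    using assms connected_imp_perfect by (metis singleton_iff)
  then show ?thesis
    by (simp add: trivial_limit_within)
qed

section \<open>Constant and affine functions, and uniqueness for scalar linear equations\<close>

lemma has_real_derivative_zero_const_on_interval:
  fixes \<omega> :: "real \<Rightarrow> real"
  assumes J: "is_interval J" and "\<And>t. t \<in> J \<Longrightarrow> (\<omega> has_real_derivative 0) (at t within J)"
    and "s \<in> J" "t \<in> J"
  shows "\<omega> s = \<omega> t"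
proof -
  have "convex J" using J by (simp add: is_interval_convex)
  then have "\<exists>c. \<forall>x\<in>J. \<omega> x = c"
    using has_field_derivative_zero_constant[of J \<omega>] assms(2) by blast
  then show ?thesis using assms(3,4) by auto
qed

text \<open>Made for the inner product of a Jacobi field with the velocity of its geodesic: that
  function is affine in the parameter, so vanishing at both ends kills it together with its
  derivative.\<close>

lemma affine_with_two_zeros:
  fixes \<omega> \<mu> :: "real \<Rightarrow> real"
  assumes J: "is_interval J" "a \<in> J" "b \<in> J" "a \<noteq> b"
    and \<omega>: "\<And>t. t \<in> J \<Longrightarrow> (\<omega> has_real_derivative \<mu> t) (at t within J)"
    and \<mu>: "\<And>t. t \<in> J \<Longrightarrow> (\<mu> has_real_derivative 0) (at t within J)"
    and "\<omega> a = 0" "\<omega> b = 0" and t: "t \<in> J"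
  shows "\<omega> t = 0" "\<mu> t = 0"
proof -
  have \<mu>c: "\<mu> s = \<mu> a" if "s \<in> J" for s
    using has_real_derivative_zero_const_on_interval[OF J(1) \<mu> that J(2)] by auto
  have "((\<lambda>s. \<omega> s - \<mu> a * s) has_real_derivative 0) (at s within J)" if "s \<in> J" for s
    using \<omega>[OF that] \<mu>c[OF that] by (auto intro!: derivative_eq_intros)
  from has_real_derivative_zero_const_on_interval[OF J(1) this]
  have c: "\<omega> s - \<mu> a * s = \<omega> a - \<mu> a * a" if "s \<in> J" for s
    using that J(2) by blast
  have "\<mu> a = 0" using c[OF J(3)] assms(7,8) J(4) by auto
  then show "\<omega> t = 0" "\<mu> t = 0" using c[OF t] \<mu>c[OF t] assms(7) by auto
qed

text \<open>A Gronwall estimate for the first order system \<open>y' = z\<close>,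
  \<open>z' = q y\<close>: the damped energy \<open>E\<close> does not increase and starts at
  0.\<close>

lemma linear_ode_zero_forward:
  fixes y z q :: "real \<Rightarrow> real"
  assumes "a \<le> t"
    and y: "\<And>s. s \<in> {a..t} \<Longrightarrow> (y has_real_derivative z s) (at s within {a..t})"
    and z: "\<And>s. s \<in> {a..t} \<Longrightarrow> (z has_real_derivative q s * y s) (at s within {a..t})"
    and q: "continuous_on {a..t} q"
    and "y a = 0" "z a = 0"
  shows "y t = 0"
proof -
  have "bounded (q ` {a..t})"
    using compact_continuous_image[OF q] compact_imp_bounded by blast
  then obtain B where B: "\<And>s. s \<in> {a..t} \<Longrightarrow> \<bar>q s\<bar> \<le> B"
    unfolding bounded_iff by (metis imageI real_norm_def)
  \<comment> \<open>As \<open>q\<close> is bounded by \<open>B\<close> in absolute value, the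
    derivative \<open>2 y z (1 + q)\<close> of \<open>y^2 + z^2\<close> is at most
    \<open>(1 + B) (y^2 + z^2)\<close>; this is the rate that the damping factor has to
    beat.\<close>
  define C where "C = 1 + B"
  define E where "E s = ((y s)\<^sup>2 + (z s)\<^sup>2) * exp (- C * s)" for s
  have E': "(E has_real_derivative
      (2 * y s * z s * (1 + q s) - C * ((y s)\<^sup>2 + (z s)\<^sup>2)) * exp (- C * s)) (at s within {a..t})"
    if "s \<in> {a..t}" for s
    unfolding E_def
    by (rule derivative_eq_intros y[OF that] z[OF that] refl)+ (simp add: algebra_simps)
  have le: "(2 * y s * z s * (1 + q s) - C * ((y s)\<^sup>2 + (z s)\<^sup>2)) * exp (- C * s) \<le> 0"
    if "s \<in> {a..t}" for s
  proof -
    have "\<bar>2 * y s * z s\<bar> \<le> (y s)\<^sup>2 + (z s)\<^sup>2"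
      using sum_squares_bound[of "\<bar>y s\<bar>" "\<bar>z s\<bar>"] by (simp add: abs_mult)
    moreover have "\<bar>1 + q s\<bar> \<le> C" using B[OF that] unfolding C_def by linarith
    ultimately have "\<bar>2 * y s * z s\<bar> * \<bar>1 + q s\<bar> \<le> ((y s)\<^sup>2 + (z s)\<^sup>2) * C"
      by (intro mult_mono) auto
    then have "2 * y s * z s * (1 + q s) \<le> C * ((y s)\<^sup>2 + (z s)\<^sup>2)"
      by (metis abs_mult abs_le_D1 mult.commute)
    then show ?thesis by (simp add: mult_nonpos_nonneg)
  qed
  have "E t \<le> E a"
  proof -
    have "\<exists>x\<in>{a..t}. E t - E a = ((2 * y x * z x * (1 + q x) - C * ((y x)\<^sup>2 + (z x)\<^sup>2)) * exp (- C * x)) * (t - a)"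
      by (rule mvt_very_simple[OF \<open>a \<le> t\<close>])
         (use E' in \<open>auto simp: has_field_derivative_def\<close>)
    then show ?thesis
      using le \<open>a \<le> t\<close> by (smt (verit, best) mult_nonpos_nonneg)
  qed
  also have "E a = 0" using assms by (simp add: E_def)
  finally have "(y t)\<^sup>2 + (z t)\<^sup>2 \<le> 0"
    unfolding E_def by (simp add: mult_le_0_iff not_le[symmetric])
  then show ?thesis by (simp add: sum_power2_le_zero_iff)
qed

lemma linear_ode_zero:
  fixes y z q :: "real \<Rightarrow> real"
  assumes J: "is_interval J" "a \<in> J" "t \<in> J"
    and y: "\<And>s. s \<in> J \<Longrightarrow> (y has_real_derivative z s) (at s within J)"
    and z: "\<And>s. s \<in> J \<Longrightarrow> (z has_real_derivative q s * y s) (at s within J)"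
    and q: "continuous_on J q"
    and "y a = 0" "z a = 0"
  shows "y t = 0"
proof (cases "a \<le> t")
  case True
  have sub: "{a..t} \<subseteq> J"
    using mem_is_interval_1_I[OF J] by auto
  have y': "(y has_real_derivative z s) (at s within {a..t})"
    and z': "(z has_real_derivative q s * y s) (at s within {a..t})" if "s \<in> {a..t}" for s
  proof -
    have "s \<in> J" using that sub by blast
    show "(y has_real_derivative z s) (at s within {a..t})"
      by (rule has_field_derivative_subset[OF y[OF \<open>s \<in> J\<close>] sub])
    show "(z has_real_derivative q s * y s) (at s within {a..t})"
      by (rule has_field_derivative_subset[OF z[OF \<open>s \<in> J\<close>] sub])
  qed
  show ?thesis
    by (rule linear_ode_zero_forward[of a t y z q, OF True y' z' continuous_on_subset[OF q sub] assms(7,8)])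
next
  case False
  \<comment> \<open>To the left of \<open>a\<close> the equation is reflected:
    \<open>y (- s)\<close> has derivative \<open>- z (- s)\<close>, and two sign changes restore the
    form \<open>q y\<close> of the second derivative.\<close>
  then have le: "- a \<le> - t" by simp
  have sub: "uminus ` {-a..-t} \<subseteq> J"
    using mem_is_interval_1_I[OF J(1,3,2)] by auto
  have m: "(uminus has_real_derivative -1) (at s within {-a..-t})" for s :: real
    by (auto intro!: derivative_eq_intros)
  have in_J: "- s \<in> J" if "s \<in> {-a..-t}" for s using sub that by blast
  have "((\<lambda>s. y (- s)) has_real_derivative z (- s) * - 1) (at s within {-a..-t})"
    if "s \<in> {-a..-t}" for s
    using DERIV_image_chain[OF has_field_derivative_subset[OF y[OF in_J[OF that]] sub] m] by (simp only: o_def)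
  then have y': "((\<lambda>s. y (- s)) has_real_derivative - z (- s)) (at s within {-a..-t})"
    if "s \<in> {-a..-t}" for s using that by simp
  have "((\<lambda>s. z (- s)) has_real_derivative q (- s) * y (- s) * - 1) (at s within {-a..-t})"
    if "s \<in> {-a..-t}" for s
    using DERIV_image_chain[OF has_field_derivative_subset[OF z[OF in_J[OF that]] sub] m] by (simp only: o_def)
  from DERIV_minus[OF this]
  have z': "((\<lambda>s. - z (- s)) has_real_derivative q (- s) * y (- s)) (at s within {-a..-t})"
    if "s \<in> {-a..-t}" for s using that by simp
  have "continuous_on {-a..-t} (\<lambda>s. q (- s))"
    by (rule continuous_on_compose2[OF q]) (use sub in \<open>auto intro!: continuous_intros\<close>)
  from linear_ode_zero_forward[of "-a" "-t" "\<lambda>s. y (- s)" "\<lambda>s. - z (- s)" "\<lambda>s. q (- s)", OF le y' z' this]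
  show ?thesis using assms(7,8) by simp
qed

section \<open>Symmetry of second directional derivatives\<close>

lemma second_difference_mean_value:
  fixes \<phi> :: "'a::real_normed_vector \<Rightarrow> real"
  assumes h: "0 < h" and U: "\<And>s t. s \<in> {0..h} \<Longrightarrow> t \<in> {0..h} \<Longrightarrow> x + s *\<^sub>R u + t *\<^sub>R v \<in> U"
    and d: "\<And>y. y \<in> U \<Longrightarrow> \<phi> differentiable (at y)"
    and du: "\<And>y. y \<in> U \<Longrightarrow> (\<lambda>z. frechet_derivative \<phi> (at z) u) differentiable (at y)"
  obtains s t where "s \<in> {0..h}" "t \<in> {0..h}"
    "\<phi> (x + h *\<^sub>R u + h *\<^sub>R v) - \<phi> (x + h *\<^sub>R u) - \<phi> (x + h *\<^sub>R v) + \<phi> x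
     = h * h * frechet_derivative (\<lambda>z. frechet_derivative \<phi> (at z) u) (at (x + s *\<^sub>R u + t *\<^sub>R v)) v"
proof -
  let ?D = "\<lambda>z. frechet_derivative \<phi> (at z) u"
  \<comment> \<open>The increment in direction \<open>v\<close> as a function of the position along
    \<open>u\<close>. The mean value theorem is applied to it in direction \<open>u\<close>, and
    then in direction \<open>v\<close> to the directional derivative along \<open>u\<close>.\<close>
  let ?p = "\<lambda>s. \<phi> (x + s *\<^sub>R u + h *\<^sub>R v) - \<phi> (x + s *\<^sub>R u)"
  have d\<phi>: "(\<phi> has_derivative frechet_derivative \<phi> (at y)) (at y)" if "y \<in> U" for y
    using d[OF that] frechet_derivative_works by blast
  have line: "((\<lambda>s. \<phi> (c + s *\<^sub>R u)) has_derivative (\<lambda>k. k * ?D (c + s *\<^sub>R u))) (at s within A)"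
    if "c + s *\<^sub>R u \<in> U" for c s A
  proof -
    have "((\<lambda>s. c + s *\<^sub>R u) has_derivative (\<lambda>k. k *\<^sub>R u)) (at s within A)"
      by (auto intro!: derivative_eq_intros)
    from has_derivative_compose[OF this d\<phi>[OF that]]
    have "((\<lambda>s. \<phi> (c + s *\<^sub>R u)) has_derivative (\<lambda>k. frechet_derivative \<phi> (at (c + s *\<^sub>R u)) (k *\<^sub>R u))) (at s within A)" .
    then show ?thesis
      using linear_scale[OF linear_frechet_derivative[OF d[OF that]]] by simp
  qed
  have in1: "x + s *\<^sub>R u \<in> U" and in2: "(x + h *\<^sub>R v) + s *\<^sub>R u \<in> U" if "s \<in> {0..h}" for s
    using U[OF that, of 0] U[OF that, of h] h by (auto simp: algebra_simps)
  have "(?p has_derivative (\<lambda>k. k * ?D (x + s *\<^sub>R u + h *\<^sub>R v) - k * ?D (x + s *\<^sub>R u))) (at s within {0..h})"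
    if "0 \<le> s" "s \<le> h" for s
    using has_derivative_diff[OF line[OF in2[of s]] line[OF in1[of s]]] that
    by (simp add: algebra_simps)
  from mvt_simple[OF h this] obtain s where s: "s \<in> {0<..<h}"
    "?p h - ?p 0 = h * (?D (x + s *\<^sub>R u + h *\<^sub>R v) - ?D (x + s *\<^sub>R u))"
    by (auto simp: algebra_simps)
  have "((\<lambda>t. ?D (x + s *\<^sub>R u + t *\<^sub>R v)) has_derivative
      (\<lambda>k. k * frechet_derivative ?D (at (x + s *\<^sub>R u + t *\<^sub>R v)) v)) (at t within {0..h})"
    if "0 \<le> t" "t \<le> h" for t
  proof -
    have y: "x + s *\<^sub>R u + t *\<^sub>R v \<in> U" using U[of s t] s that by auto
    have "((\<lambda>t. x + s *\<^sub>R u + t *\<^sub>R v) has_derivative (\<lambda>k. k *\<^sub>R v)) (at t within {0..h})"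
      by (auto intro!: derivative_eq_intros)
    from has_derivative_compose[OF this du[OF y, unfolded frechet_derivative_works]]
    show ?thesis
      using linear_scale[OF linear_frechet_derivative[OF du[OF y]]] by simp
  qed
  from mvt_simple[OF h this] obtain t where t: "t \<in> {0<..<h}"
    "?D (x + s *\<^sub>R u + h *\<^sub>R v) - ?D (x + s *\<^sub>R u)
      = h * frechet_derivative ?D (at (x + s *\<^sub>R u + t *\<^sub>R v)) v"
    by auto
  show ?thesis
    by (rule that[of s t]) (use s t in \<open>auto simp: algebra_simps\<close>)
qed

text \<open>The second difference of \<open>\<phi>\<close> is symmetric in \<open>u\<close> and
  \<open>v\<close>, and it equals \<open>h * h\<close> times either mixed derivative at some point
  of a small parallelogram. So the two mixed derivatives take a common value arbitrarily close to
  \<open>x\<close>, and continuity carries this to \<open>x\<close>.\<close>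

lemma schwarz_directional:
  fixes \<phi> :: "'a::real_normed_vector \<Rightarrow> real"
  assumes U: "open U" "x \<in> U"
    and d: "\<And>y. y \<in> U \<Longrightarrow> \<phi> differentiable (at y)"
    and du: "\<And>y. y \<in> U \<Longrightarrow> (\<lambda>z. frechet_derivative \<phi> (at z) u) differentiable (at y)"
    and dv: "\<And>y. y \<in> U \<Longrightarrow> (\<lambda>z. frechet_derivative \<phi> (at z) v) differentiable (at y)"
    and cuv: "continuous_on U (\<lambda>y. frechet_derivative (\<lambda>z. frechet_derivative \<phi> (at z) u) (at y) v)"
    and cvu: "continuous_on U (\<lambda>y. frechet_derivative (\<lambda>z. frechet_derivative \<phi> (at z) v) (at y) u)"
  shows "frechet_derivative (\<lambda>z. frechet_derivative \<phi> (at z) u) (at x) v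
       = frechet_derivative (\<lambda>z. frechet_derivative \<phi> (at z) v) (at x) u"
proof (rule ccontr)
  let ?A = "\<lambda>y. frechet_derivative (\<lambda>z. frechet_derivative \<phi> (at z) u) (at y) v"
  let ?B = "\<lambda>y. frechet_derivative (\<lambda>z. frechet_derivative \<phi> (at z) v) (at y) u"
  assume "?A x \<noteq> ?B x"
  \<comment> \<open>Half of the supposed gap: two values closer than this to \<open>?A x\<close> and
    to \<open>?B x\<close> cannot coincide.\<close>
  define \<epsilon> where "\<epsilon> = \<bar>?A x - ?B x\<bar> / 2"
  have \<epsilon>: "0 < \<epsilon>" using \<open>?A x \<noteq> ?B x\<close> by (simp add: \<epsilon>_def)
  have "isCont ?A x" "isCont ?B x"
    using cuv cvu U continuous_on_eq_continuous_at by blast+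
  then have "\<forall>\<^sub>F y in nhds x. dist (?A y) (?A x) < \<epsilon>" "\<forall>\<^sub>F y in nhds x. dist (?B y) (?B x) < \<epsilon>"
    using \<epsilon> by (auto simp: isCont_def tendsto_iff eventually_at_filter elim!: eventually_mono)
  moreover have "\<forall>\<^sub>F y in nhds x. y \<in> U" using U eventually_nhds by blast
  ultimately have "\<forall>\<^sub>F y in nhds x. y \<in> U \<and> dist (?A y) (?A x) < \<epsilon> \<and> dist (?B y) (?B x) < \<epsilon>"
    by eventually_elim auto
  then obtain \<delta> where \<delta>: "0 < \<delta>"
    "\<And>y. dist y x < \<delta> \<Longrightarrow> y \<in> U \<and> dist (?A y) (?A x) < \<epsilon> \<and> dist (?B y) (?B x) < \<epsilon>"
    unfolding eventually_nhds_metric by blast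
  \<comment> \<open>The summand 1 keeps \<open>N\<close> positive when both vectors are 0. With
    \<open>h = \<delta> / (2 * N)\<close> the parallelogram stays within distance
    \<open>\<delta> / 2\<close> of \<open>x\<close>.\<close>
  define N where "N = norm u + norm v + 1"
  define h where "h = \<delta> / (2 * N)"
  have N: "0 < N" unfolding N_def by (smt (verit) norm_ge_zero)
  then have h: "0 < h" using \<delta> by (simp add: h_def)
  have near: "dist (x + s *\<^sub>R u + t *\<^sub>R v) x < \<delta>" if "s \<in> {0..h}" "t \<in> {0..h}" for s t
  proof -
    have "dist (x + s *\<^sub>R u + t *\<^sub>R v) x = norm (s *\<^sub>R u + t *\<^sub>R v)"
      by (simp add: dist_norm add.assoc)
    also have "\<dots> \<le> norm (s *\<^sub>R u) + norm (t *\<^sub>R v)" by (rule norm_triangle_ineq)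
    also have "\<dots> \<le> h * norm u + h * norm v"
      using that by (auto intro!: add_mono mult_right_mono)
    also have "\<dots> \<le> h * N" unfolding N_def using h by (simp add: algebra_simps)
    also have "\<dots> = \<delta> / 2" using N by (simp add: h_def)
    also have "\<dots> < \<delta>" using \<delta>(1) by simp
    finally show ?thesis .
  qed
  have inU: "x + s *\<^sub>R u + t *\<^sub>R v \<in> ball x \<delta>" if "s \<in> {0..h}" "t \<in> {0..h}" for s t
    using near[OF that] by (simp add: dist_commute)
  have ball: "y \<in> ball x \<delta> \<Longrightarrow> y \<in> U" for y using \<delta>(2)[of y] by (simp add: dist_commute)
  obtain s t where st: "s \<in> {0..h}" "t \<in> {0..h}"
    "\<phi> (x + h *\<^sub>R u + h *\<^sub>R v) - \<phi> (x + h *\<^sub>R u) - \<phi> (x + h *\<^sub>R v) + \<phi> x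
      = h * h * ?A (x + s *\<^sub>R u + t *\<^sub>R v)"
    using second_difference_mean_value[OF h inU d[OF ball] du[OF ball]] by blast
  obtain s' t' where st': "s' \<in> {0..h}" "t' \<in> {0..h}"
    "\<phi> (x + h *\<^sub>R v + h *\<^sub>R u) - \<phi> (x + h *\<^sub>R v) - \<phi> (x + h *\<^sub>R u) + \<phi> x
      = h * h * ?B (x + s' *\<^sub>R v + t' *\<^sub>R u)"
  proof (rule second_difference_mean_value[OF h _ d[OF ball] dv[OF ball]])
    show "x + s *\<^sub>R v + t *\<^sub>R u \<in> ball x \<delta>" if "s \<in> {0..h}" "t \<in> {0..h}" for s t
      using inU[OF that(2,1)] by (simp add: algebra_simps)
  qed auto
  have "h * h * ?A (x + s *\<^sub>R u + t *\<^sub>R v) = h * h * ?B (x + t' *\<^sub>R u + s' *\<^sub>R v)"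
    using st(3) st'(3) by (simp add: algebra_simps)
  then have eq: "?A (x + s *\<^sub>R u + t *\<^sub>R v) = ?B (x + t' *\<^sub>R u + s' *\<^sub>R v)" using h by simp
  have close: "\<bar>A - B\<bar> < 2 * \<epsilon>" if "p = q" "\<bar>p - A\<bar> < \<epsilon>" "\<bar>q - B\<bar> < \<epsilon>" for p q A B :: real
    using that by linarith
  have "\<bar>?A x - ?B x\<bar> < 2 * \<epsilon>"
    by (rule close[OF eq])
      (use \<delta>(2)[OF near[OF st(1,2)]] \<delta>(2)[OF near[OF st'(2,1)]] in \<open>simp_all only: dist_real_def\<close>)
  then show False unfolding \<epsilon>_def by simp
qed

section \<open>Dimension of the kernel of a functional and of an injective image\<close>

lemma dim_kernel_functional:
  fixes V :: "'a::real_vector set" and L :: "'a \<Rightarrow> real"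
  assumes V: "subspace V"
    and L: "\<And>x y. x \<in> V \<Longrightarrow> y \<in> V \<Longrightarrow> L (x + y) = L x + L y" "\<And>c x. x \<in> V \<Longrightarrow> L (c *\<^sub>R x) = c * L x"
  shows "dim V = dim {x \<in> V. L x = 0} \<or> dim V = Suc (dim {x \<in> V. L x = 0})"
proof (cases "{x \<in> V. L x = 0} = V")
  case False
  define V0 where "V0 = {x \<in> V. L x = 0}"
  \<comment> \<open>Any vector outside the kernel extends a basis of the kernel to one of
    \<open>V\<close>, because \<open>x - (L x / L v) v\<close> lies in the kernel for each
    \<open>x\<close> in \<open>V\<close>.\<close>
  obtain v where v: "v \<in> V" "L v \<noteq> 0" using False by auto
  have L0: "L 0 = 0" using L(2)[of v 0] v by simp
  have V0: "subspace V0"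
    unfolding V0_def by (rule subspaceI) (use V L L0 in \<open>auto simp: subspace_0 subspace_add subspace_scale\<close>)
  obtain B where B: "B \<subseteq> V0" "independent B" "V0 \<subseteq> span B" "card B = dim V0"
    using basis_exists by blast
  have span: "span B = V0"
    using B(1,3) span_minimal[OF B(1) V0] by auto
  have "v \<notin> span B" using v by (simp add: span V0_def)
  then have indep: "independent (insert v B)" using B(2) by (rule independent_insertI)
  have "V \<subseteq> span (insert v B)"
  proof
    fix x assume x: "x \<in> V"
    define c where "c = L x / L v"
    have "x + (- c) *\<^sub>R v \<in> V0"
    proof -
      have cv: "(- c) *\<^sub>R v \<in> V" using v(1) by (rule subspace_scale[OF V])
      have "L (x + (- c) *\<^sub>R v) = L x + (- c) * L v"
        by (simp only: L(1)[OF x cv] L(2)[OF v(1)])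
      with subspace_add[OF V x cv] show ?thesis using v(2) by (simp add: V0_def c_def)
    qed
    then have "x + (- c) *\<^sub>R v \<in> span B" by (simp add: span)
    then have "x + (- c) *\<^sub>R v \<in> span (insert v B)"
      using span_mono[of B "insert v B"] by auto
    moreover have "c *\<^sub>R v \<in> span (insert v B)" by (simp add: span_base span_scale)
    ultimately have "(x + (- c) *\<^sub>R v) + c *\<^sub>R v \<in> span (insert v B)" by (rule span_add)
    then show "x \<in> span (insert v B)" by simp
  qed
  moreover have "insert v B \<subseteq> V" using B(1) v by (auto simp: V0_def)
  ultimately have "dim V = card (insert v B)" using indep by (intro dim_unique) auto
  \<comment> \<open>If \<open>B\<close> is infinite, then \<open>B\<close> and its extension by
    \<open>v\<close> both have cardinality 0, and the first alternative holds.\<close>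
  moreover have "card (insert v B) = Suc (card B)" if "finite B"
    using that \<open>v \<notin> span B\<close> span_superset[of B] by (intro card_insert_disjoint) auto
  ultimately have "dim V = dim V0 \<or> dim V = Suc (dim V0)"
    using B(4) by (cases "finite B") auto
  then show ?thesis by (simp add: V0_def)
qed simp

text \<open>Injectivity is asked on the span rather than on the whole space because the map
  \<open>lift\<close> below discards the values of a field outside \<open>K\<close>.\<close>

lemma dim_image_inj_on:
  assumes f: "linear f" and inj: "inj_on f (span S)"
  shows "dim (f ` S) = dim S"
proof -
  obtain B where B: "B \<subseteq> S" "independent B" "S \<subseteq> span B" "card B = dim S"
    using basis_exists by blast
  have sp: "span B \<subseteq> span S" by (rule span_mono[OF B(1)])
  have "independent (f ` B)"
    by (rule linear_independent_injective_image[OF f B(2) inj_on_subset[OF inj sp]])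
  moreover have "f ` S \<subseteq> span (f ` B)"
    using B(3) linear_span_image[OF f, of B] by blast
  moreover have "card (f ` B) = dim S"
    using B(1,4) inj_on_subset[OF inj] span_superset[of S] card_image by (metis order.trans)
  ultimately show ?thesis
    using B(1) by (intro dim_unique) auto
qed

section \<open>Rolle's theorem and inverse functions on intervals of any kind\<close>

lemma rolle_on_interval:
  fixes F D :: "real \<Rightarrow> real"
  assumes J: "is_interval J" "a \<in> J" "b \<in> J" "a \<noteq> b" and "F a = F b"
    and F: "\<And>t. t \<in> J \<Longrightarrow> (F has_real_derivative D t) (at t within J)"
  obtains c where "c \<in> J" "D c = 0"
proof -
  have main: thesis if "a < b" "a \<in> J" "b \<in> J" "F a = F b" for a b
  proof -
    have sub: "{a..b} \<subseteq> J" using mem_is_interval_1_I[OF J(1) that(2,3)] by auto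
    have "(F has_derivative (\<lambda>k. D t * k)) (at t within {a..b})" if "a \<le> t" "t \<le> b" for t
    proof -
      have "t \<in> J" using sub that by auto
      from has_field_derivative_subset[OF F[OF this] sub] show ?thesis
        by (simp add: has_field_derivative_def)
    qed
    from mvt_simple[OF \<open>a < b\<close> this] obtain c where "c \<in> {a<..<b}" "F b - F a = D c * (b - a)" by auto
    with that sub show thesis by (intro \<open>\<And>c. c \<in> J \<Longrightarrow> D c = 0 \<Longrightarrow> thesis\<close>[of c]) auto
  qed
  show thesis using main[of a b] main[of b a] assms by (cases "a < b") auto
qed

text \<open>This allows a derivative at \<open>t\<close> to be computed from the times near
  \<open>t\<close> at which a curve stays in one chart.\<close>

lemma at_within_openin:
  assumes "openin (top_of_set J) N" "t \<in> N"
  shows "at t within J = at t within N"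
proof -
  obtain T where "open T" "N = J \<inter> T" using assms(1) by (auto simp: openin_open)
  then show ?thesis using assms(2) by (intro at_within_nhd[of t T]) auto
qed

text \<open>By Rolle's theorem \<open>r\<close> is injective, and a continuous injection of an
  interval is a homeomorphism onto its image. With \<open>\<rho>\<close> continuous, its difference
  quotients are the reciprocals of those of \<open>r\<close>. All limits are taken within the
  intervals, which may contain end points.\<close>

lemma reparametrization_inverse:
  fixes r r' :: "real \<Rightarrow> real"
  assumes J: "is_interval J" and r: "\<And>t. t \<in> J \<Longrightarrow> (r has_real_derivative r' t) (at t within J)"
    and nz: "\<And>t. t \<in> J \<Longrightarrow> r' t \<noteq> 0"
  obtains \<rho> where "\<And>t. t \<in> J \<Longrightarrow> \<rho> (r t) = t" "\<And>t. t \<in> J \<Longrightarrow> (\<rho> has_real_derivative inverse (r' t)) (at (r t) within r ` J)"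
proof -
  have cont: "continuous_on J r"
    using r by (meson DERIV_continuous continuous_on_eq_continuous_within)
  have inj: "inj_on r J"
  proof (rule inj_onI, rule ccontr)
    fix x y assume "x \<in> J" "y \<in> J" "r x = r y" "x \<noteq> y"
    then show False using rolle_on_interval[OF J _ _ _ _ r, of x y] nz by metis
  qed
  have "path_connected J" using J by (simp add: is_interval_path_connected_1)
  then obtain \<rho> where h: "homeomorphism J (r ` J) r \<rho>"
    using homeomorphism_into_1d[OF _ cont refl inj] by blast
  have inv: "\<rho> (r t) = t" if "t \<in> J" for t using h that by (simp add: homeomorphism_def)
  have "(\<rho> has_real_derivative inverse (r' t)) (at (r t) within r ` J)" if t: "t \<in> J" for t
  proof -
    have "continuous_on (r ` J) \<rho>" using h by (simp add: homeomorphism_def)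
    then have "(\<rho> \<longlongrightarrow> t) (at (r t) within r ` J)"
      using t inv by (fastforce simp: continuous_on_def)
    moreover have "\<forall>\<^sub>F s in at (r t) within r ` J. \<rho> s \<in> J \<and> \<rho> s \<noteq> t"
      unfolding eventually_at_filter by (rule always_eventually) (use inv in auto)
    ultimately have fl: "filterlim \<rho> (at t within J) (at (r t) within r ` J)"
      unfolding filterlim_at by (auto elim: eventually_mono)
    have "((\<lambda>y. (r y - r t) / (y - t)) \<longlongrightarrow> r' t) (at t within J)"
      using r[OF t] by (simp add: has_field_derivative_iff)
    then have "((\<lambda>s. inverse ((r (\<rho> s) - r t) / (\<rho> s - t))) \<longlongrightarrow> inverse (r' t)) (at (r t) within r ` J)"
      by (intro tendsto_inverse nz[OF t] filterlim_compose[OF _ fl])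
    moreover have "\<forall>\<^sub>F s in at (r t) within r ` J. inverse ((r (\<rho> s) - r t) / (\<rho> s - t)) = (\<rho> s - \<rho> (r t)) / (s - r t)"
      unfolding eventually_at_filter by (rule always_eventually) (use inv t in auto)
    ultimately show ?thesis
      unfolding has_field_derivative_iff by (rule Lim_transform_eventually)
  qed
  with inv that show thesis by blast
qed

section \<open>The Levi-Civita connection in a chart\<close>

text \<open>\<open>A\<close> is the map given by the Gram matrix of \<open>h\<close>. Nondegeneracy
  makes it injective, and finite dimension then makes it surjective.\<close>

lemma nondegenerate_represents:
  fixes h :: "'e::euclidean_space \<Rightarrow> 'e \<Rightarrow> real"
  assumes h: "bilinear h" and nd: "\<And>w. (\<And>z. h w z = 0) \<Longrightarrow> w = 0" and l: "linear l"
  obtains w where "\<And>z. h w z = l z"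
proof -
  define A where "A w = (\<Sum>b\<in>Basis. h w b *\<^sub>R b)" for w
  have Ab: "A w \<bullet> b = h w b" if "b \<in> Basis" for w b
    unfolding A_def using that by (simp add: inner_sum_left inner_Basis if_distrib cong: if_cong)
  have linA: "linear A"
    unfolding A_def by (rule linearI)
      (simp_all add: bilinear_ladd[OF h] bilinear_lmul[OF h] scaleR_add_left sum.distrib scaleR_sum_right)
  have lin: "linear (h w)" for w using h by (simp add: bilinear_def)
  have "inj A"
  proof (rule linear_inj_on_iff_eq_0[THEN iffD2, of A UNIV, simplified, rule_format])
    show "linear A" by (rule linA)
    fix w assume "A w = 0"
    then have "h w b = 0" if "b \<in> Basis" for b using Ab[OF that, of w] by simp
    then have "h w z = 0" for z
      using linear_eq_stdbasis[OF lin module_hom_zero] by (metis)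
    then show "w = 0" by (rule nd)
  qed
  then have "surj A" using linA linear_injective_imp_surjective by blast
  then obtain w where w: "A w = (\<Sum>b\<in>Basis. l b *\<^sub>R b)" by (metis surjD)
  have "h w b = l b" if "b \<in> Basis" for b
    using Ab[OF that, of w] w that by (simp add: inner_sum_left inner_Basis if_distrib cong: if_cong)
  then have "h w = l" by (rule linear_eq_stdbasis[OF lin l])
  then show ?thesis using that[of w] by simp
qed

text \<open>A product rule with one factor merely continuous: since \<open>d x = 0\<close>, the term
  with a derivative of \<open>u\<close> would be multiplied by 0. It is the last step of the
  bootstrap in \<open>differentiable_linear_solution\<close>.\<close>

lemma has_derivative_mult_vanishing:
  fixes u d :: "'a::real_normed_vector \<Rightarrow> real"
  assumes u: "isCont u x" and d: "(d has_derivative d') (at x)" and "d x = 0"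
  shows "((\<lambda>y. u y * d y) has_derivative (\<lambda>k. u x * d' k)) (at x)"
proof -
  have bl: "bounded_linear d'" using d by (rule has_derivative_bounded_linear)
  have q: "((\<lambda>y. (d y - d x - d' (y - x)) / norm (y - x)) \<longlongrightarrow> 0) (at x)"
    using d by (simp add: has_derivative_at_within divide_inverse_commute)
  obtain B where B: "\<And>k. norm (d' k) \<le> norm k * B" using bounded_linear.bounded[OF bl] by blast
  \<comment> \<open>The remainder of the product splits into \<open>u\<close> times the remainder of
    \<open>d\<close>, and the increment of \<open>u\<close> times a bounded quotient; both tend to
    0.\<close>
  have "((\<lambda>y. (u y - u x) * (d' (y - x) / norm (y - x))) \<longlongrightarrow> 0) (at x)"
  proof (rule Lim_null_comparison)
    show "\<forall>\<^sub>F y in at x. norm ((u y - u x) * (d' (y - x) / norm (y - x))) \<le> \<bar>u y - u x\<bar> * B"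
    proof (rule always_eventually, rule allI)
      fix y show "norm ((u y - u x) * (d' (y - x) / norm (y - x))) \<le> \<bar>u y - u x\<bar> * B"
      proof (cases "y = x")
        case False
        then have "\<bar>d' (y - x) / norm (y - x)\<bar> \<le> B"
          using B[of "y - x"] by (simp add: pos_divide_le_eq mult.commute)
        then show ?thesis by (simp only: real_norm_def abs_mult mult_left_mono abs_ge_zero)
      qed simp
    qed
    show "((\<lambda>y. \<bar>u y - u x\<bar> * B) \<longlongrightarrow> 0) (at x)"
      using u unfolding isCont_def by (auto intro!: tendsto_eq_intros)
  qed
  moreover have "((\<lambda>y. u y * ((d y - d x - d' (y - x)) / norm (y - x))) \<longlongrightarrow> 0) (at x)"
    using tendsto_mult[OF u[unfolded isCont_def] q] by simp
  ultimately have "((\<lambda>y. u y * ((d y - d x - d' (y - x)) / norm (y - x))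
      + (u y - u x) * (d' (y - x) / norm (y - x))) \<longlongrightarrow> 0) (at x)"
    using tendsto_add by fastforce
  moreover have "u y * ((d y - d x - d' (y - x)) / norm (y - x)) + (u y - u x) * (d' (y - x) / norm (y - x))
      = (u y * d y - u x * d x - u x * d' (y - x)) / norm (y - x)" for y
    using \<open>d x = 0\<close> by (simp add: field_simps diff_divide_distrib[symmetric] add_divide_distrib[symmetric])
  ultimately show ?thesis
    using bounded_linear_const_mult[OF bl, of "u x"] by (simp add: has_derivative_at_within divide_inverse_commute)
qed

text \<open>A Christoffel vector is known only through the linear equation that it solves, so its
  regularity has to come from that equation. Freezing the form at \<open>x\<close> gives
  \<open>h x (w y) z = k y z - (h y - h x) (w y) z\<close>. From this \<open>w\<close> is
  successively bounded near \<open>x\<close>, continuous at \<open>x\<close>, and differentiable at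
  \<open>x\<close>.\<close>

lemma differentiable_linear_solution:
  fixes h :: "'a::real_normed_vector \<Rightarrow> 'e::euclidean_space \<Rightarrow> 'e \<Rightarrow> real"
  assumes U: "open U" "x \<in> U"
    and bil: "\<And>y. y \<in> U \<Longrightarrow> bilinear (h y)"
    and nd: "\<And>w. (\<And>z. h x w z = 0) \<Longrightarrow> w = 0"
    and dh: "\<And>v z. (\<lambda>y. h y v z) differentiable (at x)"
    and dk: "\<And>z. (\<lambda>y. k y z) differentiable (at x)"
    and eq: "\<And>y z. y \<in> U \<Longrightarrow> h y (w y) z = k y z"
  shows "w differentiable (at x)"
proof -
  define A where "A w = (\<Sum>b\<in>Basis. h x w b *\<^sub>R b)" for w
  note hx = bil[OF U(2)]
  have linA: "linear A"
    unfolding A_def by (rule linearI)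
      (simp_all add: bilinear_ladd[OF hx] bilinear_lmul[OF hx] scaleR_add_left sum.distrib scaleR_sum_right)
  have Ab: "A w \<bullet> b = h x w b" if "b \<in> Basis" for w b
    unfolding A_def using that by (simp add: inner_sum_left inner_Basis if_distrib cong: if_cong)
  have lin: "linear (h x w)" for w using hx by (simp add: bilinear_def)
  have "inj A"
  proof (rule linear_inj_on_iff_eq_0[THEN iffD2, of A UNIV, simplified, rule_format])
    show "linear A" by (rule linA)
    fix w assume "A w = 0"
    then have "h x w b = 0" if "b \<in> Basis" for b using Ab[OF that, of w] by simp
    then have "h x w z = 0" for z
      using linear_eq_stdbasis[OF lin module_hom_zero] by (metis)
    then show "w = 0" by (rule nd)
  qed
  then obtain B where B: "linear B" "\<And>v. B (A v) = v"
    using linear_injective_left_inverse[OF linA] by (auto simp: o_def fun_eq_iff)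
  have blB: "bounded_linear B" using B(1) by (simp add: linear_conv_bounded_linear)
  define K where "K y = B (\<Sum>b\<in>Basis. k y b *\<^sub>R b)" for y
  have w_eq: "w y = K y - (\<Sum>b\<in>Basis. \<Sum>c\<in>Basis. ((w y \<bullet> c) * (h y c b - h x c b)) *\<^sub>R B b)"
    if y: "y \<in> U" for y
  proof -
    have expand: "h y' (w y) b = (\<Sum>c\<in>Basis. (w y \<bullet> c) * h y' c b)" if "y' \<in> U" for y' b
    proof -
      have "linear (\<lambda>v. h y' v b)" using bil[OF that] by (simp add: bilinear_def)
      from linear_sum[OF this, of "\<lambda>c. (w y \<bullet> c) *\<^sub>R c" Basis] linear_scale[OF this]
      show ?thesis by (simp add: euclidean_representation)
    qed
    have "A (w y) = (\<Sum>b\<in>Basis. (k y b - (\<Sum>c\<in>Basis. (w y \<bullet> c) * (h y c b - h x c b))) *\<^sub>R b)"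
      unfolding A_def
    proof (rule sum.cong[OF refl])
      fix b :: 'e
      have "(\<Sum>c\<in>Basis. (w y \<bullet> c) * (h y c b - h x c b)) = h y (w y) b - h x (w y) b"
        by (simp add: expand[OF y] expand[OF U(2)] algebra_simps sum_subtractf)
      then show "h x (w y) b *\<^sub>R b = (k y b - (\<Sum>c\<in>Basis. (w y \<bullet> c) * (h y c b - h x c b))) *\<^sub>R b"
        using eq[OF y, of b] by simp
    qed
    also have "\<dots> = (\<Sum>b\<in>Basis. k y b *\<^sub>R b)
        - (\<Sum>b\<in>Basis. \<Sum>c\<in>Basis. ((w y \<bullet> c) * (h y c b - h x c b)) *\<^sub>R b)"
      by (simp add: scaleR_diff_left sum_subtractf scaleR_sum_left)
    finally have "B (A (w y)) = K y - (\<Sum>b\<in>Basis. \<Sum>c\<in>Basis. ((w y \<bullet> c) * (h y c b - h x c b)) *\<^sub>R B b)"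
      unfolding K_def by (simp add: linear_diff[OF B(1)] linear_sum[OF B(1)] linear_scale[OF B(1)])
    then show ?thesis by (simp add: B(2))
  qed
  have dK: "K differentiable (at x)"
    unfolding K_def
    by (rule differentiable_chain_at[of "\<lambda>y. \<Sum>b\<in>Basis. k y b *\<^sub>R b" x B, unfolded o_def])
       (auto intro!: differentiable_sum differentiable_scaleR dk bounded_linear_imp_differentiable[OF blB])
  then have contK: "isCont K x" by (rule differentiable_imp_continuous_within)
  define \<epsilon> where "\<epsilon> y = (\<Sum>b\<in>Basis. \<Sum>c\<in>Basis. \<bar>h y c b - h x c b\<bar> * norm (B b))" for y
  have conth: "((\<lambda>y. h y c b) \<longlongrightarrow> h x c b) (at x)" for c b
    using differentiable_imp_continuous_within[OF dh] by (simp add: isCont_def continuous_within)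
  have "(\<epsilon> \<longlongrightarrow> (\<Sum>b\<in>Basis. \<Sum>c\<in>Basis. \<bar>h x c b - h x c b\<bar> * norm (B b))) (at x)"
    unfolding \<epsilon>_def by (intro tendsto_intros conth)
  then have \<epsilon>0: "(\<epsilon> \<longlongrightarrow> 0) (at x)" by simp
  have rem: "norm (\<Sum>b\<in>Basis. \<Sum>c\<in>Basis. ((w y \<bullet> c) * (h y c b - h x c b)) *\<^sub>R B b) \<le> norm (w y) * \<epsilon> y" for y
  proof -
    have "norm (\<Sum>b\<in>Basis. \<Sum>c\<in>Basis. ((w y \<bullet> c) * (h y c b - h x c b)) *\<^sub>R B b)
        \<le> (\<Sum>b\<in>Basis. \<Sum>c\<in>Basis. norm (w y) * (\<bar>h y c b - h x c b\<bar> * norm (B b)))"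
      by (intro sum_norm_le order.trans[OF norm_sum] sum_mono)
         (auto simp: abs_mult mult.assoc intro!: mult_right_mono Basis_le_norm)
    then show ?thesis by (simp add: \<epsilon>_def sum_distrib_left)
  qed
  have inU: "\<forall>\<^sub>F y in at x. y \<in> U" using U eventually_at_topological by blast
  have "\<forall>\<^sub>F y in at x. norm (w y) \<le> 2 * (norm (K x) + 1)"
  proof -
    have "\<forall>\<^sub>F y in at x. \<epsilon> y < 1 / 2" using order_tendstoD(2)[OF \<epsilon>0, of "1/2"] by simp
    moreover have "\<forall>\<^sub>F y in at x. norm (K y) < norm (K x) + 1"
      using contK unfolding isCont_def by (intro order_tendstoD(2)[OF tendsto_norm]) auto
    ultimately show ?thesis using inU
    proof eventually_elim
      case (elim y)
      \<comment> \<open>Absorption: as \<open>\<epsilon> y < 1 / 2\<close>, half of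
        \<open>norm (w y)\<close> moves to the left side. This bounds \<open>w\<close> near
        \<open>x\<close> before anything is known about its continuity.\<close>
      have "norm (w y) \<le> norm (K y) + norm (w y) * \<epsilon> y"
        using norm_triangle_ineq4 rem[of y] w_eq[OF elim(3)] by (smt (verit, best))
      also have "norm (w y) * \<epsilon> y \<le> norm (w y) * (1 / 2)"
        using elim(1) by (intro mult_left_mono) auto
      finally show ?case using elim(2) by simp
    qed
  qed
  then have "((\<lambda>y. norm (w y) * \<epsilon> y) \<longlongrightarrow> 0) (at x)"
    by (intro lim_null_mult_left_bounded[OF _ \<epsilon>0, of _ "2 * (norm (K x) + 1)"]) simp
  have K: "K x = w x" using w_eq[OF U(2)] by simp
  have "((\<lambda>y. \<Sum>b\<in>Basis. \<Sum>c\<in>Basis. ((w y \<bullet> c) * (h y c b - h x c b)) *\<^sub>R B b) \<longlongrightarrow> 0) (at x)"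
    by (rule Lim_null_comparison[OF always_eventually \<open>((\<lambda>y. norm (w y) * \<epsilon> y) \<longlongrightarrow> 0) (at x)\<close>])
       (use rem in blast)
  then have "((\<lambda>y. K y - (\<Sum>b\<in>Basis. \<Sum>c\<in>Basis. ((w y \<bullet> c) * (h y c b - h x c b)) *\<^sub>R B b)) \<longlongrightarrow> K x) (at x)"
    using tendsto_diff[OF contK[unfolded isCont_def]] by fastforce
  moreover have "\<forall>\<^sub>F y in at x. K y - (\<Sum>b\<in>Basis. \<Sum>c\<in>Basis. ((w y \<bullet> c) * (h y c b - h x c b)) *\<^sub>R B b) = w y"
    by (rule eventually_mono[OF inU]) (rule w_eq[symmetric])
  ultimately have "(w \<longlongrightarrow> K x) (at x)" by (rule Lim_transform_eventually)
  then have "(w \<longlongrightarrow> w x) (at x)" by (simp only: K)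
  then have contw: "isCont (\<lambda>y. w y \<bullet> c) x" for c
    unfolding isCont_def by (intro tendsto_intros)
  \<comment> \<open>Each coefficient is a function now known to be continuous at \<open>x\<close>,
    times a differentiable one that vanishes there.\<close>
  have "(\<lambda>y. (w y \<bullet> c) * (h y c b - h x c b)) differentiable (at x)" for b c
  proof -
    obtain D where "((\<lambda>y. h y c b) has_derivative D) (at x)" using dh unfolding differentiable_def by blast
    then have "((\<lambda>y. h y c b - h x c b) has_derivative D) (at x)" by (auto intro!: derivative_eq_intros)
    from has_derivative_mult_vanishing[OF contw this] show ?thesis unfolding differentiable_def by auto
  qed
  then have "(\<lambda>y. K y - (\<Sum>b\<in>Basis. \<Sum>c\<in>Basis. ((w y \<bullet> c) * (h y c b - h x c b)) *\<^sub>R B b)) differentiable (at x)"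
    by (intro differentiable_diff dK differentiable_sum ballI differentiable_scaleR differentiable_const) auto
  then obtain D where "((\<lambda>y. K y - (\<Sum>b\<in>Basis. \<Sum>c\<in>Basis. ((w y \<bullet> c) * (h y c b - h x c b)) *\<^sub>R B b))
      has_derivative D) (at x)"
    unfolding differentiable_def by blast
  then have "(w has_derivative D) (at x)"
    by (rule has_derivative_transform_within_open[OF _ U]) (rule w_eq[symmetric])
  then show ?thesis unfolding differentiable_def by blast
qed

section \<open>Christoffel vectors and metric compatibility in a Riemannian chart\<close>

locale chart_metric =
  fixes U :: "'e::euclidean_space set" and h :: "'e \<Rightarrow> 'e \<Rightarrow> 'e \<Rightarrow> real"
  assumes open_U: "open U"
    and smooth: "smooth_on U (\<lambda>x. h x u v)"
    and bil: "x \<in> U \<Longrightarrow> bilinear (h x)"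
    and sym: "x \<in> U \<Longrightarrow> h x u v = h x v u"
    and pos: "x \<in> U \<Longrightarrow> u \<noteq> 0 \<Longrightarrow> 0 < h x u u"
begin

definition dh :: "'e \<Rightarrow> 'e \<Rightarrow> 'e \<Rightarrow> 'e \<Rightarrow> real" where
  "dh x u v w = frechet_derivative (\<lambda>y. h y v w) (at x) u"

abbreviation \<Gamma> :: "'e \<Rightarrow> 'e \<Rightarrow> 'e \<Rightarrow> 'e" where
  "\<Gamma> \<equiv> christoffel h"

lemmas bil_simps = bilinear_ladd[OF bil] bilinear_radd[OF bil] bilinear_lmul[OF bil] bilinear_rmul[OF bil]
  bilinear_lsub[OF bil] bilinear_rsub[OF bil] bilinear_lneg[OF bil] bilinear_rneg[OF bil]
  bilinear_lzero[OF bil] bilinear_rzero[OF bil]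

lemma Ck: "Ck_on k U (\<lambda>x. h x u v)"
  using smooth by (simp add: smooth_on_def)

lemma h_differentiable: "x \<in> U \<Longrightarrow> (\<lambda>y. h y v w) differentiable (at x)"
  using Ck[of 1] by simp

lemma h_has_derivative: "x \<in> U \<Longrightarrow> ((\<lambda>y. h y v w) has_derivative (\<lambda>u. dh x u v w)) (at x)"
  using h_differentiable[unfolded frechet_derivative_works] by (simp add: dh_def)

lemma dh_differentiable: "x \<in> U \<Longrightarrow> (\<lambda>y. dh y u v w) differentiable (at x)"
  using Ck[of 2] unfolding dh_def by (simp add: numeral_2_eq_2)

lemma continuous_on_ddh: "continuous_on U (\<lambda>y. frechet_derivative (\<lambda>z. dh z u v w) (at y) u')"
  using Ck[of 2] unfolding dh_def by (simp add: numeral_2_eq_2)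

lemma dh_eqI:
  assumes "x \<in> U" and "(F has_derivative D) (at x)" and "\<And>y. y \<in> U \<Longrightarrow> F y = h y v w"
  shows "dh x u v w = D u"
proof -
  have "((\<lambda>y. h y v w) has_derivative D) (at x)"
    by (rule has_derivative_transform_within_open[OF assms(2) open_U assms(1)]) (rule assms(3))
  then show ?thesis
    using has_derivative_unique[OF h_has_derivative[OF assms(1)]] by (metis)
qed

lemma dh_bilinear:
  assumes x: "x \<in> U"
  shows "dh x u (v + v') w = dh x u v w + dh x u v' w"
    and "dh x u (c *\<^sub>R v) w = c * dh x u v w"
    and "dh x u v (w + w') = dh x u v w + dh x u v w'"
    and "dh x u v (c *\<^sub>R w) = c * dh x u v w"
    and "dh x (u + u') v w = dh x u v w + dh x u' v w"
    and "dh x (c *\<^sub>R u) v w = c * dh x u v w"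
    and "dh x u v w = dh x u w v"
proof -
  have lin: "linear (\<lambda>u. dh x u v w)"
    using h_has_derivative[OF x] has_derivative_linear by blast
  show "dh x (u + u') v w = dh x u v w + dh x u' v w" "dh x (c *\<^sub>R u) v w = c * dh x u v w"
    using linear_add[OF lin] linear_scale[OF lin] by auto
  show "dh x u (v + v') w = dh x u v w + dh x u v' w"
    by (rule dh_eqI[OF x has_derivative_add[OF h_has_derivative[OF x] h_has_derivative[OF x]]])
       (simp add: bil_simps)
  show "dh x u v (w + w') = dh x u v w + dh x u v w'"
    by (rule dh_eqI[OF x has_derivative_add[OF h_has_derivative[OF x] h_has_derivative[OF x]]])
       (simp add: bil_simps)
  show "dh x u (c *\<^sub>R v) w = c * dh x u v w"
    by (rule dh_eqI[OF x has_derivative_mult_right[OF h_has_derivative[OF x]]])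
       (simp add: bil_simps)
  show "dh x u v (c *\<^sub>R w) = c * dh x u v w"
    by (rule dh_eqI[OF x has_derivative_mult_right[OF h_has_derivative[OF x]]])
       (simp add: bil_simps)
  show "dh x u v w = dh x u w v"
    by (rule dh_eqI[OF x h_has_derivative[OF x]]) (simp add: sym)
qed

lemma h_eqI:
  assumes x: "x \<in> U" and eq: "\<And>z. h x v z = h x w z"
  shows "v = w"
proof (rule ccontr)
  assume "v \<noteq> w"
  then have "0 < h x (v - w) (v - w)" using pos[OF x] by simp
  then show False using eq by (simp add: bil_simps x)
qed

text \<open>Justifies the definite description in \<open>christoffel\<close>: the right side is
  linear in \<open>z\<close>, hence represented by a vector, and definiteness makes that vector
  unique.\<close>

lemma koszul:
  assumes x: "x \<in> U"
  shows "2 * h x (\<Gamma> x u v) z = dh x u v z + dh x v u z - dh x z u v"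
proof -
  let ?l = "\<lambda>z. (dh x u v z + dh x v u z - dh x z u v) / 2"
  have "linear ?l"
    by (rule linearI) (simp_all add: dh_bilinear[OF x] field_simps)
  moreover have "w = 0" if "\<And>z. h x w z = 0" for w
    using h_eqI[OF x, of w 0] that by (simp add: bil_simps x)
  ultimately obtain w where w: "\<And>z. h x w z = ?l z"
    using nondegenerate_represents[OF bil[OF x]] by blast
  have \<Gamma>: "\<Gamma> x u v = (THE w. \<forall>z. 2 * h x w z = dh x u v z + dh x v u z - dh x z u v)"
    by (simp add: christoffel_def dh_def)
  have "\<forall>z. 2 * h x (\<Gamma> x u v) z = dh x u v z + dh x v u z - dh x z u v"
    unfolding \<Gamma>
  proof (rule theI[of _ w])
    show "\<forall>z. 2 * h x w z = dh x u v z + dh x v u z - dh x z u v" by (simp add: w)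
    fix w' assume eq: "\<forall>z. 2 * h x w' z = dh x u v z + dh x v u z - dh x z u v"
    show "w' = w"
    proof (rule h_eqI[OF x])
      fix z show "h x w' z = h x w z" using spec[OF eq, of z] w[of z] by simp
    qed
  qed
  then show ?thesis by (rule spec)
qed

lemma christoffel_eqI:
  assumes x: "x \<in> U" and "\<And>z. 2 * h x w z = dh x u v z + dh x v u z - dh x z u v"
  shows "\<Gamma> x u v = w"
  by (rule h_eqI[OF x]) (use koszul[OF x, of u v] assms(2) in \<open>metis mult_cancel_left zero_neq_numeral\<close>)

lemma christoffel_sym: "x \<in> U \<Longrightarrow> \<Gamma> x u v = \<Gamma> x v u"
  by (rule christoffel_eqI) (simp_all add: koszul dh_bilinear(7)[of x _ u v])

lemma christoffel_linear:
  assumes x: "x \<in> U"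
  shows "\<Gamma> x (u + u') v = \<Gamma> x u v + \<Gamma> x u' v"
    and "\<Gamma> x (c *\<^sub>R u) v = c *\<^sub>R \<Gamma> x u v"
    and "\<Gamma> x u (v + v') = \<Gamma> x u v + \<Gamma> x u v'"
    and "\<Gamma> x u (c *\<^sub>R v) = c *\<^sub>R \<Gamma> x u v"
  by (rule christoffel_eqI[OF x];
      simp add: bil_simps x dh_bilinear(1-6)[OF x] distrib_left koszul[OF x] mult.left_commute[of 2];
      simp add: algebra_simps)+

text \<open>In the sum of the Koszul formulas for \<open>\<Gamma> x u v\<close> and
  \<open>\<Gamma> x u w\<close>, the derivatives in the directions \<open>v\<close> and
  \<open>w\<close> cancel.\<close>

lemma metric_compatible:
  assumes x: "x \<in> U"
  shows "dh x u v w = h x (\<Gamma> x u v) w + h x v (\<Gamma> x u w)"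
  using koszul[OF x, of u v w] koszul[OF x, of u w v] dh_bilinear(7)[OF x, of u v w]
    dh_bilinear(7)[OF x, of v u w] dh_bilinear(7)[OF x, of w u v] sym[OF x, of v]
  by simp

lemma christoffel_differentiable:
  assumes x: "x \<in> U"
  shows "(\<lambda>y. \<Gamma> y u v) differentiable (at x)"
proof (rule differentiable_linear_solution[OF open_U x bil])
  show "w = 0" if "\<And>z. h x w z = 0" for w
    using h_eqI[OF x, of w 0] that by (simp add: bil_simps x)
  show "h y (\<Gamma> y u v) z = (dh y u v z + dh y v u z - dh y z u v) / 2" if "y \<in> U" for y z
    using koszul[OF that, of u v z] by simp
  show "(\<lambda>y. (dh y u v z + dh y v u z - dh y z u v) / 2) differentiable (at x)" for z
    using dh_differentiable[OF x] by simp
qed (use h_differentiable[OF x] in auto)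

text \<open>Smoothness of the metric is given for fixed vector arguments only. Expanding in the
  standard basis leaves products of scalar components with functions \<open>h y i j\<close> of this
  kind.\<close>

lemma h_moving_has_derivative:
  assumes X: "(X has_derivative X') (at t within S)" and Y: "(Y has_derivative Y') (at t within S)"
    and c: "(c has_derivative c') (at t within S)" and ct: "c t \<in> U"
    and cS: "\<And>s. s \<in> S \<Longrightarrow> c s \<in> U" and t: "t \<in> S"
  shows "((\<lambda>s. h (c s) (X s) (Y s)) has_derivative
    (\<lambda>k. dh (c t) (c' k) (X t) (Y t) + h (c t) (X' k) (Y t) + h (c t) (X t) (Y' k))) (at t within S)"
proof -
  have expand: "h y v w = (\<Sum>i\<in>Basis. \<Sum>j\<in>Basis. (v \<bullet> i) * (w \<bullet> j) * h y i j)" if "y \<in> U" for y v w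
  proof -
    have "h y (\<Sum>i\<in>Basis. (v \<bullet> i) *\<^sub>R i) (\<Sum>j\<in>Basis. (w \<bullet> j) *\<^sub>R j)
        = (\<Sum>i\<in>Basis. \<Sum>j\<in>Basis. (v \<bullet> i) * (w \<bullet> j) * h y i j)"
      unfolding bilinear_sum[OF bil[OF that]]
      by (simp add: bil_simps that sum.cartesian_product mult.assoc mult.left_commute)
    then show ?thesis by (simp add: euclidean_representation)
  qed
  have dexpand: "dh y u v w = (\<Sum>i\<in>Basis. \<Sum>j\<in>Basis. (v \<bullet> i) * (w \<bullet> j) * dh y u i j)" if "y \<in> U" for y u v w
  proof (rule dh_eqI[OF that, where F="\<lambda>y. \<Sum>i\<in>Basis. \<Sum>j\<in>Basis. (v \<bullet> i) * (w \<bullet> j) * h y i j"])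
    show "((\<lambda>y. \<Sum>i\<in>Basis. \<Sum>j\<in>Basis. (v \<bullet> i) * (w \<bullet> j) * h y i j) has_derivative
      (\<lambda>u. \<Sum>i\<in>Basis. \<Sum>j\<in>Basis. (v \<bullet> i) * (w \<bullet> j) * dh y u i j)) (at y)"
      by (intro has_derivative_sum has_derivative_mult_right h_has_derivative[OF that])
  qed (simp add: expand)
  have "((\<lambda>s. \<Sum>i\<in>Basis. \<Sum>j\<in>Basis. (X s \<bullet> i) * (Y s \<bullet> j) * h (c s) i j) has_derivative
    (\<lambda>k. \<Sum>i\<in>Basis. \<Sum>j\<in>Basis. (X t \<bullet> i) * (Y t \<bullet> j) * dh (c t) (c' k) i j +
       ((X t \<bullet> i) * (Y' k \<bullet> j) + (X' k \<bullet> i) * (Y t \<bullet> j)) * h (c t) i j)) (at t within S)"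
    by (intro has_derivative_sum has_derivative_mult has_derivative_inner_left X Y
        has_derivative_compose[OF c h_has_derivative[OF ct]])
  then have "((\<lambda>s. \<Sum>i\<in>Basis. \<Sum>j\<in>Basis. (X s \<bullet> i) * (Y s \<bullet> j) * h (c s) i j) has_derivative
    (\<lambda>k. dh (c t) (c' k) (X t) (Y t) + h (c t) (X' k) (Y t) + h (c t) (X t) (Y' k))) (at t within S)"
    unfolding dexpand[OF ct, of _ "X t" "Y t"] expand[OF ct, of _ "Y t"] expand[OF ct, of "X t"]
    by (simp add: algebra_simps sum.distrib)
  then show ?thesis
    by (rule has_derivative_transform[OF t, rotated]) (use cS expand in auto)
qed

lemma covariant_product_rule:
  assumes X: "(X has_vector_derivative X') (at t within S)" and Y: "(Y has_vector_derivative Y') (at t within S)"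
    and c: "(c has_vector_derivative c') (at t within S)"
    and cS: "\<And>s. s \<in> S \<Longrightarrow> c s \<in> U" and t: "t \<in> S"
  shows "((\<lambda>s. h (c s) (X s) (Y s)) has_real_derivative
    h (c t) (X' + \<Gamma> (c t) c' (X t)) (Y t) + h (c t) (X t) (Y' + \<Gamma> (c t) c' (Y t))) (at t within S)"
proof -
  have ct: "c t \<in> U" using cS t .
  show ?thesis
    using h_moving_has_derivative[OF X[unfolded has_vector_derivative_def] Y[unfolded has_vector_derivative_def]
        c[unfolded has_vector_derivative_def] ct cS t]
    unfolding has_field_derivative_def
    by (rule has_derivative_eq_rhs) (auto simp: fun_eq_iff dh_bilinear[OF ct] bil_simps ct metric_compatible algebra_simps)
qed

end

section \<open>Connection and curvature of a warped product chart\<close>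

text \<open>The hypotheses mention only the Christoffel vectors, so the lemma serves the Lorentz
  metric too, which is outside the locale \<open>chart_metric\<close>.\<close>

lemma curvature_linear:
  assumes U: "open U" "x \<in> U"
    and add: "\<And>y u u' v. y \<in> U \<Longrightarrow> christoffel h y (u + u') v = christoffel h y u v + christoffel h y u' v"
      "\<And>y u v v'. y \<in> U \<Longrightarrow> christoffel h y u (v + v') = christoffel h y u v + christoffel h y u v'"
    and scale: "\<And>y c u v. y \<in> U \<Longrightarrow> christoffel h y (c *\<^sub>R u) v = c *\<^sub>R christoffel h y u v"
      "\<And>y c u v. y \<in> U \<Longrightarrow> christoffel h y u (c *\<^sub>R v) = c *\<^sub>R christoffel h y u v"
    and d: "\<And>u v. (\<lambda>y. christoffel h y u v) differentiable (at x)"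
  shows "curvature h x (u + u') v w = curvature h x u v w + curvature h x u' v w"
    and "curvature h x (c *\<^sub>R u) v w = c *\<^sub>R curvature h x u v w"
proof -
  let ?D = "\<lambda>u v w. frechet_derivative (\<lambda>y. christoffel h y v w) (at x) u"
  have D: "((\<lambda>y. christoffel h y v w) has_derivative (\<lambda>u. ?D u v w)) (at x)" for v w
    using d[unfolded frechet_derivative_works] .
  have lin: "linear (\<lambda>u. ?D u v w)" for v w
    using D has_derivative_linear by blast
  have "((\<lambda>y. christoffel h y (u + u') w) has_derivative (\<lambda>k. ?D k u w + ?D k u' w)) (at x)"
    by (rule has_derivative_transform_within_open[OF has_derivative_add[OF D D] U]) (simp add: add)
  from has_derivative_unique[OF this D]
  have "?D v (u + u') w = ?D v u w + ?D v u' w" by metis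
  then show "curvature h x (u + u') v w = curvature h x u v w + curvature h x u' v w"
    unfolding curvature_def by (simp add: linear_add[OF lin] add U(2))
  have "((\<lambda>y. christoffel h y (c *\<^sub>R u) w) has_derivative (\<lambda>k. c *\<^sub>R ?D k u w)) (at x)"
    by (rule has_derivative_transform_within_open[OF has_derivative_scaleR_right[OF D] U]) (simp add: scale)
  from has_derivative_unique[OF this D]
  have "?D v (c *\<^sub>R u) w = c *\<^sub>R ?D v u w" by metis
  then show "curvature h x (c *\<^sub>R u) v w = c *\<^sub>R curvature h x u v w"
    unfolding curvature_def by (simp add: linear_scale[OF lin] scale U(2) algebra_simps)
qed

section \<open>Skew symmetry of the curvature of a Riemannian chart\<close>

context chart_metric
begin

definition d\<Gamma> :: "'e \<Rightarrow> 'e \<Rightarrow> 'e \<Rightarrow> 'e \<Rightarrow> 'e" where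
  "d\<Gamma> x u v w = frechet_derivative (\<lambda>y. \<Gamma> y v w) (at x) u"

lemma christoffel_has_derivative:
  "x \<in> U \<Longrightarrow> ((\<lambda>y. \<Gamma> y v w) has_derivative (\<lambda>u. d\<Gamma> x u v w)) (at x)"
  using christoffel_differentiable[unfolded frechet_derivative_works] by (simp add: d\<Gamma>_def)

text \<open>For equal arguments metric compatibility says that \<open>dh y v' v v\<close> is twice
  \<open>h y (\<Gamma> y v' v) v\<close>; this identity is differentiated in direction
  \<open>u\<close>.\<close>

lemma second_derivative_metric:
  assumes x: "x \<in> U"
  shows "frechet_derivative (\<lambda>y. dh y v' v v) (at x) u
    = 2 * (dh x u (\<Gamma> x v' v) v + h x (d\<Gamma> x u v' v) v)"
proof -
  have "((\<lambda>y. h y (\<Gamma> y v' v) v) has_derivative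
      (\<lambda>k. dh x k (\<Gamma> x v' v) v + h x (d\<Gamma> x k v' v) v + h x (\<Gamma> x v' v) 0)) (at x within U)"
    by (rule h_moving_has_derivative) (use x in \<open>auto intro: has_derivative_at_withinI christoffel_has_derivative\<close>)
  then have "((\<lambda>y. h y (\<Gamma> y v' v) v) has_derivative
      (\<lambda>k. dh x k (\<Gamma> x v' v) v + h x (d\<Gamma> x k v' v) v)) (at x)"
    using at_within_open[OF x open_U] by (simp add: bil_simps x)
  from has_derivative_mult_right[OF this, of 2]
  have "((\<lambda>y. dh y v' v v) has_derivative
      (\<lambda>k. 2 * (dh x k (\<Gamma> x v' v) v + h x (d\<Gamma> x k v' v) v))) (at x)"
    by (rule has_derivative_transform_within_open[OF _ open_U x])
       (simp add: metric_compatible sym)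
  from fun_cong[OF frechet_derivative_at[OF this], of u] show ?thesis by simp
qed

text \<open>The second derivatives of \<open>h y v v\<close> in the directions \<open>u\<close> and
  \<open>v\<close> commute. Rewritten with Christoffel vectors, their difference is twice the
  asserted product. This is what makes the product of a Jacobi field with the velocity
  affine.\<close>

lemma curvature_skew:
  assumes x: "x \<in> U"
  shows "h x (curvature h x u v v) v = 0"
proof -
  have "frechet_derivative (\<lambda>y. dh y v v v) (at x) u = frechet_derivative (\<lambda>y. dh y u v v) (at x) v"
    unfolding dh_def
    by (rule schwarz_directional[OF open_U x])
       (use h_differentiable dh_differentiable continuous_on_ddh in \<open>simp_all add: dh_def\<close>)
  then have "h x (d\<Gamma> x u v v) v - h x (d\<Gamma> x v u v) v
      = dh x v (\<Gamma> x u v) v - dh x u (\<Gamma> x v v) v"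
    using second_derivative_metric[OF x] by simp
  also have "\<dots> = h x (\<Gamma> x v (\<Gamma> x u v)) v - h x (\<Gamma> x u (\<Gamma> x v v)) v"
    using metric_compatible[OF x] sym[OF x, of "\<Gamma> x u v"] by simp
  finally show ?thesis
    unfolding curvature_def d\<Gamma>_def[symmetric] by (simp add: bil_simps x)
qed

end

section \<open>The Lorentz metric over one fiber chart\<close>

locale grw_chart = chart_metric U h for U :: "'e::euclidean_space set" and h +
  fixes I :: "real set" and f f1 f2 :: "real \<Rightarrow> real"
  assumes open_I: "open I"
    and f_pos: "\<tau> \<in> I \<Longrightarrow> 0 < f \<tau>"
    and f_deriv: "\<tau> \<in> I \<Longrightarrow> (f has_real_derivative f1 \<tau>) (at \<tau>)"
    and f1_deriv: "\<tau> \<in> I \<Longrightarrow> (f1 has_real_derivative f2 \<tau>) (at \<tau>)"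
begin

definition H :: "real \<times> 'e \<Rightarrow> real \<times> 'e \<Rightarrow> real \<times> 'e \<Rightarrow> real" where
  "H = (\<lambda>(\<tau>, x) (a, u) (b, v). - (a * b) + (f \<tau>)\<^sup>2 * h x u v)"

lemma H_simp [simp]: "H (\<tau>, x) (a, u) (b, v) = - (a * b) + (f \<tau>)\<^sup>2 * h x u v"
  by (simp add: H_def)

lemma has_derivative_along_base:
  assumes "(F has_real_derivative F') (at \<tau>)"
  shows "((\<lambda>y. F (fst y)) has_derivative (\<lambda>k. F' * fst k)) (at (\<tau>, x))"
proof -
  have "(F has_derivative (\<lambda>k. F' * k)) (at (fst (\<tau>, x)))"
    using assms by (simp add: has_field_derivative_def)
  from has_derivative_compose[OF has_derivative_fst[OF has_derivative_ident] this] show ?thesis .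
qed

lemma has_derivative_along_fiber:
  assumes "(F has_derivative F') (at x)"
  shows "((\<lambda>y. F (snd y)) has_derivative (\<lambda>k. F' (snd k))) (at (\<tau>, x))"
proof -
  have "(F has_derivative F') (at (snd (\<tau>, x)))"
    using assms by simp
  from has_derivative_compose[OF has_derivative_snd[OF has_derivative_ident] this] show ?thesis .
qed

lemma H_has_derivative:
  assumes "\<tau> \<in> I" "x \<in> U"
  shows "((\<lambda>y. H y (b, v) (c, w)) has_derivative
    (\<lambda>k. 2 * f \<tau> * f1 \<tau> * fst k * h x v w + (f \<tau>)\<^sup>2 * dh x (snd k) v w)) (at (\<tau>, x))"
proof -
  have "((\<lambda>y. - (b * c) + (f (fst y))\<^sup>2 * h (snd y) v w) has_derivative
    (\<lambda>k. 2 * f \<tau> * f1 \<tau> * fst k * h x v w + (f \<tau>)\<^sup>2 * dh x (snd k) v w)) (at (\<tau>, x))"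
    by (rule derivative_eq_intros has_derivative_along_base[OF f_deriv[OF assms(1)]]
        has_derivative_along_fiber[OF h_has_derivative[OF assms(2)]] refl)+
       (simp add: fun_eq_iff algebra_simps)
  moreover have "(\<lambda>y. H y (b, v) (c, w)) = (\<lambda>y. - (b * c) + (f (fst y))\<^sup>2 * h (snd y) v w)"
    by (auto simp: fun_eq_iff)
  ultimately show ?thesis by simp
qed

lemma christoffel_H:
  assumes "\<tau> \<in> I" "x \<in> U"
  shows "christoffel H (\<tau>, x) (a, u) (b, v)
    = (f \<tau> * f1 \<tau> * h x u v, (f1 \<tau> / f \<tau>) *\<^sub>R (a *\<^sub>R v + b *\<^sub>R u) + \<Gamma> x u v)"
proof -
  have D: "frechet_derivative (\<lambda>y. H y (b, v) (c, w)) (at (\<tau>, x)) k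
      = 2 * f \<tau> * f1 \<tau> * fst k * h x v w + (f \<tau>)\<^sup>2 * dh x (snd k) v w" for b v c w k
    by (rule fun_cong[OF frechet_derivative_at[OF H_has_derivative[OF assms]], symmetric])
  have f: "f \<tau> > 0" using f_pos assms by simp
  let ?G = "(f \<tau> * f1 \<tau> * h x u v, (f1 \<tau> / f \<tau>) *\<^sub>R (a *\<^sub>R v + b *\<^sub>R u) + \<Gamma> x u v)"
  have G: "2 * H (\<tau>, x) ?G z = frechet_derivative (\<lambda>y. H y (b, v) z) (at (\<tau>, x)) (a, u)
      + frechet_derivative (\<lambda>y. H y (a, u) z) (at (\<tau>, x)) (b, v)
      - frechet_derivative (\<lambda>y. H y (a, u) (b, v)) (at (\<tau>, x)) z" for z
  proof (cases z)
    case (Pair c w)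
    have "2 * H (\<tau>, x) ?G (c, w) = - 2 * f \<tau> * f1 \<tau> * c * h x u v
        + 2 * f \<tau> * f1 \<tau> * (a * h x v w + b * h x u w) + (f \<tau>)\<^sup>2 * (2 * h x (\<Gamma> x u v) w)"
      using f by (simp add: bil_simps assms(2) field_simps power2_eq_square)
    then show ?thesis
      unfolding Pair D koszul[OF assms(2)] by (simp add: algebra_simps)
  qed
  show ?thesis
    unfolding christoffel_def[of H]
  proof (rule the_equality)
    fix W assume W: "\<forall>z. 2 * H (\<tau>, x) W z = frechet_derivative (\<lambda>y. H y (b, v) z) (at (\<tau>, x)) (a, u)
      + frechet_derivative (\<lambda>y. H y (a, u) z) (at (\<tau>, x)) (b, v)
      - frechet_derivative (\<lambda>y. H y (a, u) (b, v)) (at (\<tau>, x)) z"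
    have "2 * H (\<tau>, x) W z = 2 * H (\<tau>, x) ?G z" for z
      by (rule trans[OF spec[OF W] G[symmetric]])
    then have eq: "H (\<tau>, x) W z = H (\<tau>, x) ?G z" for z
      by (metis mult_left_cancel zero_neq_numeral)
    \<comment> \<open>\<open>H\<close> is indefinite, so uniqueness is obtained by components:
      pairing with \<open>(1, 0)\<close> reads off the base part, and pairing with
      \<open>(0, z)\<close> reduces the fiber part to definiteness of \<open>h\<close>.\<close>
    have "fst W = fst ?G"
      using eq[of "(1, 0)"] by (cases W) (simp add: bil_simps assms(2))
    moreover have "snd W = snd ?G"
    proof (rule h_eqI[OF assms(2)])
      fix z show "h x (snd W) z = h x (snd ?G) z"
        using eq[of "(0, z)"] f by (cases W) simp
    qed
    ultimately show "W = ?G" by (simp add: prod_eq_iff)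
  qed (use G in blast)
qed

lemma christoffel_H_has_derivative:
  assumes "\<tau> \<in> I" "x \<in> U"
  shows "((\<lambda>y. christoffel H y (a, u) (b, v)) has_derivative
    (\<lambda>k. (fst k * ((f1 \<tau>)\<^sup>2 + f \<tau> * f2 \<tau>) * h x u v + f \<tau> * f1 \<tau> * dh x (snd k) u v,
      (fst k * ((f2 \<tau> * f \<tau> - (f1 \<tau>)\<^sup>2) / (f \<tau>)\<^sup>2)) *\<^sub>R (a *\<^sub>R v + b *\<^sub>R u) + d\<Gamma> x (snd k) u v)))
    (at (\<tau>, x))"
proof -
  have f: "f \<tau> \<noteq> 0" using f_pos assms by force
  have q: "((\<lambda>\<tau>. f1 \<tau> / f \<tau>) has_real_derivative (f2 \<tau> * f \<tau> - (f1 \<tau>)\<^sup>2) / (f \<tau>)\<^sup>2) (at \<tau>)"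
    using DERIV_divide[OF f1_deriv f_deriv f] assms by (simp add: power2_eq_square)
  have p: "((\<lambda>\<tau>. f \<tau> * f1 \<tau>) has_real_derivative (f1 \<tau>)\<^sup>2 + f \<tau> * f2 \<tau>) (at \<tau>)"
    using DERIV_mult[OF f_deriv f1_deriv] assms by (simp add: power2_eq_square algebra_simps)
  have "((\<lambda>y. f (fst y) * f1 (fst y) * h (snd y) u v) has_derivative
      (\<lambda>k. fst k * ((f1 \<tau>)\<^sup>2 + f \<tau> * f2 \<tau>) * h x u v + f \<tau> * f1 \<tau> * dh x (snd k) u v)) (at (\<tau>, x))"
    by (rule has_derivative_eq_rhs[OF has_derivative_mult[OF has_derivative_along_base[OF p]
          has_derivative_along_fiber[OF h_has_derivative[OF assms(2)]]]])
       (simp add: fun_eq_iff algebra_simps)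
  moreover have "((\<lambda>y. (f1 (fst y) / f (fst y)) *\<^sub>R (a *\<^sub>R v + b *\<^sub>R u) + \<Gamma> (snd y) u v) has_derivative
      (\<lambda>k. (fst k * ((f2 \<tau> * f \<tau> - (f1 \<tau>)\<^sup>2) / (f \<tau>)\<^sup>2)) *\<^sub>R (a *\<^sub>R v + b *\<^sub>R u) + d\<Gamma> x (snd k) u v))
      (at (\<tau>, x))"
    by (rule has_derivative_eq_rhs[OF has_derivative_add[OF has_derivative_scaleR_left[OF has_derivative_along_base[OF q]]
          has_derivative_along_fiber[OF christoffel_has_derivative[OF assms(2)]]]])
       (simp add: fun_eq_iff mult.commute)
  ultimately have "((\<lambda>y. (f (fst y) * f1 (fst y) * h (snd y) u v,
      (f1 (fst y) / f (fst y)) *\<^sub>R (a *\<^sub>R v + b *\<^sub>R u) + \<Gamma> (snd y) u v)) has_derivative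
    (\<lambda>k. (fst k * ((f1 \<tau>)\<^sup>2 + f \<tau> * f2 \<tau>) * h x u v + f \<tau> * f1 \<tau> * dh x (snd k) u v,
      (fst k * ((f2 \<tau> * f \<tau> - (f1 \<tau>)\<^sup>2) / (f \<tau>)\<^sup>2)) *\<^sub>R (a *\<^sub>R v + b *\<^sub>R u) + d\<Gamma> x (snd k) u v)))
    (at (\<tau>, x))"
    by (rule has_derivative_Pair)
  then show ?thesis
    by (rule has_derivative_transform_within_open[of _ _ _ _ "I \<times> U"])
       (use assms open_I open_U in \<open>auto simp: open_Times christoffel_H\<close>)
qed

lemma christoffel_H_linear:
  assumes "y \<in> I \<times> U"
  shows "christoffel H y (V + V') W = christoffel H y V W + christoffel H y V' W"
    and "christoffel H y (c *\<^sub>R V) W = c *\<^sub>R christoffel H y V W"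
    and "christoffel H y W (V + V') = christoffel H y W V + christoffel H y W V'"
    and "christoffel H y W (c *\<^sub>R V) = c *\<^sub>R christoffel H y W V"
proof -
  obtain \<tau> x a u b v e w where [simp]: "y = (\<tau>, x)" "V = (a, u)" "V' = (b, v)" "W = (e, w)"
    by (metis surj_pair)
  have [simp]: "\<tau> \<in> I" "x \<in> U" using assms by auto
  show "christoffel H y (V + V') W = christoffel H y V W + christoffel H y V' W"
    by (simp add: christoffel_H bil_simps christoffel_linear algebra_simps add_divide_distrib)
  show "christoffel H y (c *\<^sub>R V) W = c *\<^sub>R christoffel H y V W"
    by (simp add: christoffel_H bil_simps christoffel_linear algebra_simps add_divide_distrib)
  show "christoffel H y W (V + V') = christoffel H y W V + christoffel H y W V'"
    by (simp add: christoffel_H bil_simps christoffel_linear algebra_simps add_divide_distrib)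
  show "christoffel H y W (c *\<^sub>R V) = c *\<^sub>R christoffel H y W V"
    by (simp add: christoffel_H bil_simps christoffel_linear algebra_simps add_divide_distrib)
qed

lemma christoffel_H_differentiable:
  assumes "y \<in> I \<times> U"
  shows "(\<lambda>y. christoffel H y V W) differentiable (at y)"
proof -
  obtain \<tau> x a u b v where "y = (\<tau>, x)" "V = (a, u)" "W = (b, v)"
    by (metis surj_pair)
  then show ?thesis
    using assms christoffel_H_has_derivative[of \<tau> x a u b v] unfolding differentiable_def by auto
qed

lemma curvature_H:
  assumes "\<tau> \<in> I" "x \<in> U"
  shows "curvature H (\<tau>, x) (\<alpha>, u) (s, v) (s, v)
    = (f \<tau> * f2 \<tau> * (\<alpha> * h x v v - s * h x u v),
       curvature h x u v v + (f2 \<tau> / f \<tau> * s) *\<^sub>R (\<alpha> *\<^sub>R v - s *\<^sub>R u)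
         + (f1 \<tau>)\<^sup>2 *\<^sub>R (h x v v *\<^sub>R u - h x u v *\<^sub>R v))"
proof -
  have f: "f \<tau> > 0" using f_pos assms by force
  have D: "frechet_derivative (\<lambda>y. christoffel H y (a, u) (b, v)) (at (\<tau>, x)) (k, z)
      = (k * ((f1 \<tau>)\<^sup>2 + f \<tau> * f2 \<tau>) * h x u v + f \<tau> * f1 \<tau> * dh x z u v,
      (k * ((f2 \<tau> * f \<tau> - (f1 \<tau>)\<^sup>2) / (f \<tau>)\<^sup>2)) *\<^sub>R (a *\<^sub>R v + b *\<^sub>R u) + d\<Gamma> x z u v)" for a u b v k z
    using fun_cong[OF frechet_derivative_at[OF christoffel_H_has_derivative[OF assms, of a u b v]], of "(k, z)"]
    by simp
  \<comment> \<open>Writing \<open>f1 \<tau>\<close> and \<open>f2 \<tau>\<close> as multiples of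
    \<open>f \<tau>\<close> removes the quotients, after which both components are polynomial
    identities.\<close>
  define q w where "q = f1 \<tau> / f \<tau>" and "w = f2 \<tau> / f \<tau>"
  have f1: "f1 \<tau> = q * f \<tau>" and f2: "f2 \<tau> = w * f \<tau>" using f by (simp_all add: q_def w_def)
  have q': "(w * f \<tau> * f \<tau> - (q * f \<tau>)\<^sup>2) / (f \<tau>)\<^sup>2 = w - q\<^sup>2" "q * f \<tau> / f \<tau> = q" "w * f \<tau> / f \<tau> = w"
    using f by (simp_all add: power2_eq_square field_simps)
  note simps = metric_compatible[OF assms(2)] christoffel_linear[OF assms(2)] bil_simps[OF assms(2)]
    sym[OF assms(2), of v u] christoffel_sym[OF assms(2), of v u] sym[OF assms(2), of v "\<Gamma> x u v"]
  have "fst (curvature H (\<tau>, x) (\<alpha>, u) (s, v) (s, v)) = f \<tau> * f2 \<tau> * (\<alpha> * h x v v - s * h x u v)"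
    unfolding curvature_def[of H] D christoffel_H[OF assms] f1 f2 q'
    by (simp add: simps) (simp add: algebra_simps power2_eq_square)
  moreover have "snd (curvature H (\<tau>, x) (\<alpha>, u) (s, v) (s, v))
     = curvature h x u v v + (f2 \<tau> / f \<tau> * s) *\<^sub>R (\<alpha> *\<^sub>R v - s *\<^sub>R u)
         + (f1 \<tau>)\<^sup>2 *\<^sub>R (h x v v *\<^sub>R u - h x u v *\<^sub>R v)"
    unfolding curvature_def[of h] d\<Gamma>_def[symmetric] curvature_def[of H] D christoffel_H[OF assms] f1 f2 q'
    by (simp add: simps) (simp add: algebra_simps power2_eq_square)
  ultimately show ?thesis by (simp add: prod_eq_iff)
qed

end

section \<open>The tangential part of the Jacobi equation\<close>

text \<open>
  Here \<open>\<alpha>\<close> is the base component of a Jacobi field, \<open>\<phi>\<close> and \<open>\<psi>\<close> are the inner products of its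
  fiber component and of the covariant derivative of the latter with the fiber velocity, \<open>e\<close> is the
  square of the fiber speed, \<open>\<sigma> = d\<tau>/dt\<close>, and \<open>G = f\<close>, \<open>Q = f'/f\<close>, \<open>W = f''/f\<close> along the
  geodesic. \<open>\<omega>\<close> below is the inner product of the Jacobi field with the velocity, and \<open>\<kappa>\<close> is the relative
  variation of the conserved quantity \<open>f\<^sup>2 \<surd>e\<close>.
\<close>

locale tangential_jacobi =
  fixes J :: "real set" and a b :: real and G Q W \<sigma> e \<alpha> \<alpha>1 \<phi> \<psi> :: "real \<Rightarrow> real"
  assumes J: "is_interval J" "a \<in> J" "b \<in> J" "a \<noteq> b"
    and G_pos: "t \<in> J \<Longrightarrow> 0 < G t" and e_pos: "t \<in> J \<Longrightarrow> 0 < e t"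
    and G: "t \<in> J \<Longrightarrow> (G has_real_derivative Q t * G t * \<sigma> t) (at t within J)"
    and Q: "t \<in> J \<Longrightarrow> (Q has_real_derivative (W t - (Q t)\<^sup>2) * \<sigma> t) (at t within J)"
    and W: "continuous_on J W"
    and \<sigma>: "t \<in> J \<Longrightarrow> (\<sigma> has_real_derivative - (Q t * (G t)\<^sup>2 * e t)) (at t within J)"
    and e: "t \<in> J \<Longrightarrow> (e has_real_derivative - (4 * Q t * \<sigma> t * e t)) (at t within J)"
    and \<alpha>: "t \<in> J \<Longrightarrow> (\<alpha> has_real_derivative \<alpha>1 t) (at t within J)"
    and \<alpha>1: "t \<in> J \<Longrightarrow> (\<alpha>1 has_real_derivative
      - (2 * Q t * (G t)\<^sup>2 * \<psi> t) - ((Q t)\<^sup>2 + W t) * (G t)\<^sup>2 * \<alpha> t * e t) (at t within J)"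
    and \<phi>: "t \<in> J \<Longrightarrow> (\<phi> has_real_derivative \<psi> t - 2 * Q t * \<sigma> t * \<phi> t) (at t within J)"
    and \<psi>: "t \<in> J \<Longrightarrow> (\<psi> has_real_derivative - (2 * (W t - (Q t)\<^sup>2) * \<alpha> t * \<sigma> t * e t)
      - 2 * Q t * \<alpha>1 t * e t - 4 * Q t * \<sigma> t * \<psi> t) (at t within J)"
    and zero: "\<alpha> a = 0" "\<alpha> b = 0" "\<phi> a = 0" "\<phi> b = 0"
begin

definition \<kappa> :: "real \<Rightarrow> real" where
  "\<kappa> t = \<psi> t / e t + 2 * Q t * \<alpha> t"

lemma \<kappa>_const:
  assumes "s \<in> J" "t \<in> J"
  shows "\<kappa> s = \<kappa> t"
proof -
  have "(\<kappa> has_real_derivative 0) (at t within J)" if t: "t \<in> J" for t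
  proof -
    have "e t \<noteq> 0" using e_pos[OF t] by simp
    show ?thesis
      unfolding \<kappa>_def
      by (rule derivative_eq_intros \<psi>[OF t] e[OF t] Q[OF t] \<alpha>[OF t] refl \<open>e t \<noteq> 0\<close>)+
         (use \<open>e t \<noteq> 0\<close> in \<open>simp add: field_simps power2_eq_square\<close>)
  qed
  from has_real_derivative_zero_const_on_interval[OF J(1) this assms] show ?thesis .
qed

text \<open>Since \<open>\<sigma>' = - Q G^2 e\<close>, the left side is the Wronskian of
  \<open>\<alpha>\<close> and \<open>\<sigma>\<close>. The function \<open>\<omega>\<close> is
  affine with zeros at \<open>a\<close> and \<open>b\<close>, so its derivative \<open>\<mu>\<close>
  vanishes; inserting \<open>\<psi> = e (\<kappa> - 2 Q \<alpha>)\<close> into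
  \<open>\<mu> = 0\<close> gives the relation.\<close>

lemma wronskian:
  assumes t: "t \<in> J"
  shows "\<alpha>1 t * \<sigma> t + \<alpha> t * (Q t * (G t)\<^sup>2 * e t) = \<kappa> t * (G t)\<^sup>2 * e t"
proof -
  define \<omega> \<mu> where "\<omega> t = - (\<alpha> t * \<sigma> t) + (G t)\<^sup>2 * \<phi> t"
    and "\<mu> t = - (\<alpha>1 t * \<sigma> t) + \<alpha> t * Q t * (G t)\<^sup>2 * e t + (G t)\<^sup>2 * \<psi> t" for t
  have "(\<omega> has_real_derivative \<mu> t) (at t within J)" if t: "t \<in> J" for t
    unfolding \<omega>_def \<mu>_def
    by (rule derivative_eq_intros \<alpha>[OF t] \<sigma>[OF t] G[OF t] \<phi>[OF t] refl)+
       (simp add: algebra_simps power2_eq_square)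
  moreover have "(\<mu> has_real_derivative 0) (at t within J)" if t: "t \<in> J" for t
    unfolding \<mu>_def
    by (rule derivative_eq_intros \<alpha>1[OF t] \<alpha>[OF t] \<sigma>[OF t] G[OF t] Q[OF t] e[OF t] \<psi>[OF t] refl)+
       (simp add: algebra_simps power2_eq_square)
  moreover have "\<omega> a = 0" "\<omega> b = 0" by (simp_all add: \<omega>_def zero)
  ultimately have "\<mu> t = 0" using affine_with_two_zeros(2)[OF J, of \<omega> \<mu>] t by blast
  moreover have "\<psi> t = e t * (\<kappa> t - 2 * Q t * \<alpha> t)"
    using e_pos[OF t] by (simp add: \<kappa>_def field_simps)
  ultimately show ?thesis by (simp add: \<mu>_def algebra_simps)
qed

lemma vanishes_if_derivative_vanishes:
  assumes "\<alpha>1 a = 0" and t: "t \<in> J"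
  shows "\<alpha> t = 0"
proof -
  have "\<kappa> a = 0"
    using wronskian[OF J(2)] assms(1) zero G_pos[OF J(2)] e_pos[OF J(2)] by simp
  then have \<kappa>0: "\<kappa> s = 0" if "s \<in> J" for s using \<kappa>_const[OF that J(2)] by simp
  have "\<psi> s = - (2 * Q s * \<alpha> s * e s)" if "s \<in> J" for s
    using \<kappa>0[OF that] e_pos[OF that] by (simp add: \<kappa>_def field_simps)
  \<comment> \<open>Inserting \<open>\<psi>\<close> turns the first term of
    \<open>\<alpha>1'\<close> into \<open>4 Q^2 G^2 e \<alpha>\<close>; subtracting the part with
    \<open>Q^2 + W\<close> leaves the factor \<open>3 Q^2 - W\<close>.\<close>
  then have d\<alpha>1: "(\<alpha>1 has_real_derivative ((3 * (Q s)\<^sup>2 - W s) * (G s)\<^sup>2 * e s) * \<alpha> s) (at s within J)" if "s \<in> J" for s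
    using \<alpha>1[OF that] that by (simp add: algebra_simps power2_eq_square)
  have cont: "continuous_on J (\<lambda>s. (3 * (Q s)\<^sup>2 - W s) * (G s)\<^sup>2 * e s)"
    using Q W G e by (intro continuous_intros) (meson DERIV_continuous continuous_on_eq_continuous_within)+
  show ?thesis
    by (rule linear_ode_zero[OF J(1,2) t \<alpha> d\<alpha>1 cont zero(1) assms(1)])
qed

lemma vanishes_if_base_regular:
  assumes \<sigma>nz: "\<And>t. t \<in> J \<Longrightarrow> \<sigma> t \<noteq> 0" and t: "t \<in> J"
  shows "\<alpha> t = 0"
proof -
  have d: "((\<lambda>s. \<alpha> s / \<sigma> s) has_real_derivative \<kappa> s * (G s)\<^sup>2 * e s / (\<sigma> s)\<^sup>2) (at s within J)" if s: "s \<in> J" for s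
    by (rule derivative_eq_intros \<alpha>[OF s] \<sigma>[OF s] refl \<sigma>nz[OF s])+
       (use wronskian[OF s] in \<open>simp add: power2_eq_square\<close>)
  have "\<alpha> a / \<sigma> a = \<alpha> b / \<sigma> b" using zero by simp
  from rolle_on_interval[OF J, of "\<lambda>s. \<alpha> s / \<sigma> s", OF this d] obtain c
    where c: "c \<in> J" "\<kappa> c * (G c)\<^sup>2 * e c / (\<sigma> c)\<^sup>2 = 0" by blast
  then have "\<kappa> c = 0" using G_pos[of c] e_pos[of c] \<sigma>nz[of c] by simp
  then have "((\<lambda>s. \<alpha> s / \<sigma> s) has_real_derivative 0) (at s within J)" if "s \<in> J" for s
    using d[OF that] \<kappa>_const[OF that c(1)] by simp
  from has_real_derivative_zero_const_on_interval[OF J(1) this t J(2)] show ?thesis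
    using zero \<sigma>nz[OF t] by simp
qed

end

section \<open>Curves and fields on a manifold\<close>

locale riemannian =
  fixes F :: "('i, 'p, 'e::euclidean_space) manifold" and g :: "('i, 'e) metric"
  assumes riem: "riemannian_manifold F g"
begin

abbreviation U :: "'i \<Rightarrow> 'e set" where
  "U i \<equiv> chart F i ` chart_dom F i"

lemma chart_metric: "chart_metric (U i) (g i)"
  using riem unfolding riemannian_manifold_def smooth_manifold_def by unfold_locales auto

lemma chart_dom_open: "openin (mtop F) (chart_dom F i)"
  using riem unfolding riemannian_manifold_def smooth_manifold_def by blast

lemma cover: "p \<in> topspace (mtop F) \<Longrightarrow> \<exists>i. p \<in> chart_dom F i"
  using riem unfolding riemannian_manifold_def smooth_manifold_def by blast

lemma chart_inj: "inj_on (chart F i) (chart_dom F i)"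
proof -
  have "homeomorphic_map (subtopology (mtop F) (chart_dom F i)) (top_of_set (U i)) (chart F i)"
    using riem unfolding riemannian_manifold_def smooth_manifold_def by blast
  then have "inj_on (chart F i) (topspace (subtopology (mtop F) (chart_dom F i)))"
    by (simp add: homeomorphic_eq_everything_map)
  then show ?thesis
    using openin_subset[OF chart_dom_open[of i]] by (simp add: Int_absorb1)
qed

lemma transition_chart: "p \<in> chart_dom F i \<Longrightarrow> transition F i j (chart F i p) = chart F j p"
  by (simp add: transition_def inv_into_f_f[OF chart_inj])

lemma transition_differentiable:
  assumes "p \<in> chart_dom F i" "p \<in> chart_dom F j"
  shows "transition F i j differentiable (at (chart F i p))"
proof -
  have "Ck_on 1 (chart F i ` (chart_dom F i \<inter> chart_dom F j)) (transition F i j)"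
    using riem unfolding riemannian_manifold_def smooth_manifold_def smooth_on_def by blast
  then show ?thesis using assms by simp
qed

lemma metric_transition:
  assumes "p \<in> chart_dom F i" "p \<in> chart_dom F j"
  shows "g i (chart F i p) u v = g j (chart F j p)
    (frechet_derivative (transition F i j) (at (chart F i p)) u)
    (frechet_derivative (transition F i j) (at (chart F i p)) v)"
proof -
  have "g i (chart F i p) u v = g j (transition F i j (chart F i p))
    (frechet_derivative (transition F i j) (at (chart F i p)) u)
    (frechet_derivative (transition F i j) (at (chart F i p)) v)"
    using riem assms unfolding riemannian_manifold_def by blast
  then show ?thesis by (simp only: transition_chart[OF assms(1)])
qed

lemma preimage_chart_dom_open:
  assumes "continuous_map (top_of_set J) (mtop F) \<beta>"
  shows "openin (top_of_set J) {t \<in> J. \<beta> t \<in> chart_dom F i}"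
  using openin_continuous_map_preimage[OF assms chart_dom_open] by simp

lemma velocity_has_derivative:
  assumes "differentiable_curve F J \<beta>" "t \<in> J" "\<beta> t \<in> chart_dom F i"
  shows "((\<lambda>s. chart F i (\<beta> s)) has_vector_derivative velocity F J \<beta> i t) (at t within J)"
proof -
  have "(chart F i \<circ> \<beta>) differentiable (at t within J)"
    using assms unfolding differentiable_curve_def by blast
  then show ?thesis
    using assms(2,3) unfolding vector_derivative_works by (simp add: velocity_def o_def)
qed

lemma velocity_transforms:
  assumes \<beta>: "differentiable_curve F J \<beta>" and t: "t \<in> J" and nb: "at t within J \<noteq> bot"
    and ij: "\<beta> t \<in> chart_dom F i" "\<beta> t \<in> chart_dom F j"
  shows "velocity F J \<beta> j t
    = frechet_derivative (transition F i j) (at (chart F i (\<beta> t))) (velocity F J \<beta> i t)"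
proof -
  let ?N = "{t \<in> J. \<beta> t \<in> chart_dom F i}"
  have N: "openin (top_of_set J) ?N"
    using \<beta> preimage_chart_dom_open unfolding differentiable_curve_def by blast
  have tN: "t \<in> ?N" using t ij by simp
  note within = at_within_openin[OF N tN]
  have D: "(transition F i j has_derivative frechet_derivative (transition F i j) (at (chart F i (\<beta> t))))
      (at (chart F i (\<beta> t)))"
    using transition_differentiable[OF ij] by (simp add: frechet_derivative_works)
  have "((\<lambda>s. transition F i j (chart F i (\<beta> s))) has_derivative
      (\<lambda>k. frechet_derivative (transition F i j) (at (chart F i (\<beta> t))) (k *\<^sub>R velocity F J \<beta> i t)))
      (at t within ?N)"
    using has_derivative_compose[OF velocity_has_derivative[OF \<beta> t ij(1), unfolded has_vector_derivative_def] D]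
    by (simp only: within)
  then have "((\<lambda>s. chart F j (\<beta> s)) has_derivative
      (\<lambda>k. frechet_derivative (transition F i j) (at (chart F i (\<beta> t))) (k *\<^sub>R velocity F J \<beta> i t)))
      (at t within ?N)"
    by (rule has_derivative_transform[OF tN, rotated]) (simp add: transition_chart)
  then have "((\<lambda>s. chart F j (\<beta> s)) has_vector_derivative
      frechet_derivative (transition F i j) (at (chart F i (\<beta> t))) (velocity F J \<beta> i t)) (at t within J)"
    unfolding has_vector_derivative_def within
    by (simp add: linear_scale[OF linear_frechet_derivative[OF transition_differentiable[OF ij]]])
  then show ?thesis
    using vector_derivative_unique_within[OF nb velocity_has_derivative[OF \<beta> t ij(2)]] by blast
qed

text \<open>The scalar factor \<open>c\<close> lets one statement serve for first and second
  derivatives: \<open>c = 1\<close> for a field carried along, and \<open>c\<close> equal to the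
  derivative of the parameter change for its covariant derivative. It is applied to \<open>r\<close>
  and to its inverse \<open>\<rho>\<close>.\<close>

lemma covariant_derivative_reparametrized:
  assumes nb: "at t within J \<noteq> bot" and t: "t \<in> J" "\<beta> (r t) \<in> chart_dom F i"
    and r: "(r has_real_derivative r') (at t within J)" "r ` J \<subseteq> K" and nbK: "at (r t) within K \<noteq> bot"
    and \<beta>: "differentiable_curve F K \<beta>" and \<beta>': "\<And>s. s \<in> J \<Longrightarrow> \<beta>' s = \<beta> (r s)"
    and Z: "Z i differentiable (at (r t) within K)"
    and c: "(c has_real_derivative c') (at t within J)"
    and Y: "\<And>s. s \<in> J \<Longrightarrow> Y i s = c s *\<^sub>R Z i (r s)"
  shows "Y i differentiable (at t within J)"
    and "covariant_derivative F g J \<beta>' Y i t = c' *\<^sub>R Z i (r t) + (c t * r') *\<^sub>R covariant_derivative F g K \<beta> Z i (r t)"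
    and "velocity F J \<beta>' i t = r' *\<^sub>R velocity F K \<beta> i (r t)"
proof -
  interpret C: chart_metric "U i" "g i" by (rule chart_metric)
  have rt: "r t \<in> K" using r(2) t(1) by blast
  have r1: "(r has_vector_derivative r') (at t within J)"
    using r(1) by (simp add: has_real_derivative_iff_has_vector_derivative)
  have chain: "((\<lambda>s. W (r s)) has_vector_derivative r' *\<^sub>R W') (at t within J)"
    if "(W has_vector_derivative W') (at (r t) within K)" for W :: "real \<Rightarrow> 'e" and W'
    using vector_diff_chain_within[OF r1 has_vector_derivative_within_subset[OF that r(2)]]
    by (simp add: o_def)
  have "((\<lambda>s. chart F i (\<beta> (r s))) has_vector_derivative r' *\<^sub>R velocity F K \<beta> i (r t)) (at t within J)"
    by (rule chain[OF velocity_has_derivative[OF \<beta> rt t(2)]])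
  then have "((\<lambda>s. chart F i (\<beta>' s)) has_vector_derivative r' *\<^sub>R velocity F K \<beta> i (r t)) (at t within J)"
    by (rule has_vector_derivative_transform[OF t(1), rotated]) (simp add: \<beta>')
  then show vel: "velocity F J \<beta>' i t = r' *\<^sub>R velocity F K \<beta> i (r t)"
    using t by (simp add: velocity_def \<beta>' o_def vector_derivative_within[OF nb])
  have "((\<lambda>s. c s *\<^sub>R Z i (r s)) has_vector_derivative
      c t *\<^sub>R (r' *\<^sub>R vector_derivative (Z i) (at (r t) within K)) + c' *\<^sub>R Z i (r t)) (at t within J)"
    by (rule has_vector_derivative_scaleR[OF c chain])
       (use Z in \<open>simp add: vector_derivative_works\<close>)
  then have YD: "(Y i has_vector_derivative
      c t *\<^sub>R (r' *\<^sub>R vector_derivative (Z i) (at (r t) within K)) + c' *\<^sub>R Z i (r t)) (at t within J)"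
    by (rule has_vector_derivative_transform[OF t(1), rotated]) (simp add: Y)
  then show "Y i differentiable (at t within J)"
    by (rule differentiableI_vector)
  show "covariant_derivative F g J \<beta>' Y i t = c' *\<^sub>R Z i (r t) + (c t * r') *\<^sub>R covariant_derivative F g K \<beta> Z i (r t)"
    using t rt vector_derivative_within[OF nb YD]
    by (simp add: covariant_derivative_def vel \<beta>' Y C.christoffel_linear scaleR_add_right add.commute mult.commute)
qed

end

section \<open>Linearity of the covariant derivative and of the Jacobi equation\<close>

lemma covariant_derivative_linear:
  assumes nb: "\<And>t. t \<in> J \<Longrightarrow> at t within J \<noteq> bot"
    and lin: "\<And>i t. t \<in> J \<Longrightarrow> \<gamma> t \<in> chart_dom M i \<Longrightarrow> linear (christoffel (h i) (chart M i (\<gamma> t)) (velocity M J \<gamma> i t))"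
    and X: "differentiable_field M J \<gamma> X" and Y: "differentiable_field M J \<gamma> Y"
  shows "covariant_derivative M h J \<gamma> (X + Y) = covariant_derivative M h J \<gamma> X + covariant_derivative M h J \<gamma> Y"
    and "covariant_derivative M h J \<gamma> (c *\<^sub>R X) = c *\<^sub>R covariant_derivative M h J \<gamma> X"
proof -
  have D: "(X i has_vector_derivative vector_derivative (X i) (at t within J)) (at t within J)"
    "(Y i has_vector_derivative vector_derivative (Y i) (at t within J)) (at t within J)"
    if "t \<in> J" "\<gamma> t \<in> chart_dom M i" for i t
    using X Y that by (auto simp: differentiable_field_def vector_derivative_works[symmetric])
  have "vector_derivative ((X + Y) i) (at t within J)
      = vector_derivative (X i) (at t within J) + vector_derivative (Y i) (at t within J)"
    "vector_derivative ((c *\<^sub>R X) i) (at t within J) = c *\<^sub>R vector_derivative (X i) (at t within J)"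
    if "t \<in> J" "\<gamma> t \<in> chart_dom M i" for i t
    using vector_derivative_within[OF nb[OF that(1)] has_vector_derivative_add[OF D[OF that]]]
      vector_derivative_within[OF nb[OF that(1)] has_vector_derivative_scaleR[OF DERIV_const D(1)[OF that]]]
    by (simp_all add: plus_fun_def scaleR_fun_def)
  then show "covariant_derivative M h J \<gamma> (X + Y) = covariant_derivative M h J \<gamma> X + covariant_derivative M h J \<gamma> Y"
    "covariant_derivative M h J \<gamma> (c *\<^sub>R X) = c *\<^sub>R covariant_derivative M h J \<gamma> X"
    by (auto simp: fun_eq_iff covariant_derivative_def plus_fun_def scaleR_fun_def
        linear_add[OF lin] linear_scale[OF lin] scaleR_add_right)
qed

text \<open>Formulated through linearity of the Christoffel, curvature and transition maps, so that
  it applies to the Lorentz metric on the product manifold.\<close>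

lemma jacobi_fields_subspace:
  assumes nb: "\<And>t. t \<in> J \<Longrightarrow> at t within J \<noteq> bot"
    and lin: "\<And>i t. t \<in> J \<Longrightarrow> \<gamma> t \<in> chart_dom M i \<Longrightarrow> linear (christoffel (h i) (chart M i (\<gamma> t)) (velocity M J \<gamma> i t))"
    and R: "\<And>i t. t \<in> J \<Longrightarrow> \<gamma> t \<in> chart_dom M i \<Longrightarrow> linear (\<lambda>u. curvature (h i) (chart M i (\<gamma> t)) u (velocity M J \<gamma> i t) (velocity M J \<gamma> i t))"
    and T: "\<And>i j t. t \<in> J \<Longrightarrow> \<gamma> t \<in> chart_dom M i \<inter> chart_dom M j \<Longrightarrow> linear (frechet_derivative (transition M i j) (at (chart M i (\<gamma> t))))"
  shows "subspace {X. jacobi_field M h J \<gamma> X \<and> (\<forall>i. X i a = 0) \<and> (\<forall>i. X i b = 0)}"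
proof -
  let ?D = "covariant_derivative M h J \<gamma>"
  have diff_add: "differentiable_field M J \<gamma> (X + Y)"
    and diff_scale: "differentiable_field M J \<gamma> (c *\<^sub>R X)"
    if "differentiable_field M J \<gamma> X" "differentiable_field M J \<gamma> Y" for X Y :: "'a \<Rightarrow> real \<Rightarrow> 'c" and c
    using that by (auto simp: differentiable_field_def plus_fun_def scaleR_fun_def)
  have add: "jacobi_field M h J \<gamma> (X + Y)" if X: "jacobi_field M h J \<gamma> X" and Y: "jacobi_field M h J \<gamma> Y" for X Y
  proof -
    have dX: "differentiable_field M J \<gamma> X" "differentiable_field M J \<gamma> (?D X)"
      and dY: "differentiable_field M J \<gamma> Y" "differentiable_field M J \<gamma> (?D Y)"
      using X Y unfolding jacobi_field_def by blast+
    have D1: "?D (X + Y) = ?D X + ?D Y"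
      by (rule covariant_derivative_linear(1)[OF nb lin dX(1) dY(1)])
    have D2: "?D (?D X + ?D Y) = ?D (?D X) + ?D (?D Y)"
      by (rule covariant_derivative_linear(1)[OF nb lin dX(2) dY(2)])
    have "field_along M J \<gamma> (X + Y)"
      unfolding field_along_def
    proof (intro conjI allI ballI impI)
      fix i t assume "\<not> (t \<in> J \<and> \<gamma> t \<in> chart_dom M i)"
      then have "X i t = 0" "Y i t = 0" using X Y unfolding jacobi_field_def field_along_def by blast+
      then show "(X + Y) i t = 0" by (simp add: plus_fun_def)
    next
      fix i j t assume t: "t \<in> J" "\<gamma> t \<in> chart_dom M i \<inter> chart_dom M j"
      have "X j t = frechet_derivative (transition M i j) (at (chart M i (\<gamma> t))) (X i t)"
        "Y j t = frechet_derivative (transition M i j) (at (chart M i (\<gamma> t))) (Y i t)"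
        using X Y t unfolding jacobi_field_def field_along_def by blast+
      then show "(X + Y) j t = frechet_derivative (transition M i j) (at (chart M i (\<gamma> t))) ((X + Y) i t)"
        by (simp add: plus_fun_def linear_add[OF T[OF t]])
    qed
    moreover have "?D (?D (X + Y)) i t + curvature (h i) (chart M i (\<gamma> t)) ((X + Y) i t) (velocity M J \<gamma> i t) (velocity M J \<gamma> i t) = 0"
      if t: "t \<in> J" "\<gamma> t \<in> chart_dom M i" for i t
    proof -
      have "?D (?D X) i t + curvature (h i) (chart M i (\<gamma> t)) (X i t) (velocity M J \<gamma> i t) (velocity M J \<gamma> i t) = 0"
        "?D (?D Y) i t + curvature (h i) (chart M i (\<gamma> t)) (Y i t) (velocity M J \<gamma> i t) (velocity M J \<gamma> i t) = 0"
        using X Y t unfolding jacobi_field_def by blast+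
      then show ?thesis
        unfolding D1 D2
        by (simp add: plus_fun_def linear_add[OF R[OF t]] flip: eq_neg_iff_add_eq_0)
    qed
    ultimately show ?thesis
      unfolding jacobi_field_def using diff_add[OF dX(1) dY(1)] diff_add[OF dX(2) dY(2)] by (simp add: D1)
  qed
  have scale: "jacobi_field M h J \<gamma> (c *\<^sub>R X)" if X: "jacobi_field M h J \<gamma> X" for X c
  proof -
    have dX: "differentiable_field M J \<gamma> X" "differentiable_field M J \<gamma> (?D X)"
      using X unfolding jacobi_field_def by blast+
    have D1: "?D (c *\<^sub>R X) = c *\<^sub>R ?D X"
      by (rule covariant_derivative_linear(2)[OF nb lin dX(1) dX(1)])
    have D2: "?D (c *\<^sub>R ?D X) = c *\<^sub>R ?D (?D X)"
      by (rule covariant_derivative_linear(2)[OF nb lin dX(2) dX(2)])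
    have "field_along M J \<gamma> (c *\<^sub>R X)"
      unfolding field_along_def
    proof (intro conjI allI ballI impI)
      fix i t assume "\<not> (t \<in> J \<and> \<gamma> t \<in> chart_dom M i)"
      then have "X i t = 0" using X unfolding jacobi_field_def field_along_def by blast
      then show "(c *\<^sub>R X) i t = 0" by (simp add: scaleR_fun_def)
    next
      fix i j t assume t: "t \<in> J" "\<gamma> t \<in> chart_dom M i \<inter> chart_dom M j"
      have "X j t = frechet_derivative (transition M i j) (at (chart M i (\<gamma> t))) (X i t)"
        using X t unfolding jacobi_field_def field_along_def by blast
      then show "(c *\<^sub>R X) j t = frechet_derivative (transition M i j) (at (chart M i (\<gamma> t))) ((c *\<^sub>R X) i t)"
        by (simp add: scaleR_fun_def linear_scale[OF T[OF t]])
    qed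
    moreover have "?D (?D (c *\<^sub>R X)) i t + curvature (h i) (chart M i (\<gamma> t)) ((c *\<^sub>R X) i t) (velocity M J \<gamma> i t) (velocity M J \<gamma> i t) = 0"
      if t: "t \<in> J" "\<gamma> t \<in> chart_dom M i" for i t
    proof -
      have "?D (?D X) i t + curvature (h i) (chart M i (\<gamma> t)) (X i t) (velocity M J \<gamma> i t) (velocity M J \<gamma> i t) = 0"
        using X t unfolding jacobi_field_def by blast
      then show ?thesis
        unfolding D1 D2 using linear_scale[OF R[OF t]] by (simp add: scaleR_fun_def scaleR_add_right[symmetric])
    qed
    ultimately show ?thesis
      unfolding jacobi_field_def using diff_scale[OF dX(1) dX(1)] diff_scale[OF dX(2) dX(2)] by (simp add: D1)
  qed
  have d0: "differentiable_field M J \<gamma> 0"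
    by (simp add: differentiable_field_def zero_fun_def)
  have "?D (0 *\<^sub>R 0) = 0 *\<^sub>R ?D 0"
    by (rule covariant_derivative_linear(2)[OF nb lin d0 d0])
  then have D0: "?D 0 = 0" by simp
  have "curvature (h i) (chart M i (\<gamma> t)) 0 (velocity M J \<gamma> i t) (velocity M J \<gamma> i t) = 0"
    if t: "t \<in> J" "\<gamma> t \<in> chart_dom M i" for i t
    using linear_0[OF R[OF t]] by simp
  moreover have "field_along M J \<gamma> 0"
    unfolding field_along_def zero_fun_def
    by (intro conjI allI ballI impI) (simp_all only: linear_0[OF T])
  ultimately have zero: "jacobi_field M h J \<gamma> 0"
    unfolding jacobi_field_def D0 using d0 by (simp add: zero_fun_def)
  show ?thesis
    by (rule subspaceI) (use add scale zero in \<open>auto simp: plus_fun_def scaleR_fun_def zero_fun_def\<close>)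
qed

lemma has_vector_derivative_cong_openin:
  assumes N: "openin (top_of_set J) N" "t \<in> N"
    and F: "(F has_vector_derivative D) (at t within J)" and FG: "\<And>s. s \<in> N \<Longrightarrow> F s = G s"
  shows "(G has_vector_derivative D) (at t within J)"
  using has_vector_derivative_transform[OF N(2), of G F D] F FG
  unfolding at_within_openin[OF N] by auto

lemma has_real_derivative_cong_openin:
  assumes N: "openin (top_of_set J) N" "t \<in> N"
    and F: "(F has_real_derivative D) (at t within J)" and FG: "\<And>s. s \<in> N \<Longrightarrow> F s = G s"
  shows "(G has_real_derivative D) (at t within J)"
  using has_vector_derivative_cong_openin[OF N, of F D G] F FG
  unfolding has_real_derivative_iff_has_vector_derivative by blast

section \<open>Inner products along a curve and the speed of a geodesic\<close>

context riemannian
begin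

text \<open>A single function on all of \<open>J\<close> built from chart components. The metric and
  the fields transform compatibly, so the chart picked by \<open>SOME\<close> is immaterial, and
  theorems about real functions on intervals become applicable.\<close>

definition inner_along :: "(real \<Rightarrow> 'p) \<Rightarrow> ('i \<Rightarrow> real \<Rightarrow> 'e) \<Rightarrow> ('i \<Rightarrow> real \<Rightarrow> 'e) \<Rightarrow> real \<Rightarrow> real" where
  "inner_along \<beta> X Y t = (let i = SOME i. \<beta> t \<in> chart_dom F i in g i (chart F i (\<beta> t)) (X i t) (Y i t))"

lemma inner_along_eq:
  assumes X: "field_along F J \<beta> X" and Y: "field_along F J \<beta> Y" and t: "t \<in> J" "\<beta> t \<in> chart_dom F i"
  shows "inner_along \<beta> X Y t = g i (chart F i (\<beta> t)) (X i t) (Y i t)"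
proof -
  define j where "j = (SOME i. \<beta> t \<in> chart_dom F i)"
  have j: "\<beta> t \<in> chart_dom F j" unfolding j_def by (rule someI[of _ i]) (rule t(2))
  have "X j t = frechet_derivative (transition F i j) (at (chart F i (\<beta> t))) (X i t)"
    "Y j t = frechet_derivative (transition F i j) (at (chart F i (\<beta> t))) (Y i t)"
    using X Y t j unfolding field_along_def by blast+
  then show ?thesis
    using metric_transition[OF t(2) j] by (simp add: inner_along_def Let_def flip: j_def)
qed

text \<open>The fields enter through their components in one chart. In this form the rule applies to
  covariant derivatives of Jacobi fields, which are controlled here chart by chart.\<close>

lemma product_rule_in_chart:
  assumes \<beta>: "differentiable_curve F J \<beta>" and t: "t \<in> J" "\<beta> t \<in> chart_dom F i"
    and X: "X i differentiable (at t within J)" and Y: "Y i differentiable (at t within J)"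
  shows "((\<lambda>s. g i (chart F i (\<beta> s)) (X i s) (Y i s)) has_real_derivative
    g i (chart F i (\<beta> t)) (covariant_derivative F g J \<beta> X i t) (Y i t) +
    g i (chart F i (\<beta> t)) (X i t) (covariant_derivative F g J \<beta> Y i t)) (at t within J)"
proof -
  interpret C: chart_metric "U i" "g i" by (rule chart_metric)
  let ?N = "{t \<in> J. \<beta> t \<in> chart_dom F i}"
  have N: "openin (top_of_set J) ?N" "t \<in> ?N"
    using \<beta> preimage_chart_dom_open t unfolding differentiable_curve_def by blast+
  have "((\<lambda>s. g i (chart F i (\<beta> s)) (X i s) (Y i s)) has_real_derivative
    g i (chart F i (\<beta> t)) (vector_derivative (X i) (at t within J) +
      christoffel (g i) (chart F i (\<beta> t)) (velocity F J \<beta> i t) (X i t)) (Y i t) +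
    g i (chart F i (\<beta> t)) (X i t) (vector_derivative (Y i) (at t within J) +
      christoffel (g i) (chart F i (\<beta> t)) (velocity F J \<beta> i t) (Y i t))) (at t within ?N)"
  proof (rule C.covariant_product_rule)
    show "(X i has_vector_derivative vector_derivative (X i) (at t within J)) (at t within ?N)"
      "(Y i has_vector_derivative vector_derivative (Y i) (at t within J)) (at t within ?N)"
      "((\<lambda>s. chart F i (\<beta> s)) has_vector_derivative velocity F J \<beta> i t) (at t within ?N)"
      using X Y velocity_has_derivative[OF \<beta> t]
      unfolding vector_derivative_works at_within_openin[OF N] by simp_all
  qed (use t in auto)
  then show ?thesis
    using t by (simp add: covariant_derivative_def at_within_openin[OF N])
qed

lemma inner_along_has_derivative:
  assumes \<beta>: "differentiable_curve F J \<beta>" and t: "t \<in> J" "\<beta> t \<in> chart_dom F i"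
    and XY: "field_along F J \<beta> X" "field_along F J \<beta> Y"
    and X: "X i differentiable (at t within J)" and Y: "Y i differentiable (at t within J)"
  shows "(inner_along \<beta> X Y has_real_derivative
    g i (chart F i (\<beta> t)) (covariant_derivative F g J \<beta> X i t) (Y i t) +
    g i (chart F i (\<beta> t)) (X i t) (covariant_derivative F g J \<beta> Y i t)) (at t within J)"
proof -
  let ?N = "{t \<in> J. \<beta> t \<in> chart_dom F i}"
  have N: "openin (top_of_set J) ?N" "t \<in> ?N"
    using \<beta> preimage_chart_dom_open t unfolding differentiable_curve_def by blast+
  show ?thesis
    by (rule has_real_derivative_cong_openin[OF N product_rule_in_chart[of J \<beta> t i X Y, OF \<beta> t X Y]])
       (auto intro!: inner_along_eq[OF XY, symmetric])
qed

lemma velocity_field_along: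
  assumes "differentiable_curve F J \<beta>" and "\<And>t. t \<in> J \<Longrightarrow> at t within J \<noteq> bot"
  shows "field_along F J \<beta> (velocity F J \<beta>)"
  unfolding field_along_def
proof (intro conjI allI ballI impI)
  fix i j t assume "t \<in> J" "\<beta> t \<in> chart_dom F i \<inter> chart_dom F j"
  then show "velocity F J \<beta> j t
    = frechet_derivative (transition F i j) (at (chart F i (\<beta> t))) (velocity F J \<beta> i t)"
    using velocity_transforms[OF assms(1)] assms(2) by blast
qed (auto simp: velocity_def)

lemma curve_in_chart:
  assumes "differentiable_curve F J \<beta>" "t \<in> J"
  shows "\<exists>i. \<beta> t \<in> chart_dom F i"
proof -
  have "\<beta> t \<in> topspace (mtop F)"
    using assms continuous_map_image_subset_topspace[of "top_of_set J" "mtop F" \<beta>]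
    unfolding differentiable_curve_def by auto
  then show ?thesis by (rule cover)
qed

lemma geodesic_speed_const:
  assumes J: "is_interval J" "\<And>t. t \<in> J \<Longrightarrow> at t within J \<noteq> bot" and \<beta>: "geodesic F g J \<beta>"
    and st: "s \<in> J" "t \<in> J"
  shows "inner_along \<beta> (velocity F J \<beta>) (velocity F J \<beta>) s = inner_along \<beta> (velocity F J \<beta>) (velocity F J \<beta>) t"
proof (rule has_real_derivative_zero_const_on_interval[OF J(1) _ st])
  fix u assume u: "u \<in> J"
  have curve: "differentiable_curve F J \<beta>" using \<beta> by (simp add: geodesic_def)
  obtain i where i: "\<beta> u \<in> chart_dom F i" using curve_in_chart[OF curve u] by blast
  interpret C: chart_metric "U i" "g i" by (rule chart_metric)
  have "velocity F J \<beta> i differentiable (at u within J)" "covariant_derivative F g J \<beta> (velocity F J \<beta>) i u = 0"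
    using \<beta> u i unfolding geodesic_def differentiable_field_def by blast+
  with inner_along_has_derivative[OF curve u i velocity_field_along[OF curve J(2)] velocity_field_along[OF curve J(2)]]
  show "(inner_along \<beta> (velocity F J \<beta>) (velocity F J \<beta>) has_real_derivative 0) (at u within J)"
    using i by (simp add: C.bil_simps)
qed

text \<open>The speed is constant, so one zero of the velocity makes it vanish throughout. The curve
  is then constant in each chart for a short time, and connectedness of \<open>J\<close> makes it
  constant.\<close>

lemma geodesic_velocity_nonzero:
  assumes J: "is_interval J" "\<And>t. t \<in> J \<Longrightarrow> at t within J \<noteq> bot" and \<beta>: "geodesic F g J \<beta>"
    and nc: "\<not> \<beta> constant_on J" and t: "t \<in> J" "\<beta> t \<in> chart_dom F i"
  shows "velocity F J \<beta> i t \<noteq> 0"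
proof
  assume zero: "velocity F J \<beta> i t = 0"
  have curve: "differentiable_curve F J \<beta>" using \<beta> by (simp add: geodesic_def)
  note fa = velocity_field_along[OF curve J(2)]
  interpret C: chart_metric "U i" "g i" for i by (rule chart_metric)
  have "inner_along \<beta> (velocity F J \<beta>) (velocity F J \<beta>) t = 0"
    using inner_along_eq[OF fa fa t] zero t by (simp add: C.bil_simps)
  then have E0: "inner_along \<beta> (velocity F J \<beta>) (velocity F J \<beta>) s = 0" if "s \<in> J" for s
    using geodesic_speed_const[OF J \<beta> that t(1)] by simp
  have v0: "velocity F J \<beta> j s = 0" if "s \<in> J" "\<beta> s \<in> chart_dom F j" for s j
    using E0[OF that(1)] inner_along_eq[OF fa fa that] C.pos[of "chart F j (\<beta> s)" j "velocity F J \<beta> j s"] that(2)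
    by force
  have "\<beta> constant_on J"
  proof (rule locally_constant_imp_constant)
    show "connected J" using J(1) by (simp add: is_interval_connected_1)
    fix s assume s: "s \<in> J"
    obtain j where j: "\<beta> s \<in> chart_dom F j" using curve_in_chart[OF curve s] by blast
    let ?N = "{t \<in> J. \<beta> t \<in> chart_dom F j}"
    have N: "openin (top_of_set J) ?N" "s \<in> ?N"
      using curve preimage_chart_dom_open s j unfolding differentiable_curve_def by blast+
    obtain \<epsilon> where \<epsilon>: "0 < \<epsilon>" "ball s \<epsilon> \<inter> J \<subseteq> ?N"
      using N openin_contains_ball[of J ?N] by blast
    \<comment> \<open>The intersection with a ball makes the neighbourhood convex, as required for
      concluding constancy from a zero derivative.\<close>
    let ?T = "ball s \<epsilon> \<inter> J"
    have convex: "convex ?T" using J(1) by (simp add: is_interval_convex convex_Int)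
    have d: "((\<lambda>u. chart F j (\<beta> u)) has_derivative (\<lambda>h. 0)) (at u within ?T)" if "u \<in> ?T" for u
    proof -
      have u: "u \<in> J" "\<beta> u \<in> chart_dom F j" using that \<epsilon>(2) by auto
      have "((\<lambda>u. chart F j (\<beta> u)) has_vector_derivative 0) (at u within J)"
        using velocity_has_derivative[OF curve u] v0[OF u] by simp
      then have "((\<lambda>u. chart F j (\<beta> u)) has_vector_derivative 0) (at u within ?T)"
        by (rule has_vector_derivative_within_subset) auto
      then show ?thesis by (simp add: has_vector_derivative_def)
    qed
    obtain c where c: "chart F j (\<beta> u) = c" if "u \<in> ?T" for u
      using has_derivative_zero_constant[OF convex d] by blast
    have const: "\<beta> u = \<beta> s" if "u \<in> ?T" for u
    proof (rule inj_onD[OF chart_inj])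
      show "chart F j (\<beta> u) = chart F j (\<beta> s)" using c[OF that] c[of s] s \<epsilon>(1) by simp
      show "\<beta> u \<in> chart_dom F j" "\<beta> s \<in> chart_dom F j" using that \<epsilon>(2) j by auto
    qed
    have "openin (top_of_set J) ?T" by (subst Int_commute) (rule openin_open_Int[OF open_ball])
    moreover have "s \<in> ?T" using s \<epsilon>(1) by simp
    ultimately show "\<exists>T. openin (top_of_set J) T \<and> s \<in> T \<and> (\<forall>u\<in>T. \<beta> u = \<beta> s)"
      using const by (metis (no_types))
  qed
  with nc show False by simp
qed

end

section \<open>Geodesics of a GRW spacetime\<close>

lemma has_real_derivative_frechet_derivative:
  fixes F :: "real \<Rightarrow> real"
  assumes "F differentiable (at x)"
  shows "(F has_real_derivative frechet_derivative F (at x) 1) (at x)"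
proof -
  have "(F has_derivative frechet_derivative F (at x)) (at x)"
    using assms by (simp add: frechet_derivative_works)
  moreover have "frechet_derivative F (at x) = (*) (frechet_derivative F (at x) 1)"
  proof
    fix k show "frechet_derivative F (at x) k = frechet_derivative F (at x) 1 * k"
      using linear_scale[OF linear_frechet_derivative[OF assms], of k 1] by simp
  qed
  ultimately show ?thesis by (simp add: has_field_derivative_def)
qed

locale grw_geodesic = riemannian F g
  for F :: "('i, 'p, 'e::euclidean_space) manifold" and g :: "('i, 'e) metric" +
  fixes I :: "real set" and f :: "real \<Rightarrow> real"
    and J :: "real set" and \<gamma> :: "real \<Rightarrow> real \<times> 'p" and a b :: real
    and K :: "real set" and \<gamma>F :: "real \<Rightarrow> 'p" and r :: "real \<Rightarrow> real"
  assumes base_open: "open I" and f_smooth: "smooth_on I f" and f_positive: "\<forall>\<tau>\<in>I. 0 < f \<tau>"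
    and J: "is_interval J" "a \<in> J" "b \<in> J" "a \<noteq> b"
    and geod: "geodesic (grw_manifold I F) (grw_metric f g) J \<gamma>"
    and fiber_geod: "geodesic F g K \<gamma>F" "\<not> \<gamma>F constant_on K"
    and reparam: "reparametrization_of (snd \<circ> \<gamma>) J r \<gamma>F K"
begin

definition f1 :: "real \<Rightarrow> real" where "f1 \<tau> = frechet_derivative f (at \<tau>) 1"
definition f2 :: "real \<Rightarrow> real" where "f2 \<tau> = frechet_derivative f1 (at \<tau>) 1"

lemma f_derivatives:
  shows "\<tau> \<in> I \<Longrightarrow> (f has_real_derivative f1 \<tau>) (at \<tau>)"
    and "\<tau> \<in> I \<Longrightarrow> (f1 has_real_derivative f2 \<tau>) (at \<tau>)"
    and "continuous_on I f2"
proof -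
  have "Ck_on (Suc (Suc 0)) I f" using f_smooth unfolding smooth_on_def by blast
  then have "\<forall>\<tau>\<in>I. f differentiable (at \<tau>)" "\<forall>\<tau>\<in>I. f1 differentiable (at \<tau>)" "continuous_on I f2"
    unfolding f1_def[abs_def] f2_def[abs_def] by simp_all
  then show "\<tau> \<in> I \<Longrightarrow> (f has_real_derivative f1 \<tau>) (at \<tau>)"
    "\<tau> \<in> I \<Longrightarrow> (f1 has_real_derivative f2 \<tau>) (at \<tau>)" "continuous_on I f2"
    unfolding f1_def f2_def by (blast intro: has_real_derivative_frechet_derivative)+
qed

sublocale C: grw_chart "U i" "g i" I f f1 f2 for i
proof -
  interpret chart_metric "U i" "g i" by (rule chart_metric)
  show "grw_chart (U i) (g i) I f f1 f2"
    by unfold_locales (use base_open f_positive f_derivatives in auto)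
qed

abbreviation "M \<equiv> grw_manifold I F"
abbreviation "h \<equiv> grw_metric f g"

definition \<tau> :: "real \<Rightarrow> real" where "\<tau> t = fst (\<gamma> t)"
definition \<beta> :: "real \<Rightarrow> 'p" where "\<beta> t = snd (\<gamma> t)"
definition \<sigma> :: "real \<Rightarrow> real" where "\<sigma> t = vector_derivative \<tau> (at t within J)"
definition G :: "real \<Rightarrow> real" where "G t = f (\<tau> t)"
definition Q :: "real \<Rightarrow> real" where "Q t = f1 (\<tau> t) / f (\<tau> t)"
definition W :: "real \<Rightarrow> real" where "W t = f2 (\<tau> t) / f (\<tau> t)"
definition r' :: "real \<Rightarrow> real" where "r' t = vector_derivative r (at t within J)"

abbreviation v :: "'i \<Rightarrow> real \<Rightarrow> 'e" where "v \<equiv> velocity F J \<beta>"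
abbreviation x :: "'i \<Rightarrow> real \<Rightarrow> 'e" where "x i t \<equiv> chart F i (\<beta> t)"
abbreviation T :: "'i \<Rightarrow> real \<Rightarrow> 'e" where "T \<equiv> velocity F K \<gamma>F"
abbreviation D :: "('i \<Rightarrow> real \<Rightarrow> 'e) \<Rightarrow> 'i \<Rightarrow> real \<Rightarrow> 'e" where "D \<equiv> covariant_derivative F g J \<beta>"
abbreviation N :: "'i \<Rightarrow> real set" where "N i \<equiv> {t \<in> J. \<beta> t \<in> chart_dom F i}"

lemma h_eq: "h i = C.H i"
  by (auto simp: grw_metric_def C.H_def fun_eq_iff)

lemma nb: "t \<in> J \<Longrightarrow> at t within J \<noteq> bot"
  using at_within_interval_nontrivial[OF J] .

lemma M_simps [simp]: "chart_dom M i = I \<times> chart_dom F i" "chart M i (s, p) = (s, chart F i p)"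
  by (simp_all add: grw_manifold_def)

lemma \<gamma>_eq: "\<gamma> t = (\<tau> t, \<beta> t)"
  by (simp add: \<tau>_def \<beta>_def)

lemma curve: "differentiable_curve M J \<gamma>"
  using geod by (simp add: geodesic_def)

lemma continuous: "continuous_map (top_of_set J) (top_of_set I) \<tau>" "continuous_map (top_of_set J) (mtop F) \<beta>"
proof -
  have "continuous_map (top_of_set J) (prod_topology (top_of_set I) (mtop F)) \<gamma>"
    using curve by (simp add: differentiable_curve_def grw_manifold_def)
  then show "continuous_map (top_of_set J) (top_of_set I) \<tau>" "continuous_map (top_of_set J) (mtop F) \<beta>"
    unfolding \<tau>_def[abs_def] \<beta>_def[abs_def] continuous_map_pairwise by (simp_all add: o_def)
qed

lemma \<tau>_in_I: "t \<in> J \<Longrightarrow> \<tau> t \<in> I"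
  using continuous_map_image_subset_topspace[OF continuous(1)] by auto

lemma in_chart: "t \<in> J \<Longrightarrow> \<gamma> t \<in> chart_dom M i \<longleftrightarrow> \<beta> t \<in> chart_dom F i"
  by (simp add: \<gamma>_eq \<tau>_in_I)

lemma N_open: "openin (top_of_set J) (N i)"
  by (rule preimage_chart_dom_open[OF continuous(2)])

lemma chart_\<gamma>_deriv:
  assumes "t \<in> N i"
  shows "((\<lambda>s. (\<tau> s, x i s)) has_vector_derivative velocity M J \<gamma> i t) (at t within J)"
proof -
  have t: "t \<in> J" "\<gamma> t \<in> chart_dom M i" using assms in_chart by auto
  then have "(chart M i \<circ> \<gamma>) differentiable (at t within J)"
    using curve unfolding differentiable_curve_def by blast
  moreover have "chart M i \<circ> \<gamma> = (\<lambda>s. (\<tau> s, x i s))" by (simp add: fun_eq_iff \<gamma>_eq)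
  ultimately show ?thesis
    unfolding vector_derivative_works velocity_def using t by simp
qed

lemma \<beta>_curve: "differentiable_curve F J \<beta>"
proof -
  have "(chart F i \<circ> \<beta>) differentiable (at t within J)" if "t \<in> J" "\<beta> t \<in> chart_dom F i" for i t
    using bounded_linear.has_vector_derivative[OF bounded_linear_snd chart_\<gamma>_deriv[of t i]] that
    by (auto simp: o_def intro: differentiableI_vector)
  then show ?thesis using continuous(2) by (simp add: differentiable_curve_def)
qed

lemma exists_chart: "t \<in> J \<Longrightarrow> \<exists>i. t \<in> N i"
  using curve_in_chart[OF \<beta>_curve] by blast

lemma \<tau>_deriv:
  assumes "t \<in> J"
  shows "(\<tau> has_real_derivative \<sigma> t) (at t within J)"
proof -
  obtain i where "t \<in> N i" using exists_chart[OF assms] by blast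
  from bounded_linear.has_vector_derivative[OF bounded_linear_fst chart_\<gamma>_deriv[OF this]]
  have "\<tau> differentiable (at t within J)" by (auto intro: differentiableI_vector)
  then show ?thesis
    by (simp add: \<sigma>_def vector_derivative_works has_real_derivative_iff_has_vector_derivative)
qed

lemma velocity_M: "velocity M J \<gamma> i t = (if t \<in> N i then (\<sigma> t, v i t) else 0)"
proof (cases "t \<in> N i")
  case True
  then have t: "t \<in> J" "\<beta> t \<in> chart_dom F i" by auto
  have "fst (velocity M J \<gamma> i t) = \<sigma> t"
    using bounded_linear.has_vector_derivative[OF bounded_linear_fst chart_\<gamma>_deriv[OF True]]
    by (simp add: \<sigma>_def vector_derivative_within[OF nb[OF t(1)]])
  moreover have "snd (velocity M J \<gamma> i t) = v i t"
    using vector_derivative_unique_within[OF nb[OF t(1)] velocity_has_derivative[OF \<beta>_curve t]]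
      bounded_linear.has_vector_derivative[OF bounded_linear_snd chart_\<gamma>_deriv[OF True]]
    by simp
  ultimately show ?thesis using True by (simp add: prod_eq_iff)
next
  case False
  then have n: "\<not> (t \<in> J \<and> \<gamma> t \<in> chart_dom M i)" using in_chart by blast
  show ?thesis by (simp only: velocity_def[of M] if_not_P[OF n] if_not_P[OF False])
qed

lemma covariant_derivative_M:
  assumes t: "t \<in> N i" and X: "X i differentiable (at t within J)"
  shows "covariant_derivative M h J \<gamma> X i t =
    (vector_derivative (\<lambda>s. fst (X i s)) (at t within J) + Q t * (G t)\<^sup>2 * g i (x i t) (v i t) (snd (X i t)),
     D (\<lambda>i s. snd (X i s)) i t + Q t *\<^sub>R (\<sigma> t *\<^sub>R snd (X i t) + fst (X i t) *\<^sub>R v i t))"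
proof -
  have tJ: "t \<in> J" "\<beta> t \<in> chart_dom F i" using t by auto
  have Xd: "(X i has_vector_derivative vector_derivative (X i) (at t within J)) (at t within J)"
    using X by (simp add: vector_derivative_works)
  have "vector_derivative (X i) (at t within J)
    = (vector_derivative (\<lambda>s. fst (X i s)) (at t within J), vector_derivative (\<lambda>s. snd (X i s)) (at t within J))"
    using bounded_linear.has_vector_derivative[OF bounded_linear_fst Xd]
      bounded_linear.has_vector_derivative[OF bounded_linear_snd Xd]
    by (simp add: prod_eq_iff vector_derivative_within[OF nb[OF tJ(1)]])
  moreover have "christoffel (h i) (chart M i (\<gamma> t)) (velocity M J \<gamma> i t) (X i t)
    = (f (\<tau> t) * f1 (\<tau> t) * g i (x i t) (v i t) (snd (X i t)),
       (f1 (\<tau> t) / f (\<tau> t)) *\<^sub>R (\<sigma> t *\<^sub>R snd (X i t) + fst (X i t) *\<^sub>R v i t)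
       + christoffel (g i) (x i t) (v i t) (snd (X i t)))"
    using C.christoffel_H[of "\<tau> t" "x i t" i "\<sigma> t" "v i t" "fst (X i t)" "snd (X i t)"] t \<tau>_in_I
    by (simp add: h_eq \<gamma>_eq velocity_M)
  moreover have "f (\<tau> t) * f1 (\<tau> t) = Q t * (G t)\<^sup>2"
    using C.f_pos[OF \<tau>_in_I[OF tJ(1)]] by (simp add: Q_def G_def power2_eq_square)
  ultimately show ?thesis
    using tJ in_chart[OF tJ(1), of i] by (simp add: covariant_derivative_def Q_def add_ac)
qed

lemma curvature_M:
  assumes t: "t \<in> N i"
  shows "curvature (h i) (chart M i (\<gamma> t)) (\<alpha>, u) (velocity M J \<gamma> i t) (velocity M J \<gamma> i t) =
    (W t * (G t)\<^sup>2 * (\<alpha> * g i (x i t) (v i t) (v i t) - \<sigma> t * g i (x i t) u (v i t)),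
     curvature (g i) (x i t) u (v i t) (v i t) + (W t * \<sigma> t) *\<^sub>R (\<alpha> *\<^sub>R v i t - \<sigma> t *\<^sub>R u)
       + ((Q t)\<^sup>2 * (G t)\<^sup>2) *\<^sub>R (g i (x i t) (v i t) (v i t) *\<^sub>R u - g i (x i t) u (v i t) *\<^sub>R v i t))"
proof -
  have tJ: "t \<in> J" "\<beta> t \<in> chart_dom F i" using t by auto
  have "f (\<tau> t) \<noteq> 0" using C.f_pos[OF \<tau>_in_I[OF tJ(1)]] by simp
  then have "f (\<tau> t) * f2 (\<tau> t) = W t * (G t)\<^sup>2" "(f1 (\<tau> t))\<^sup>2 = (Q t)\<^sup>2 * (G t)\<^sup>2"
    by (simp_all add: W_def Q_def G_def power2_eq_square)
  then show ?thesis
    using C.curvature_H[of "\<tau> t" "x i t" i \<alpha> u "\<sigma> t" "v i t"] t \<tau>_in_I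
    by (simp add: h_eq \<gamma>_eq velocity_M W_def)
qed

text \<open>The geodesic equation of the spacetime, split into base and fiber parts. The last
  conclusion makes \<open>\<beta>\<close> a pregeodesic of the fiber and determines the parameter
  change \<open>r\<close>.\<close>

lemma velocity_deriv:
  assumes t: "t \<in> N i"
  shows "(\<sigma> has_real_derivative - (Q t * (G t)\<^sup>2 * g i (x i t) (v i t) (v i t))) (at t within J)"
    and "v i differentiable (at t within J)"
    and "D v i t = - (2 * Q t * \<sigma> t) *\<^sub>R v i t"
proof -
  have tJ: "t \<in> J" "\<beta> t \<in> chart_dom F i" using t by auto
  have d: "velocity M J \<gamma> i differentiable (at t within J)"
    using geod tJ in_chart unfolding geodesic_def differentiable_field_def by blast
  then have d': "(velocity M J \<gamma> i has_vector_derivative vector_derivative (velocity M J \<gamma> i) (at t within J)) (at t within J)"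
    by (simp add: vector_derivative_works)
  have snd: "(\<lambda>i s. snd (velocity M J \<gamma> i s)) = v"
    by (auto simp: fun_eq_iff velocity_M) (auto simp: velocity_def)
  from bounded_linear.has_vector_derivative[OF bounded_linear_snd d']
  have "(\<lambda>s. snd (velocity M J \<gamma> i s)) differentiable (at t within J)" by (rule differentiableI_vector)
  then show "v i differentiable (at t within J)" using fun_cong[OF snd, of i] by simp
  have "((\<lambda>s. fst (velocity M J \<gamma> i s)) has_vector_derivative vector_derivative (\<lambda>s. fst (velocity M J \<gamma> i s)) (at t within J)) (at t within J)"
    using bounded_linear.has_vector_derivative[OF bounded_linear_fst d', THEN differentiableI_vector]
    by (simp add: vector_derivative_works)
  from has_vector_derivative_cong_openin[OF N_open t this, of \<sigma>]
  have \<sigma>: "(\<sigma> has_vector_derivative vector_derivative (\<lambda>s. fst (velocity M J \<gamma> i s)) (at t within J)) (at t within J)"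
    by (simp add: velocity_M)
  have "covariant_derivative M h J \<gamma> (velocity M J \<gamma>) i t = 0"
    using geod tJ unfolding geodesic_def by blast
  then have *: "vector_derivative (\<lambda>s. fst (velocity M J \<gamma> i s)) (at t within J) + Q t * (G t)\<^sup>2 * g i (x i t) (v i t) (v i t) = 0"
    "D v i t + Q t *\<^sub>R (\<sigma> t *\<^sub>R v i t + \<sigma> t *\<^sub>R v i t) = 0"
    using covariant_derivative_M[of t i "velocity M J \<gamma>", OF t d] t by (simp_all add: snd velocity_M[of i t] zero_prod_def)
  then show "(\<sigma> has_real_derivative - (Q t * (G t)\<^sup>2 * g i (x i t) (v i t) (v i t))) (at t within J)"
    using \<sigma> by (simp add: has_real_derivative_iff_has_vector_derivative add_eq_0_iff2)
  show "D v i t = - (2 * Q t * \<sigma> t) *\<^sub>R v i t"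
    using *(2) by (simp add: add_eq_0_iff2 flip: scaleR_2)
qed

end

section \<open>Sum and product rules for the covariant derivative at one time\<close>

context riemannian
begin

lemma covariant_derivative_add_at:
  assumes nb: "at t within J \<noteq> bot"
    and X: "X i differentiable (at t within J)" and Y: "Y i differentiable (at t within J)"
  shows "covariant_derivative F g J \<beta> (\<lambda>i s. X i s + Y i s) i t
    = covariant_derivative F g J \<beta> X i t + covariant_derivative F g J \<beta> Y i t"
proof -
  interpret C: chart_metric "U i" "g i" by (rule chart_metric)
  have "vector_derivative (\<lambda>s. X i s + Y i s) (at t within J)
      = vector_derivative (X i) (at t within J) + vector_derivative (Y i) (at t within J)"
    by (rule vector_derivative_within[OF nb has_vector_derivative_add])
       (use X Y in \<open>simp_all add: vector_derivative_works\<close>)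
  then show ?thesis
    by (simp add: covariant_derivative_def C.christoffel_linear)
qed

lemma covariant_derivative_scale_at:
  assumes nb: "at t within J \<noteq> bot" and X: "X i differentiable (at t within J)"
    and c: "(c has_real_derivative c') (at t within J)"
    and t: "t \<in> J" "\<beta> t \<in> chart_dom F i"
  shows "covariant_derivative F g J \<beta> (\<lambda>i s. c s *\<^sub>R X i s) i t
    = c' *\<^sub>R X i t + c t *\<^sub>R covariant_derivative F g J \<beta> X i t"
proof -
  interpret C: chart_metric "U i" "g i" by (rule chart_metric)
  have "vector_derivative (\<lambda>s. c s *\<^sub>R X i s) (at t within J)
      = c t *\<^sub>R vector_derivative (X i) (at t within J) + c' *\<^sub>R X i t"
    by (rule vector_derivative_within[OF nb has_vector_derivative_scaleR[OF c]])
       (use X in \<open>simp add: vector_derivative_works\<close>)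
  then show ?thesis
    using t by (simp add: covariant_derivative_def C.christoffel_linear scaleR_add_right)
qed

end

section \<open>The warping function and the fiber speed along the geodesic\<close>

context grw_geodesic
begin

lemma G_pos: "t \<in> J \<Longrightarrow> 0 < G t"
  using f_positive \<tau>_in_I by (simp add: G_def)

lemma chain_\<tau>:
  assumes "t \<in> J" and "(u has_real_derivative u') (at (\<tau> t))"
  shows "((\<lambda>s. u (\<tau> s)) has_real_derivative u' * \<sigma> t) (at t within J)"
  using DERIV_chain2[OF assms(2) \<tau>_deriv[OF assms(1)]] .

lemma G_deriv: "t \<in> J \<Longrightarrow> (G has_real_derivative Q t * G t * \<sigma> t) (at t within J)"
  using chain_\<tau>[OF _ f_derivatives(1)[OF \<tau>_in_I], of t] G_pos[of t]
  by (simp add: G_def[abs_def] Q_def)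

lemma Q_deriv:
  assumes t: "t \<in> J"
  shows "(Q has_real_derivative (W t - (Q t)\<^sup>2) * \<sigma> t) (at t within J)"
proof -
  have f: "f (\<tau> t) \<noteq> 0" using G_pos[OF t] by (simp add: G_def)
  have "((\<lambda>z. f1 z / f z) has_real_derivative (f2 (\<tau> t) * f (\<tau> t) - f1 (\<tau> t) * f1 (\<tau> t)) / (f (\<tau> t) * f (\<tau> t))) (at (\<tau> t))"
    by (rule DERIV_divide[OF f_derivatives(2,1)[OF \<tau>_in_I[OF t]] f])
  moreover have "(f2 (\<tau> t) * f (\<tau> t) - f1 (\<tau> t) * f1 (\<tau> t)) / (f (\<tau> t) * f (\<tau> t)) = W t - (Q t)\<^sup>2"
    using f by (simp add: W_def Q_def field_simps power2_eq_square)
  ultimately show ?thesis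
    using chain_\<tau>[OF t] by (simp add: Q_def[abs_def])
qed

lemma W_continuous: "continuous_on J W"
proof -
  have \<tau>: "continuous_on J \<tau>"
    using \<tau>_deriv by (meson DERIV_continuous continuous_on_eq_continuous_within)
  have "continuous_on I f"
    using f_derivatives(1) by (meson DERIV_isCont continuous_at_imp_continuous_on)
  then have "continuous_on J (\<lambda>t. f (\<tau> t))" "continuous_on J (\<lambda>t. f2 (\<tau> t))"
    using continuous_on_compose2[OF _ \<tau>] f_derivatives(3) \<tau>_in_I by blast+
  moreover have "f (\<tau> t) \<noteq> 0" if "t \<in> J" for t using G_pos[OF that] by (simp add: G_def)
  ultimately show ?thesis
    unfolding W_def[abs_def] by (intro continuous_on_divide) auto
qed

lemma v_field: "field_along F J \<beta> v"
  by (rule velocity_field_along[OF \<beta>_curve nb])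

definition e :: "real \<Rightarrow> real" where "e = inner_along \<beta> v v"

lemma e_eq: "t \<in> N i \<Longrightarrow> e t = g i (x i t) (v i t) (v i t)"
  unfolding e_def by (rule inner_along_eq[OF v_field v_field]) auto

lemma \<sigma>_deriv:
  assumes "t \<in> J"
  shows "(\<sigma> has_real_derivative - (Q t * (G t)\<^sup>2 * e t)) (at t within J)"
proof -
  obtain i where i: "t \<in> N i" using exists_chart[OF assms] by blast
  show ?thesis using velocity_deriv(1)[OF i] by (simp only: e_eq[OF i])
qed

text \<open>Comparison with \<open>G_deriv\<close> shows that \<open>G^4 e\<close> is constant; its
  variation is the source of \<open>\<kappa>\<close>.\<close>

lemma e_deriv:
  assumes t: "t \<in> J"
  shows "(e has_real_derivative - (4 * Q t * \<sigma> t * e t)) (at t within J)"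
proof -
  obtain i where i: "t \<in> N i" using exists_chart[OF t] by blast
  then have x: "x i t \<in> U i" by simp
  have "(e has_real_derivative g i (x i t) (D v i t) (v i t) + g i (x i t) (v i t) (D v i t)) (at t within J)"
    unfolding e_def using i velocity_deriv(2)[OF i]
    by (intro inner_along_has_derivative[OF \<beta>_curve t _ v_field v_field]) auto
  then show ?thesis
    by (simp add: velocity_deriv(3)[OF i] C.bil_simps[OF x] e_eq[OF i] algebra_simps)
qed

section \<open>The change of parameter to the fiber geodesic\<close>

lemma K_eq: "K = r ` J"
  using reparam by (simp add: reparametrization_of_def)

lemma r_deriv:
  assumes "t \<in> J"
  shows "(r has_real_derivative r' t) (at t within J)"
proof -
  have "r differentiable (at t within J)" using reparam assms unfolding reparametrization_of_def by blast
  then show ?thesis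
    by (simp add: r'_def vector_derivative_works has_real_derivative_iff_has_vector_derivative)
qed

lemma r'_nonzero: "t \<in> J \<Longrightarrow> r' t \<noteq> 0"
  using reparam by (simp add: reparametrization_of_def r'_def)

lemma \<beta>_r: "t \<in> J \<Longrightarrow> \<beta> t = \<gamma>F (r t)"
  using reparam by (simp add: reparametrization_of_def \<beta>_def)

lemma r_neq:
  assumes "s \<in> J" "t \<in> J" "s \<noteq> t"
  shows "r s \<noteq> r t"
proof
  assume "r s = r t"
  from rolle_on_interval[OF J(1) assms this r_deriv] obtain c where "c \<in> J" "r' c = 0" by blast
  then show False using r'_nonzero by blast
qed

lemma K_interval: "is_interval K"
proof -
  have "continuous_on J r"
    using r_deriv by (meson DERIV_continuous continuous_on_eq_continuous_within)
  then show ?thesis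
    using J(1) connected_continuous_image[of J r] by (simp add: K_eq is_interval_connected_1)
qed

lemma nbK: "s \<in> K \<Longrightarrow> at s within K \<noteq> bot"
proof (rule at_within_interval_nontrivial[OF K_interval])
  show "r a \<in> K" "r b \<in> K" using J(2,3) by (simp_all add: K_eq)
  show "r a \<noteq> r b" by (rule r_neq[OF J(2-4)])
qed

lemma \<gamma>F_curve: "differentiable_curve F K \<gamma>F"
  using fiber_geod(1) by (simp add: geodesic_def)

lemma T_properties:
  assumes "t \<in> N i"
  shows "T i (r t) \<noteq> 0" and "T i differentiable (at (r t) within K)"
    and "covariant_derivative F g K \<gamma>F T i (r t) = 0"
proof -
  have rt: "r t \<in> K" "\<gamma>F (r t) \<in> chart_dom F i" using assms K_eq \<beta>_r by auto
  show "T i (r t) \<noteq> 0"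
    by (rule geodesic_velocity_nonzero[OF K_interval nbK fiber_geod(1,2) rt])
  show "T i differentiable (at (r t) within K)"
    using fiber_geod(1) rt unfolding geodesic_def differentiable_field_def by simp
  show "covariant_derivative F g K \<gamma>F T i (r t) = 0"
    using fiber_geod(1) rt(1) unfolding geodesic_def by simp
qed

lemma v_T:
  assumes t: "t \<in> J"
  shows "v i t = r' t *\<^sub>R T i (r t)"
proof (cases "\<beta> t \<in> chart_dom F i")
  case True
  then have i: "t \<in> N i" using t by simp
  show ?thesis
    by (rule covariant_derivative_reparametrized(3)[of t J \<gamma>F r i "r' t" K \<beta> T "\<lambda>_. 1" 0 "\<lambda>i s. T i (r s)"])
       (use nb[OF t] t True r_deriv[OF t] nbK \<gamma>F_curve \<beta>_r T_properties(2)[OF i] in \<open>auto simp: K_eq\<close>)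
next
  case False
  then show ?thesis using t by (simp add: velocity_def \<beta>_r)
qed

lemma e_pos:
  assumes t: "t \<in> J"
  shows "0 < e t"
proof -
  obtain i where i: "t \<in> N i" using exists_chart[OF t] by blast
  have "v i t \<noteq> 0" using v_T[OF t] T_properties(1)[OF i] r'_nonzero[OF t] by simp
  then show ?thesis using C.pos[of "x i t" i] i e_eq[OF i] by simp
qed

text \<open>\<open>r\<close> is assumed to be differentiable once, so the second derivative has to
  be earned. In \<open>v = r' T\<close> the fields \<open>v\<close> and \<open>T\<close> along
  \<open>r\<close> are differentiable and \<open>T\<close> has no zero, so \<open>r'\<close> is a
  quotient of Euclidean products of components. Computing \<open>D v\<close> from this product with
  \<open>D T = 0\<close>, and from the geodesic equation, identifies its derivative.\<close>

lemma r'_deriv: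
  assumes t: "t \<in> J"
  shows "(r' has_real_derivative - (2 * Q t * \<sigma> t * r' t)) (at t within J)"
proof -
  obtain i where i: "t \<in> N i" using exists_chart[OF t] by blast
  have Td: "(\<lambda>s. T i (r s)) differentiable (at t within J)"
    by (rule covariant_derivative_reparametrized(1)[of t J \<gamma>F r i "r' t" K \<beta> T "\<lambda>_. 1" 0 "\<lambda>i s. T i (r s)"])
       (use nb[OF t] t i r_deriv[OF t] nbK \<gamma>F_curve \<beta>_r T_properties(2)[OF i] in \<open>auto simp: K_eq\<close>)
  have "(\<lambda>s. (v i s \<bullet> T i (r s)) / (T i (r s) \<bullet> T i (r s))) differentiable (at t within J)"
    using velocity_deriv(2)[OF i] Td T_properties(1)[OF i] by (intro differentiable_divide) auto
  then obtain d where "((\<lambda>s. (v i s \<bullet> T i (r s)) / (T i (r s) \<bullet> T i (r s))) has_real_derivative d) (at t within J)"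
    by (auto simp: real_differentiable_def)
  from has_real_derivative_cong_openin[OF N_open i this, of r']
  have d: "(r' has_real_derivative d) (at t within J)"
    using T_properties(1) by (simp add: v_T)
  have "D v i t = d *\<^sub>R T i (r t) + (r' t * r' t) *\<^sub>R covariant_derivative F g K \<gamma>F T i (r t)"
    by (rule covariant_derivative_reparametrized(2)[of t J \<gamma>F r i "r' t" K \<beta> T r' d v])
       (use nb[OF t] t i r_deriv[OF t] nbK \<gamma>F_curve \<beta>_r T_properties(2)[OF i] d v_T in \<open>auto simp: K_eq\<close>)
  then have "d *\<^sub>R T i (r t) = (- (2 * Q t * \<sigma> t * r' t)) *\<^sub>R T i (r t)"
    using T_properties(3)[OF i] velocity_deriv(3)[OF i] v_T[OF t] by simp
  then have "d = - (2 * Q t * \<sigma> t * r' t)"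
    using T_properties(1)[OF i] by (simp only: scaleR_cancel_right) simp
  with d show ?thesis by simp
qed

section \<open>Base and fiber components of a field along the spacetime geodesic\<close>

lemma transition_M:
  assumes "t \<in> N i" "t \<in> N j"
  shows "frechet_derivative (transition M i j) (at (chart M i (\<gamma> t))) V
    = (fst V, frechet_derivative (transition F i j) (at (x i t)) (snd V))"
    and "linear (frechet_derivative (transition M i j) (at (chart M i (\<gamma> t))))"
proof -
  let ?B = "frechet_derivative (transition F i j) (at (x i t))"
  have inj: "inj_on (chart M i) (I \<times> chart_dom F i)"
    using chart_inj[of i] by (auto simp: inj_on_def)
  have eq: "transition M i j y = (fst y, transition F i j (snd y))" if "y \<in> I \<times> U i" for y
  proof -
    obtain s p where sp: "y = chart M i (s, p)" "s \<in> I" "p \<in> chart_dom F i" using \<open>y \<in> I \<times> U i\<close> by auto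
    then have "inv_into (chart_dom M i) (chart M i) y = (s, p)"
      using inv_into_f_f[OF inj, of "(s, p)"] by simp
    then show ?thesis
      using transition_chart[OF sp(3), of j] sp(1) by (simp add: transition_def[of M])
  qed
  have "(transition F i j has_derivative ?B) (at (x i t))"
    using transition_differentiable assms by (simp add: frechet_derivative_works)
  then have "((\<lambda>y. (fst y, transition F i j (snd y))) has_derivative (\<lambda>k. (fst k, ?B (snd k)))) (at (\<tau> t, x i t))"
    by (intro has_derivative_Pair has_derivative_fst has_derivative_ident C.has_derivative_along_fiber)
  then have d: "(transition M i j has_derivative (\<lambda>k. (fst k, ?B (snd k)))) (at (\<tau> t, x i t))"
    by (rule has_derivative_transform_within_open[of _ _ _ _ "I \<times> U i"])
       (use base_open C.open_U assms \<tau>_in_I eq in \<open>auto simp: open_Times\<close>)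
  have fd: "frechet_derivative (transition M i j) (at (chart M i (\<gamma> t))) = (\<lambda>k. (fst k, ?B (snd k)))"
    using frechet_derivative_at[OF d] by (simp add: \<gamma>_eq)
  show "frechet_derivative (transition M i j) (at (chart M i (\<gamma> t))) V = (fst V, ?B (snd V))"
    by (simp add: fd)
  show "linear (frechet_derivative (transition M i j) (at (chart M i (\<gamma> t))))"
    using has_derivative_linear[OF d] by (simp add: fd)
qed

text \<open>The transition maps of the spacetime fix the base coordinate, so the base component of a
  field is the same in all charts and any of them may be picked.\<close>

definition \<alpha> :: "('i \<Rightarrow> real \<Rightarrow> real \<times> 'e) \<Rightarrow> real \<Rightarrow> real" where
  "\<alpha> X t = fst (X (SOME i. t \<in> N i) t)"

abbreviation Y :: "('i \<Rightarrow> real \<Rightarrow> real \<times> 'e) \<Rightarrow> 'i \<Rightarrow> real \<Rightarrow> 'e" where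
  "Y X \<equiv> \<lambda>i t. snd (X i t)"

definition \<alpha>1 :: "('i \<Rightarrow> real \<Rightarrow> real \<times> 'e) \<Rightarrow> real \<Rightarrow> real" where
  "\<alpha>1 X t = vector_derivative (\<alpha> X) (at t within J)"

lemma field_along_M:
  assumes "field_along M J \<gamma> X"
  shows "field_along F J \<beta> (Y X)" and "t \<in> N i \<Longrightarrow> \<alpha> X t = fst (X i t)" and "t \<notin> N i \<Longrightarrow> X i t = 0"
proof -
  have tr: "X j t = (fst (X i t), frechet_derivative (transition F i j) (at (x i t)) (snd (X i t)))"
    if "t \<in> N i" "t \<in> N j" for i j t
  proof -
    have "X j t = frechet_derivative (transition M i j) (at (chart M i (\<gamma> t))) (X i t)"
      using assms that in_chart unfolding field_along_def by blast
    then show ?thesis by (simp only: transition_M(1)[OF that])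
  qed
  have z: "X i t = 0" if "t \<notin> N i" for i t
    using assms that in_chart unfolding field_along_def by blast
  then show "t \<notin> N i \<Longrightarrow> X i t = 0" .
  show "field_along F J \<beta> (Y X)"
    unfolding field_along_def
  proof (intro conjI allI ballI impI)
    show "Y X i t = 0" if "\<not> (t \<in> J \<and> \<beta> t \<in> chart_dom F i)" for i t
      using z[of t i] that by simp
    show "Y X j t = frechet_derivative (transition F i j) (at (x i t)) (Y X i t)"
      if "t \<in> J" "\<beta> t \<in> chart_dom F i \<inter> chart_dom F j" for i j t
      using tr[of t i j] that by simp
  qed
  show "\<alpha> X t = fst (X i t)" if "t \<in> N i"
  proof -
    have "t \<in> N (SOME i. t \<in> N i)" using that by (rule someI)
    from tr[OF that this] show ?thesis by (simp add: \<alpha>_def)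
  qed
qed

end

section \<open>Jacobi fields of a GRW spacetime\<close>

lemma differentiable_cong_openin:
  fixes F :: "real \<Rightarrow> 'a::real_normed_vector"
  assumes N: "openin (top_of_set J) N" "t \<in> N"
    and F: "F differentiable (at t within J)" and FG: "\<And>s. s \<in> N \<Longrightarrow> F s = H s"
  shows "H differentiable (at t within J)"
  using has_vector_derivative_cong_openin[OF N F[unfolded vector_derivative_works] FG]
  by (rule differentiableI_vector)

lemma differentiable_fst_snd:
  fixes F :: "real \<Rightarrow> 'a::real_normed_vector \<times> 'b::real_normed_vector"
  assumes "F differentiable (at t within J)"
  shows "(\<lambda>s. fst (F s)) differentiable (at t within J)" "(\<lambda>s. snd (F s)) differentiable (at t within J)"
  using bounded_linear.has_vector_derivative[OF bounded_linear_fst assms[unfolded vector_derivative_works]]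
    bounded_linear.has_vector_derivative[OF bounded_linear_snd assms[unfolded vector_derivative_works]]
  by (auto intro: differentiableI_vector)

lemma differentiable_from_real_derivative:
  "(u has_real_derivative u') (at t within J) \<Longrightarrow> u differentiable (at t within J)"
  by (auto simp: real_differentiable_def)

context grw_geodesic
begin

definition \<phi> :: "('i \<Rightarrow> real \<Rightarrow> real \<times> 'e) \<Rightarrow> real \<Rightarrow> real" where
  "\<phi> X = inner_along \<beta> (Y X) v"

text \<open>This is \<open>g(DY, v)\<close>, by \<open>\<psi>_eq\<close>. It is encoded through the
  derivative of \<open>\<phi>\<close>, which is chart independent; the added term compensates for
  \<open>D v = - 2 Q \<sigma> v\<close> in the product rule.\<close>

definition \<psi> :: "('i \<Rightarrow> real \<Rightarrow> real \<times> 'e) \<Rightarrow> real \<Rightarrow> real" where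
  "\<psi> X t = vector_derivative (\<phi> X) (at t within J) + 2 * Q t * \<sigma> t * \<phi> X t"

context
  fixes X :: "'i \<Rightarrow> real \<Rightarrow> real \<times> 'e"
  assumes jac: "jacobi_field M h J \<gamma> X"
begin

lemma along: "field_along M J \<gamma> X"
  using jac by (simp add: jacobi_field_def)

lemma jacobi_differentiable:
  assumes "t \<in> N i"
  shows "X i differentiable (at t within J)"
    and "covariant_derivative M h J \<gamma> X i differentiable (at t within J)"
proof -
  have t: "t \<in> J" "\<gamma> t \<in> chart_dom M i" using assms in_chart by auto
  then show "X i differentiable (at t within J)"
    "covariant_derivative M h J \<gamma> X i differentiable (at t within J)"
    using jac unfolding jacobi_field_def differentiable_field_def by simp_all
qed

lemma Y_differentiable: "t \<in> N i \<Longrightarrow> Y X i differentiable (at t within J)"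
  by (rule differentiable_fst_snd(2)[OF jacobi_differentiable(1)])

lemma base_component_deriv:
  assumes t: "t \<in> N i"
  shows "(\<alpha> X has_real_derivative \<alpha>1 X t) (at t within J)"
    and "vector_derivative (\<lambda>s. fst (X i s)) (at t within J) = \<alpha>1 X t"
proof -
  have "((\<lambda>s. fst (X i s)) has_vector_derivative vector_derivative (\<lambda>s. fst (X i s)) (at t within J)) (at t within J)"
    using differentiable_fst_snd(1)[OF jacobi_differentiable(1)[OF t]] by (simp add: vector_derivative_works)
  then have d: "(\<alpha> X has_vector_derivative vector_derivative (\<lambda>s. fst (X i s)) (at t within J)) (at t within J)"
    by (rule has_vector_derivative_cong_openin[OF N_open t]) (rule field_along_M(2)[OF along, symmetric])
  have tJ: "t \<in> J" using t by simp
  show eq: "vector_derivative (\<lambda>s. fst (X i s)) (at t within J) = \<alpha>1 X t"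
    unfolding \<alpha>1_def using vector_derivative_within[OF nb[OF tJ] d] by simp
  show "(\<alpha> X has_real_derivative \<alpha>1 X t) (at t within J)"
    using d by (simp add: eq has_real_derivative_iff_has_vector_derivative)
qed

lemma covariant_derivative_jacobi:
  assumes t: "t \<in> N i"
  shows "covariant_derivative M h J \<gamma> X i t = (\<alpha>1 X t + Q t * (G t)\<^sup>2 * g i (x i t) (Y X i t) (v i t),
    D (Y X) i t + Q t *\<^sub>R (\<sigma> t *\<^sub>R Y X i t + \<alpha> X t *\<^sub>R v i t))"
  using covariant_derivative_M[of t i X, OF t jacobi_differentiable(1)[OF t]] t
  by (simp add: base_component_deriv(2)[OF t] field_along_M(2)[OF along t] C.sym[of "x i t" i "v i t" "Y X i t"])

text \<open>The definition of a Jacobi field controls the spacetime covariant derivative. Its fiber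
  component is \<open>D (Y X)\<close> plus differentiable terms, which are subtracted.\<close>

lemma DY_differentiable:
  assumes t: "t \<in> N i"
  shows "D (Y X) i differentiable (at t within J)"
proof -
  have tJ: "t \<in> J" using t by simp
  have "(\<lambda>s. snd (covariant_derivative M h J \<gamma> X i s) - Q s *\<^sub>R (\<sigma> s *\<^sub>R Y X i s + \<alpha> X s *\<^sub>R v i s))
      differentiable (at t within J)"
    using differentiable_fst_snd(2)[OF jacobi_differentiable(2)[OF t]]
      differentiable_from_real_derivative[OF Q_deriv[OF tJ]]
      differentiable_from_real_derivative[OF \<sigma>_deriv[OF tJ]]
      differentiable_from_real_derivative[OF base_component_deriv(1)[OF t]]
      Y_differentiable[OF t] velocity_deriv(2)[OF t]
    by (intro differentiable_diff differentiable_scaleR differentiable_add)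
  then show ?thesis
    by (rule differentiable_cong_openin[OF N_open t]) (simp add: covariant_derivative_jacobi)
qed

lemma \<phi>_eq: "t \<in> N i \<Longrightarrow> \<phi> X t = g i (x i t) (Y X i t) (v i t)"
  unfolding \<phi>_def by (rule inner_along_eq[OF field_along_M(1)[OF along] v_field]) auto

lemma \<phi>_deriv:
  assumes t: "t \<in> N i"
  shows "(\<phi> X has_real_derivative g i (x i t) (D (Y X) i t) (v i t) - 2 * Q t * \<sigma> t * \<phi> X t) (at t within J)"
proof -
  have tJ: "t \<in> J" "\<beta> t \<in> chart_dom F i" and x: "x i t \<in> U i" using t by auto
  have "(\<phi> X has_real_derivative g i (x i t) (D (Y X) i t) (v i t) + g i (x i t) (Y X i t) (D v i t)) (at t within J)"
    unfolding \<phi>_def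
    by (rule inner_along_has_derivative[where i=i and J=J and X="Y X" and Y=v, OF \<beta>_curve tJ field_along_M(1)[OF along] v_field
          Y_differentiable[OF t] velocity_deriv(2)[OF t]])
  then show ?thesis
    by (simp add: velocity_deriv(3)[OF t] C.bil_simps[OF x] \<phi>_eq[OF t])
qed

lemma \<psi>_eq:
  assumes t: "t \<in> N i"
  shows "\<psi> X t = g i (x i t) (D (Y X) i t) (v i t)"
proof -
  have tJ: "t \<in> J" using t by simp
  show ?thesis
    using vector_derivative_within[OF nb[OF tJ] \<phi>_deriv[OF t, unfolded has_real_derivative_iff_has_vector_derivative]]
    by (simp add: \<psi>_def)
qed

text \<open>The first conclusion differentiates the base component of the covariant derivative,
  which is \<open>\<alpha>1 + Q G^2 \<phi>\<close>; the passage to \<open>\<alpha>1\<close> itself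
  is made in \<open>\<alpha>1_deriv\<close>.\<close>

lemma jacobi_equation_split:
  assumes t: "t \<in> N i"
  shows "vector_derivative (\<lambda>s. fst (covariant_derivative M h J \<gamma> X i s)) (at t within J)
      = - (Q t * (G t)\<^sup>2 * (\<psi> X t + Q t * (\<sigma> t * \<phi> X t + \<alpha> X t * e t)))
        - W t * (G t)\<^sup>2 * (\<alpha> X t * e t - \<sigma> t * \<phi> X t)"
    and "D (D (Y X)) i t + curvature (g i) (x i t) (Y X i t) (v i t) (v i t)
      + (2 * (W t - (Q t)\<^sup>2) * \<sigma> t * \<alpha> X t + 2 * Q t * \<alpha>1 X t) *\<^sub>R v i t + (2 * Q t * \<sigma> t) *\<^sub>R D (Y X) i t = 0"
proof -
  have tJ: "t \<in> J" "\<beta> t \<in> chart_dom F i" and x: "x i t \<in> U i" using t by auto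
  let ?X2 = "covariant_derivative M h J \<gamma> X"
  \<comment> \<open>An equality of whole functions, so that it can be rewritten under
    \<open>D\<close>. Outside the charts all terms are 0 by convention.\<close>
  have Y2: "Y ?X2 = (\<lambda>i s. D (Y X) i s + ((Q s * \<sigma> s) *\<^sub>R Y X i s + (Q s * \<alpha> X s) *\<^sub>R v i s))"
  proof (intro ext)
    fix j s
    show "Y ?X2 j s = D (Y X) j s + ((Q s * \<sigma> s) *\<^sub>R Y X j s + (Q s * \<alpha> X s) *\<^sub>R v j s)"
    proof (cases "s \<in> N j")
      case True
      then show ?thesis using covariant_derivative_jacobi[OF True] by (simp add: scaleR_add_right)
    next
      case False
      then have n: "\<not> (s \<in> J \<and> \<gamma> s \<in> chart_dom M j)" "\<not> (s \<in> J \<and> \<beta> s \<in> chart_dom F j)"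
        using in_chart by blast+
      have "?X2 j s = 0" "D (Y X) j s = 0" "v j s = 0" "X j s = 0"
        by (simp_all only: covariant_derivative_def velocity_def if_not_P[OF n(1)] if_not_P[OF n(2)]
            field_along_M(3)[OF along False])
      then show ?thesis by simp
    qed
  qed
  have Qd: "Q differentiable (at t within J)" and \<sigma>d: "\<sigma> differentiable (at t within J)"
    and \<alpha>d: "\<alpha> X differentiable (at t within J)"
    using Q_deriv[OF tJ(1)] \<sigma>_deriv[OF tJ(1)] base_component_deriv(1)[OF t]
    by (blast intro: differentiable_from_real_derivative)+
  have Q\<sigma>: "((\<lambda>s. Q s * \<sigma> s) has_real_derivative (W t - (Q t)\<^sup>2) * (\<sigma> t)\<^sup>2 - (Q t)\<^sup>2 * (G t)\<^sup>2 * e t) (at t within J)"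
    by (rule derivative_eq_intros Q_deriv[OF tJ(1)] \<sigma>_deriv[OF tJ(1)] refl)+ (simp add: algebra_simps power2_eq_square)
  have Q\<alpha>: "((\<lambda>s. Q s * \<alpha> X s) has_real_derivative (W t - (Q t)\<^sup>2) * \<sigma> t * \<alpha> X t + Q t * \<alpha>1 X t) (at t within J)"
    by (rule derivative_eq_intros Q_deriv[OF tJ(1)] base_component_deriv(1)[OF t] refl)+ (simp add: algebra_simps power2_eq_square)
  have dY: "(\<lambda>s. (Q s * \<sigma> s) *\<^sub>R Y X i s) differentiable (at t within J)"
    and dv: "(\<lambda>s. (Q s * \<alpha> X s) *\<^sub>R v i s) differentiable (at t within J)"
    using Qd \<sigma>d \<alpha>d Y_differentiable[OF t] velocity_deriv(2)[OF t]
    by (auto intro: differentiable_scaleR differentiable_mult)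
  have DY2: "D (Y ?X2) i t = D (D (Y X)) i t
      + (((W t - (Q t)\<^sup>2) * (\<sigma> t)\<^sup>2 - (Q t)\<^sup>2 * (G t)\<^sup>2 * e t) *\<^sub>R Y X i t + (Q t * \<sigma> t) *\<^sub>R D (Y X) i t
        + (((W t - (Q t)\<^sup>2) * \<sigma> t * \<alpha> X t + Q t * \<alpha>1 X t) *\<^sub>R v i t + (Q t * \<alpha> X t) *\<^sub>R D v i t))"
    unfolding Y2
      covariant_derivative_add_at[of t J "D (Y X)" i "\<lambda>i s. (Q s * \<sigma> s) *\<^sub>R Y X i s + (Q s * \<alpha> X s) *\<^sub>R v i s",
        OF nb[OF tJ(1)] DY_differentiable[OF t] differentiable_add[OF dY dv]]
      covariant_derivative_add_at[of t J "\<lambda>i s. (Q s * \<sigma> s) *\<^sub>R Y X i s" i "\<lambda>i s. (Q s * \<alpha> X s) *\<^sub>R v i s",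
        OF nb[OF tJ(1)] dY dv]
      covariant_derivative_scale_at[of t J "Y X" i "\<lambda>s. Q s * \<sigma> s" _ \<beta>, OF nb[OF tJ(1)] Y_differentiable[OF t] Q\<sigma> tJ]
      covariant_derivative_scale_at[of t J v i "\<lambda>s. Q s * \<alpha> X s" _ \<beta>, OF nb[OF tJ(1)] velocity_deriv(2)[OF t] Q\<alpha> tJ] ..
  have "covariant_derivative M h J \<gamma> ?X2 i t
      + curvature (h i) (chart M i (\<gamma> t)) (X i t) (velocity M J \<gamma> i t) (velocity M J \<gamma> i t) = 0"
    using jac tJ in_chart[OF tJ(1), of i] unfolding jacobi_field_def by blast
  moreover have "X i t = (\<alpha> X t, Y X i t)" using field_along_M(2)[OF along t] by simp
  ultimately have eq: "covariant_derivative M h J \<gamma> ?X2 i t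
      + (W t * (G t)\<^sup>2 * (\<alpha> X t * e t - \<sigma> t * \<phi> X t),
     curvature (g i) (x i t) (Y X i t) (v i t) (v i t) + (W t * \<sigma> t) *\<^sub>R (\<alpha> X t *\<^sub>R v i t - \<sigma> t *\<^sub>R Y X i t)
       + ((Q t)\<^sup>2 * (G t)\<^sup>2) *\<^sub>R (e t *\<^sub>R Y X i t - \<phi> X t *\<^sub>R v i t)) = 0"
    using curvature_M[OF t, of "\<alpha> X t" "Y X i t"] by (simp only: e_eq[OF t] \<phi>_eq[OF t])
  have B: "Y ?X2 i t = D (Y X) i t + Q t *\<^sub>R (\<sigma> t *\<^sub>R Y X i t + \<alpha> X t *\<^sub>R v i t)"
    and A: "fst (?X2 i t) = \<alpha>1 X t + Q t * (G t)\<^sup>2 * \<phi> X t"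
    by (simp_all add: covariant_derivative_jacobi[OF t] \<phi>_eq[OF t])
  have gB: "g i (x i t) (v i t) (Y ?X2 i t) = \<psi> X t + Q t * (\<sigma> t * \<phi> X t + \<alpha> X t * e t)"
    unfolding C.sym[OF x, of "v i t" "Y ?X2 i t"] unfolding B
    by (simp add: C.bil_simps[OF x] \<psi>_eq[OF t] \<phi>_eq[OF t] e_eq[OF t])
  note split = covariant_derivative_M[of t i ?X2, OF t jacobi_differentiable(2)[OF t], unfolded gB A DY2]
  from eq show "vector_derivative (\<lambda>s. fst (?X2 i s)) (at t within J)
      = - (Q t * (G t)\<^sup>2 * (\<psi> X t + Q t * (\<sigma> t * \<phi> X t + \<alpha> X t * e t)))
        - W t * (G t)\<^sup>2 * (\<alpha> X t * e t - \<sigma> t * \<phi> X t)"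
    unfolding split by (simp add: zero_prod_def)
  have "0 = snd (covariant_derivative M h J \<gamma> ?X2 i t
      + (W t * (G t)\<^sup>2 * (\<alpha> X t * e t - \<sigma> t * \<phi> X t),
     curvature (g i) (x i t) (Y X i t) (v i t) (v i t) + (W t * \<sigma> t) *\<^sub>R (\<alpha> X t *\<^sub>R v i t - \<sigma> t *\<^sub>R Y X i t)
       + ((Q t)\<^sup>2 * (G t)\<^sup>2) *\<^sub>R (e t *\<^sub>R Y X i t - \<phi> X t *\<^sub>R v i t)))"
    by (simp only: eq) simp
  \<comment> \<open>The multiples of \<open>Y X\<close> from the two connection terms cancel those
    of the warped curvature, and so do the terms \<open>Q^2 G^2 \<phi> v\<close>.\<close>
  also have "\<dots> = D (D (Y X)) i t + curvature (g i) (x i t) (Y X i t) (v i t) (v i t)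
      + (2 * (W t - (Q t)\<^sup>2) * \<sigma> t * \<alpha> X t + 2 * Q t * \<alpha>1 X t) *\<^sub>R v i t + (2 * Q t * \<sigma> t) *\<^sub>R D (Y X) i t"
    unfolding split snd_add snd_conv B velocity_deriv(3)[OF t]
    by (simp add: algebra_simps power2_eq_square flip: scaleR_2)
  finally show "D (D (Y X)) i t + curvature (g i) (x i t) (Y X i t) (v i t) (v i t)
      + (2 * (W t - (Q t)\<^sup>2) * \<sigma> t * \<alpha> X t + 2 * Q t * \<alpha>1 X t) *\<^sub>R v i t + (2 * Q t * \<sigma> t) *\<^sub>R D (Y X) i t = 0"
    by (rule sym)
qed

lemma \<alpha>1_deriv:
  assumes t: "t \<in> N i"
  shows "(\<alpha>1 X has_real_derivative
      - (2 * Q t * (G t)\<^sup>2 * \<psi> X t) - ((Q t)\<^sup>2 + W t) * (G t)\<^sup>2 * \<alpha> X t * e t) (at t within J)"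
proof -
  have tJ: "t \<in> J" using t by auto
  let ?A = "\<lambda>s. fst (covariant_derivative M h J \<gamma> X i s)"
  have A: "(?A has_real_derivative vector_derivative ?A (at t within J)) (at t within J)"
    using differentiable_fst_snd(1)[OF jacobi_differentiable(2)[OF t]]
    by (simp add: vector_derivative_works has_real_derivative_iff_has_vector_derivative)
  \<comment> \<open>Removing the Christoffel term from the base component leaves
    \<open>\<alpha>1 X\<close>. All terms with \<open>\<phi>\<close> cancel in the derivative, so
    the equation for \<open>\<alpha>\<close> involves the fiber through \<open>\<psi>\<close>
    alone.\<close>
  have "((\<lambda>s. ?A s - Q s * (G s)\<^sup>2 * \<phi> X s) has_real_derivative
      - (2 * Q t * (G t)\<^sup>2 * \<psi> X t) - ((Q t)\<^sup>2 + W t) * (G t)\<^sup>2 * \<alpha> X t * e t) (at t within J)"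
    by (rule derivative_eq_intros A Q_deriv[OF tJ] G_deriv[OF tJ] \<phi>_deriv[OF t] refl)+
       (simp add: jacobi_equation_split(1)[OF t] \<psi>_eq[OF t, symmetric] algebra_simps power2_eq_square)
  moreover have "?A s - Q s * (G s)\<^sup>2 * \<phi> X s = \<alpha>1 X s" if "s \<in> N i" for s
    by (simp add: covariant_derivative_jacobi[OF that] \<phi>_eq[OF that])
  ultimately show ?thesis
    by (rule has_real_derivative_cong_openin[OF N_open t])
qed

lemma \<psi>_deriv:
  assumes t: "t \<in> N i"
  shows "(\<psi> X has_real_derivative - (2 * (W t - (Q t)\<^sup>2) * \<alpha> X t * \<sigma> t * e t)
      - 2 * Q t * \<alpha>1 X t * e t - 4 * Q t * \<sigma> t * \<psi> X t) (at t within J)"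
proof -
  have tJ: "t \<in> J" "\<beta> t \<in> chart_dom F i" and x: "x i t \<in> U i" using t by auto
  have "((\<lambda>s. g i (x i s) (D (Y X) i s) (v i s)) has_real_derivative
      g i (x i t) (D (D (Y X)) i t) (v i t) + g i (x i t) (D (Y X) i t) (D v i t)) (at t within J)"
    by (rule product_rule_in_chart[where X="D (Y X)" and Y=v and i=i, OF \<beta>_curve tJ DY_differentiable[OF t] velocity_deriv(2)[OF t]])
  then have d: "(\<psi> X has_real_derivative
      g i (x i t) (D (D (Y X)) i t) (v i t) + g i (x i t) (D (Y X) i t) (D v i t)) (at t within J)"
    by (rule has_real_derivative_cong_openin[OF N_open t]) (rule \<psi>_eq[symmetric])
  \<comment> \<open>The fiber equation paired with \<open>v\<close>. The curvature term drops out by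
    \<open>curvature_skew\<close>, which closes the scalar system.\<close>
  have "0 = g i (x i t) (D (D (Y X)) i t + curvature (g i) (x i t) (Y X i t) (v i t) (v i t)
      + (2 * (W t - (Q t)\<^sup>2) * \<sigma> t * \<alpha> X t + 2 * Q t * \<alpha>1 X t) *\<^sub>R v i t + (2 * Q t * \<sigma> t) *\<^sub>R D (Y X) i t) (v i t)"
    unfolding jacobi_equation_split(2)[OF t] by (simp add: C.bil_simps[OF x])
  then have "g i (x i t) (D (D (Y X)) i t) (v i t) = - (2 * (W t - (Q t)\<^sup>2) * \<sigma> t * \<alpha> X t + 2 * Q t * \<alpha>1 X t) * e t
      - 2 * Q t * \<sigma> t * \<psi> X t"
    by (simp add: C.bil_simps[OF x] C.curvature_skew[OF x] e_eq[OF t] \<psi>_eq[OF t] algebra_simps)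
  with d show ?thesis
    by (simp add: velocity_deriv(3)[OF t] C.bil_simps[OF x] \<psi>_eq[OF t, symmetric] algebra_simps)
qed

lemma tangential:
  assumes "\<And>i. X i a = 0" "\<And>i. X i b = 0"
  shows "tangential_jacobi J a b G Q W \<sigma> e (\<alpha> X) (\<alpha>1 X) (\<phi> X) (\<psi> X)"
proof (unfold_locales, rule J(1), rule J(2), rule J(3), rule J(4))
  fix t assume t: "t \<in> J"
  obtain i where i: "t \<in> N i" using exists_chart[OF t] by blast
  show "(\<alpha> X has_real_derivative \<alpha>1 X t) (at t within J)" by (rule base_component_deriv(1)[OF i])
  show "(\<alpha>1 X has_real_derivative
      - (2 * Q t * (G t)\<^sup>2 * \<psi> X t) - ((Q t)\<^sup>2 + W t) * (G t)\<^sup>2 * \<alpha> X t * e t) (at t within J)"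
    by (rule \<alpha>1_deriv[OF i])
  show "(\<phi> X has_real_derivative \<psi> X t - 2 * Q t * \<sigma> t * \<phi> X t) (at t within J)"
    using \<phi>_deriv[OF i] by (simp only: \<psi>_eq[OF i])
  show "(\<psi> X has_real_derivative - (2 * (W t - (Q t)\<^sup>2) * \<alpha> X t * \<sigma> t * e t)
      - 2 * Q t * \<alpha>1 X t * e t - 4 * Q t * \<sigma> t * \<psi> X t) (at t within J)"
    by (rule \<psi>_deriv[OF i])
next
  have z: "\<phi> X t = 0" if "t \<in> J" "\<And>i. X i t = 0" for t
  proof -
    obtain i where i: "t \<in> N i" using exists_chart[OF \<open>t \<in> J\<close>] by blast
    then show ?thesis using \<phi>_eq[OF i] that by (simp add: C.bil_simps)
  qed
  show "\<phi> X a = 0" "\<phi> X b = 0" using z J assms by blast+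
  show "\<alpha> X a = 0" "\<alpha> X b = 0" by (simp_all add: \<alpha>_def assms)
qed (fact G_pos e_pos G_deriv Q_deriv W_continuous \<sigma>_deriv e_deriv)+

end

end

text \<open>Under the change of parameter \<open>v = r' T\<close>, the factor obtained here is the
  one that the second covariant derivative acquires.\<close>

lemma (in chart_metric) curvature_rescale:
  assumes x: "x \<in> U"
  shows "curvature h x u (c *\<^sub>R v) (c *\<^sub>R v) = (c * c) *\<^sub>R curvature h x u v v"
proof -
  have d1: "d\<Gamma> x (c *\<^sub>R z) u w = c *\<^sub>R d\<Gamma> x z u w" for z u w
    using linear_scale[OF has_derivative_linear[OF christoffel_has_derivative[OF x]]] .
  have "((\<lambda>y. \<Gamma> y (a *\<^sub>R u) (b *\<^sub>R w)) has_derivative (\<lambda>z. (a * b) *\<^sub>R d\<Gamma> x z u w)) (at x)" for a b u w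
    by (rule has_derivative_transform_within_open[OF has_derivative_scaleR_right[OF christoffel_has_derivative[OF x]] open_U x])
       (simp add: christoffel_linear)
  from fun_cong[OF has_derivative_unique[OF christoffel_has_derivative[OF x] this]]
  have d2: "d\<Gamma> x z (a *\<^sub>R u) (b *\<^sub>R w) = (a * b) *\<^sub>R d\<Gamma> x z u w" for a b z u w .
  show ?thesis
    unfolding curvature_def d\<Gamma>_def[symmetric]
    using d2[of u c v c v] d2[of v 1 u c v]
    by (simp add: d1 christoffel_linear[OF x] scaleR_add_right scaleR_diff_right)
qed

section \<open>Lifting Jacobi fields of the fiber and projecting Jacobi fields of the
  spacetime\<close>

context grw_geodesic
begin

lemma r_in_K: "t \<in> J \<Longrightarrow> r t \<in> K"
  by (simp add: K_eq)

definition \<rho> :: "real \<Rightarrow> real" where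
  "\<rho> = (SOME \<rho>. \<forall>t\<in>J. \<rho> (r t) = t \<and> (\<rho> has_real_derivative inverse (r' t)) (at (r t) within K))"

lemma \<rho>_r: "t \<in> J \<Longrightarrow> \<rho> (r t) = t"
  and \<rho>_deriv: "t \<in> J \<Longrightarrow> (\<rho> has_real_derivative inverse (r' t)) (at (r t) within K)"
proof -
  obtain \<rho>' where "\<And>t. t \<in> J \<Longrightarrow> \<rho>' (r t) = t"
    "\<And>t. t \<in> J \<Longrightarrow> (\<rho>' has_real_derivative inverse (r' t)) (at (r t) within r ` J)"
    using reparametrization_inverse[OF J(1) r_deriv r'_nonzero] by blast
  then have "\<exists>\<rho>. \<forall>t\<in>J. \<rho> (r t) = t \<and> (\<rho> has_real_derivative inverse (r' t)) (at (r t) within K)"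
    unfolding K_eq by blast
  from someI_ex[OF this, folded \<rho>_def]
  show "t \<in> J \<Longrightarrow> \<rho> (r t) = t" "t \<in> J \<Longrightarrow> (\<rho> has_real_derivative inverse (r' t)) (at (r t) within K)"
    by blast+
qed

definition V :: "('i \<Rightarrow> real \<Rightarrow> real \<times> 'e) set" where
  "V = {X. jacobi_field M h J \<gamma> X \<and> (\<forall>i. X i a = 0) \<and> (\<forall>i. X i b = 0)}"

definition VF :: "('i \<Rightarrow> real \<Rightarrow> 'e) set" where
  "VF = {Z. jacobi_field F g K \<gamma>F Z \<and> (\<forall>i. Z i (r a) = 0) \<and> (\<forall>i. Z i (r b) = 0)}"

text \<open>The fiber field in the parameter of \<open>\<gamma>\<close>, with base component 0. The
  value 0 outside \<open>J\<close> is the one that \<open>field_along\<close> prescribes, so that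
  \<open>lift\<close> and \<open>proj\<close> invert each other as functions.\<close>

definition lift :: "('i \<Rightarrow> real \<Rightarrow> 'e) \<Rightarrow> 'i \<Rightarrow> real \<Rightarrow> real \<times> 'e" where
  "lift Z i t = (if t \<in> J then (0, Z i (r t)) else 0)"

definition proj :: "('i \<Rightarrow> real \<Rightarrow> real \<times> 'e) \<Rightarrow> 'i \<Rightarrow> real \<Rightarrow> 'e" where
  "proj X i s = (if s \<in> K then snd (X i (\<rho> s)) else 0)"

abbreviation DK :: "('i \<Rightarrow> real \<Rightarrow> 'e) \<Rightarrow> 'i \<Rightarrow> real \<Rightarrow> 'e" where "DK \<equiv> covariant_derivative F g K \<gamma>F"

lemma subspace_V: "subspace V"
  unfolding V_def
proof (rule jacobi_fields_subspace[OF nb])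
  fix i t assume "t \<in> J" "\<gamma> t \<in> chart_dom M i"
  then have y: "chart M i (\<gamma> t) \<in> I \<times> U i" by (auto simp: \<gamma>_eq)
  show "linear (christoffel (h i) (chart M i (\<gamma> t)) (velocity M J \<gamma> i t))"
    unfolding h_eq by (rule linearI) (rule C.christoffel_H_linear[OF y])+
  show "linear (\<lambda>u. curvature (h i) (chart M i (\<gamma> t)) u (velocity M J \<gamma> i t) (velocity M J \<gamma> i t))"
    unfolding h_eq
    by (rule linearI; rule curvature_linear[where U="I \<times> U i"])
       (use y base_open C.open_U in \<open>auto simp: open_Times C.christoffel_H_linear C.christoffel_H_differentiable simp del: M_simps\<close>)
next
  fix i j t assume "t \<in> J" "\<gamma> t \<in> chart_dom M i \<inter> chart_dom M j"
  then show "linear (frechet_derivative (transition M i j) (at (chart M i (\<gamma> t))))"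
    using in_chart by (intro transition_M(2)) auto
qed

text \<open>By \<open>D T = 0\<close> and skewness of the curvature, the product of \<open>Z\<close>
  with \<open>T\<close> is affine in the parameter of the fiber geodesic, and it has zeros at
  \<open>r a\<close> and \<open>r b\<close>.\<close>

lemma fiber_jacobi_orthogonal:
  assumes Z: "Z \<in> VF" and t: "t \<in> N i"
  shows "g i (x i t) (Z i (r t)) (T i (r t)) = 0" "g i (x i t) (DK Z i (r t)) (T i (r t)) = 0"
proof -
  let ?NK = "\<lambda>i. {s \<in> K. \<gamma>F s \<in> chart_dom F i}"
  have jac: "jacobi_field F g K \<gamma>F Z" and z: "\<And>i. Z i (r a) = 0" "\<And>i. Z i (r b) = 0"
    using Z by (auto simp: VF_def)
  have NK: "openin (top_of_set K) (?NK i)" for i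
    using \<gamma>F_curve preimage_chart_dom_open unfolding differentiable_curve_def by blast
  have along: "field_along F K \<gamma>F Z" using jac by (simp add: jacobi_field_def)
  note T_along = velocity_field_along[OF \<gamma>F_curve nbK]
  have diff: "Z i differentiable (at s within K)" "DK Z i differentiable (at s within K)"
    "T i differentiable (at s within K)" "DK T i s = 0"
    "DK (DK Z) i s + curvature (g i) (chart F i (\<gamma>F s)) (Z i s) (T i s) (T i s) = 0"
    if "s \<in> ?NK i" for s i
    using that jac fiber_geod(1) by (simp_all add: jacobi_field_def differentiable_field_def geodesic_def)
  define u where "u = inner_along \<gamma>F Z T"
  \<comment> \<open>As the derivative of \<open>u\<close>, the product of \<open>DK Z\<close> with
    \<open>T\<close> becomes one function on all of \<open>K\<close>; \<open>u1_eq\<close> gives its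
    form in each chart.\<close>
  define u1 where "u1 s = vector_derivative u (at s within K)" for s
  have u_eq: "u s = g i (chart F i (\<gamma>F s)) (Z i s) (T i s)" if "s \<in> ?NK i" for s i
    unfolding u_def by (rule inner_along_eq[OF along T_along]) (use that in auto)
  have u_d: "(u has_real_derivative g i (chart F i (\<gamma>F s)) (DK Z i s) (T i s)) (at s within K)" if s: "s \<in> ?NK i" for s i
  proof -
    have sK: "s \<in> K" "\<gamma>F s \<in> chart_dom F i" and x: "chart F i (\<gamma>F s) \<in> U i" using s by auto
    from inner_along_has_derivative[where i=i and J=K and X=Z and Y=T, OF \<gamma>F_curve sK along T_along diff(1,3)[OF s]]
    show ?thesis by (simp add: u_def diff(4)[OF s] C.bil_simps[OF x])
  qed
  have u1_eq: "u1 s = g i (chart F i (\<gamma>F s)) (DK Z i s) (T i s)" if s: "s \<in> ?NK i" for s i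
    unfolding u1_def
    by (rule vector_derivative_within[OF nbK u_d[OF s, unfolded has_real_derivative_iff_has_vector_derivative]])
       (use s in simp)
  have "(u has_real_derivative u1 s) (at s within K)" and "(u1 has_real_derivative 0) (at s within K)" if s: "s \<in> K" for s
  proof -
    obtain i where i: "s \<in> ?NK i" using curve_in_chart[OF \<gamma>F_curve s] s by blast
    then have sK: "s \<in> K" "\<gamma>F s \<in> chart_dom F i" and x: "chart F i (\<gamma>F s) \<in> U i" by auto
    show "(u has_real_derivative u1 s) (at s within K)"
      using u_d[OF i] by (simp only: u1_eq[OF i])
    have "DK (DK Z) i s = - curvature (g i) (chart F i (\<gamma>F s)) (Z i s) (T i s) (T i s)"
      using diff(5)[OF i] by (simp add: eq_neg_iff_add_eq_0)
    then have "g i (chart F i (\<gamma>F s)) (DK (DK Z) i s) (T i s) + g i (chart F i (\<gamma>F s)) (DK Z i s) (DK T i s) = 0"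
      by (simp add: diff(4)[OF i] C.bil_simps[OF x] C.curvature_skew[OF x])
    with product_rule_in_chart[where X="DK Z" and Y=T and i=i, OF \<gamma>F_curve sK diff(2,3)[OF i]]
    have "((\<lambda>s. g i (chart F i (\<gamma>F s)) (DK Z i s) (T i s)) has_real_derivative 0) (at s within K)"
      by simp
    then show "(u1 has_real_derivative 0) (at s within K)"
      by (rule has_real_derivative_cong_openin[OF NK i]) (rule u1_eq[symmetric])
  qed
  note u_u1 = this
  have z': "u s = 0" if s: "s \<in> K" "\<And>i. Z i s = 0" for s
  proof -
    obtain i where i: "s \<in> ?NK i" using curve_in_chart[OF \<gamma>F_curve s(1)] s(1) by blast
    then show ?thesis using u_eq[OF i] s(2) by (simp add: C.bil_simps)
  qed
  have K: "r a \<in> K" "r b \<in> K" "r t \<in> K" using J(2,3) t by (auto simp: K_eq)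
  have "u (r t) = 0" "u1 (r t) = 0"
    using affine_with_two_zeros[OF K_interval K(1,2) r_neq[OF J(2-4)] u_u1 z'[OF K(1) z(1)] z'[OF K(2) z(2)] K(3)]
    by auto
  moreover have "r t \<in> ?NK i" "chart F i (\<gamma>F (r t)) = x i t" using t K(3) by (auto simp: \<beta>_r)
  ultimately show "g i (x i t) (Z i (r t)) (T i (r t)) = 0" "g i (x i t) (DK Z i (r t)) (T i (r t)) = 0"
    using u_eq[of "r t" i] u1_eq[of "r t" i] by simp_all
qed

text \<open>With \<open>\<alpha> = 0\<close> the base equation reduces to
  \<open>2 Q G^2 g(DY, v) = 0\<close>, which is where orthogonality enters. In the fiber equation
  the term \<open>2 Q \<sigma> DY\<close> is balanced by the second derivative of
  \<open>r\<close>.\<close>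

lemma lift_mem:
  assumes Z: "Z \<in> VF"
  shows "lift Z \<in> V"
proof -
  have jac: "jacobi_field F g K \<gamma>F Z" and z: "\<And>i. Z i (r a) = 0" "\<And>i. Z i (r b) = 0"
    using Z by (auto simp: VF_def)
  define y where "y i t = (if t \<in> J then Z i (r t) else 0)" for i t
  have lift_y: "lift Z = (\<lambda>i t. (0, y i t))" by (auto simp: lift_def y_def fun_eq_iff zero_prod_def)
  have rK: "r t \<in> K" "\<gamma>F (r t) \<in> chart_dom F i" if "t \<in> N i" for t i
    using that by (auto simp: K_eq \<beta>_r)
  have ZK: "Z i differentiable (at (r t) within K)" "DK Z i differentiable (at (r t) within K)"
    "DK (DK Z) i (r t) + curvature (g i) (x i t) (Z i (r t)) (T i (r t)) (T i (r t)) = 0"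
    if "t \<in> N i" for t i
    using that rK[OF that] jac by (auto simp: jacobi_field_def differentiable_field_def \<beta>_r)
  have sub: "r ` J \<subseteq> K" by (simp add: K_eq)
  have y_d: "y i differentiable (at t within J)" and Dy: "D y i t = r' t *\<^sub>R DK Z i (r t)" if t: "t \<in> N i" for t i
  proof -
    have tJ: "t \<in> J" using t by simp
    note rep = covariant_derivative_reparametrized[of t J \<gamma>F r i "r' t" K \<beta> Z "\<lambda>_. 1" 0 y,
        OF nb[OF tJ] tJ rK(2)[OF t] r_deriv[OF tJ] sub nbK[OF rK(1)[OF t]] \<gamma>F_curve \<beta>_r ZK(1)[OF t] DERIV_const]
    show "y i differentiable (at t within J)" by (rule rep(1)) (simp_all add: y_def)
    have "D y i t = 0 *\<^sub>R Z i (r t) + (1 * r' t) *\<^sub>R DK Z i (r t)" by (rule rep(2)) (simp_all add: y_def)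
    then show "D y i t = r' t *\<^sub>R DK Z i (r t)" by simp
  qed
  \<comment> \<open>Extended to charts that miss the curve, where both sides are 0 by convention, so
    that the formula holds for all of \<open>D y i\<close> on \<open>J\<close> and can be
    differentiated again.\<close>
  have Dy': "D y i t = r' t *\<^sub>R DK Z i (r t)" if t: "t \<in> J" for t i
  proof (cases "t \<in> N i")
    case False
    then have "\<beta> t \<notin> chart_dom F i" using t by simp
    then show ?thesis by (simp add: covariant_derivative_def \<beta>_r[OF t, symmetric])
  qed (rule Dy)
  have Dy_d: "D y i differentiable (at t within J)"
    and DDy: "D (D y) i t + curvature (g i) (x i t) (y i t) (v i t) (v i t) + (2 * Q t * \<sigma> t) *\<^sub>R D y i t = 0"
    if t: "t \<in> N i" for t i
  proof -
    have tJ: "t \<in> J" and x: "x i t \<in> U i" using t by auto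
    note rep = covariant_derivative_reparametrized[of t J \<gamma>F r i "r' t" K \<beta> "DK Z" r' "- (2 * Q t * \<sigma> t * r' t)" "D y",
        OF nb[OF tJ] tJ rK(2)[OF t] r_deriv[OF tJ] sub nbK[OF rK(1)[OF t]] \<gamma>F_curve \<beta>_r ZK(2)[OF t] r'_deriv[OF tJ]]
    show "D y i differentiable (at t within J)" by (rule rep(1)) (simp_all add: Dy')
    have "D (D y) i t = (- (2 * Q t * \<sigma> t * r' t)) *\<^sub>R DK Z i (r t) + (r' t * r' t) *\<^sub>R DK (DK Z) i (r t)"
      by (rule rep(2)) (simp_all add: Dy')
    moreover have "DK (DK Z) i (r t) = - curvature (g i) (x i t) (Z i (r t)) (T i (r t)) (T i (r t))"
      using ZK(3)[OF t] by (simp add: eq_neg_iff_add_eq_0)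
    moreover have "curvature (g i) (x i t) (y i t) (v i t) (v i t)
        = (r' t * r' t) *\<^sub>R curvature (g i) (x i t) (Z i (r t)) (T i (r t)) (T i (r t))"
      using C.curvature_rescale[OF x] tJ by (simp add: v_T[OF tJ] y_def)
    ultimately show "D (D y) i t + curvature (g i) (x i t) (y i t) (v i t) (v i t) + (2 * Q t * \<sigma> t) *\<^sub>R D y i t = 0"
      by (simp add: Dy[OF t])
  qed
  have orth: "g i (x i t) (y i t) (v i t) = 0" "g i (x i t) (D y i t) (v i t) = 0" if t: "t \<in> N i" for t i
  proof -
    have tJ: "t \<in> J" and x: "x i t \<in> U i" using t by auto
    show "g i (x i t) (y i t) (v i t) = 0" "g i (x i t) (D y i t) (v i t) = 0"
      using fiber_jacobi_orthogonal[OF Z t] tJ by (simp_all add: y_def Dy[OF t] v_T[OF tJ] C.bil_simps[OF x])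
  qed
  have lift_d: "lift Z i differentiable (at t within J)" if t: "t \<in> N i" for t i
    unfolding lift_y
    using has_vector_derivative_Pair[OF has_vector_derivative_const y_d[OF t, unfolded vector_derivative_works]]
    by (rule differentiableI_vector)
  have vd0: "vector_derivative (\<lambda>s. 0::real) (at t within J) = 0" if "t \<in> J" for t
    by (rule vector_derivative_within[OF nb[OF that] has_vector_derivative_const])
  \<comment> \<open>The covariant derivative of the lift in closed form. Its base part would be
    \<open>Q G^2 g(v, y)\<close>, which is 0 by orthogonality.\<close>
  define X2 where "X2 i t = (0::real, D y i t + (Q t * \<sigma> t) *\<^sub>R y i t)" for i t
  have cov: "covariant_derivative M h J \<gamma> (lift Z) = X2"
  proof (intro ext)
    fix i t show "covariant_derivative M h J \<gamma> (lift Z) i t = X2 i t"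
    proof (cases "t \<in> N i")
      case True
      then have x: "x i t \<in> U i" by auto
      show ?thesis
        using covariant_derivative_M[of t i "lift Z", OF True lift_d[OF True]] orth(1)[OF True]
        by (simp add: lift_y X2_def C.sym[OF x, of "v i t" "y i t"] True[THEN CollectD] vd0)
    next
      case False
      then have n: "\<not> (t \<in> J \<and> \<gamma> t \<in> chart_dom M i)" "\<not> (t \<in> J \<and> \<beta> t \<in> chart_dom F i)"
        using in_chart by blast+
      have "y i t = 0"
        using n(2) jac by (auto simp: y_def jacobi_field_def field_along_def \<beta>_r)
      then show ?thesis
        by (simp only: X2_def covariant_derivative_def if_not_P[OF n(1)] if_not_P[OF n(2)]) (simp add: zero_prod_def)
    qed
  qed
  have X2_y: "Y X2 = (\<lambda>i t. D y i t + (Q t * \<sigma> t) *\<^sub>R y i t)" by (simp add: X2_def fun_eq_iff)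
  have Q\<sigma>: "((\<lambda>s. Q s * \<sigma> s) has_real_derivative (W t - (Q t)\<^sup>2) * (\<sigma> t)\<^sup>2 - (Q t)\<^sup>2 * (G t)\<^sup>2 * e t) (at t within J)"
    if "t \<in> J" for t
    by (rule derivative_eq_intros Q_deriv[OF that] \<sigma>_deriv[OF that] refl)+ (simp add: algebra_simps power2_eq_square)
  have dqy: "(\<lambda>s. (Q s * \<sigma> s) *\<^sub>R y i s) differentiable (at t within J)" if "t \<in> N i" for t i
    using differentiable_scaleR[OF differentiable_from_real_derivative[OF Q\<sigma>] y_d[OF that]] that by simp
  have X2_d: "X2 i differentiable (at t within J)" if t: "t \<in> N i" for t i
  proof -
    have "(\<lambda>s. D y i s + (Q s * \<sigma> s) *\<^sub>R y i s) differentiable (at t within J)"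
      by (rule differentiable_add[OF Dy_d[OF t] dqy[OF t]])
    from has_vector_derivative_Pair[OF has_vector_derivative_const this[unfolded vector_derivative_works]]
    show ?thesis unfolding X2_def[abs_def] by (rule differentiableI_vector)
  qed
  have equation: "covariant_derivative M h J \<gamma> X2 i t
      + curvature (h i) (chart M i (\<gamma> t)) (lift Z i t) (velocity M J \<gamma> i t) (velocity M J \<gamma> i t) = 0"
    if t: "t \<in> N i" for t i
  proof -
    have tJ: "t \<in> J" "\<beta> t \<in> chart_dom F i" and x: "x i t \<in> U i" using t by auto
    have DX2: "D (Y X2) i t = D (D y) i t
        + (((W t - (Q t)\<^sup>2) * (\<sigma> t)\<^sup>2 - (Q t)\<^sup>2 * (G t)\<^sup>2 * e t) *\<^sub>R y i t + (Q t * \<sigma> t) *\<^sub>R D y i t)"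
      unfolding X2_y
        covariant_derivative_add_at[of t J "D y" i "\<lambda>i s. (Q s * \<sigma> s) *\<^sub>R y i s",
          OF nb[OF tJ(1)] Dy_d[OF t] dqy[OF t]]
        covariant_derivative_scale_at[of t J y i "\<lambda>s. Q s * \<sigma> s" _ \<beta>, OF nb[OF tJ(1)] y_d[OF t] Q\<sigma>[OF tJ(1)] tJ] ..
    have "g i (x i t) (v i t) (Y X2 i t) = 0"
      unfolding C.sym[OF x, of "v i t" "Y X2 i t"]
      by (simp add: X2_def C.bil_simps[OF x] orth[OF t])
    then have split: "covariant_derivative M h J \<gamma> X2 i t
        = (0, D (Y X2) i t + (Q t * \<sigma> t) *\<^sub>R (D y i t + (Q t * \<sigma> t) *\<^sub>R y i t))"
      using covariant_derivative_M[of t i X2, OF t X2_d[OF t]] by (simp add: X2_def vd0 tJ)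
    have curv: "curvature (h i) (chart M i (\<gamma> t)) (lift Z i t) (velocity M J \<gamma> i t) (velocity M J \<gamma> i t)
        = (0, curvature (g i) (x i t) (y i t) (v i t) (v i t) - (W t * (\<sigma> t)\<^sup>2) *\<^sub>R y i t
            + ((Q t)\<^sup>2 * (G t)\<^sup>2 * e t) *\<^sub>R y i t)"
      using curvature_M[OF t, of 0 "y i t"] orth(1)[OF t]
      by (simp add: lift_y e_eq[OF t, symmetric] power2_eq_square mult.assoc)
    have ddy: "D (D y) i t = - curvature (g i) (x i t) (y i t) (v i t) (v i t) - (2 * Q t * \<sigma> t) *\<^sub>R D y i t"
      using DDy[OF t] by (simp add: algebra_simps eq_neg_iff_add_eq_0)
    \<comment> \<open>The multiples of \<open>D y\<close> add up to \<open>- 2 + 1 + 1\<close> times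
      \<open>Q \<sigma>\<close>, and the multiples of \<open>y\<close> from the connection cancel
      those from the warped curvature.\<close>
    show ?thesis
      unfolding split curv DX2 ddy by (simp add: zero_prod_def algebra_simps power2_eq_square flip: scaleR_2)
  qed
  have "field_along M J \<gamma> (lift Z)"
    unfolding field_along_def
  proof (intro conjI allI ballI impI)
    fix i t assume "\<not> (t \<in> J \<and> \<gamma> t \<in> chart_dom M i)"
    then have "\<not> (t \<in> J \<and> \<beta> t \<in> chart_dom F i)" using in_chart by blast
    then show "lift Z i t = 0"
      using jac by (auto simp: lift_def jacobi_field_def field_along_def \<beta>_r zero_prod_def)
  next
    fix i j t assume tJ: "t \<in> J" and "\<gamma> t \<in> chart_dom M i \<inter> chart_dom M j"
    then have t: "t \<in> N i" "t \<in> N j" using in_chart by blast+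
    have fa: "field_along F K \<gamma>F Z" using jac by (simp add: jacobi_field_def)
    have "\<gamma>F (r t) \<in> chart_dom F i \<inter> chart_dom F j" using rK(2)[OF t(1)] rK(2)[OF t(2)] by blast
    then have "Z j (r t) = frechet_derivative (transition F i j) (at (chart F i (\<gamma>F (r t)))) (Z i (r t))"
      using fa rK(1)[OF t(1)] unfolding field_along_def by blast
    then have "Z j (r t) = frechet_derivative (transition F i j) (at (x i t)) (Z i (r t))"
      by (simp add: \<beta>_r[OF tJ])
    then show "lift Z j t = frechet_derivative (transition M i j) (at (chart M i (\<gamma> t))) (lift Z i t)"
      unfolding transition_M(1)[OF t] using tJ by (simp add: lift_def)
  qed
  then have "jacobi_field M h J \<gamma> (lift Z)"
    unfolding jacobi_field_def differentiable_field_def cov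
    by (intro conjI allI ballI impI) (simp_all add: lift_d X2_d equation in_chart del: M_simps)
  then show ?thesis
    using z J(2,3) by (simp add: V_def lift_def zero_prod_def)
qed

lemma proj_mem:
  assumes X: "X \<in> V" and \<alpha>0: "\<And>t. t \<in> J \<Longrightarrow> \<alpha> X t = 0"
  shows "proj X \<in> VF" and "lift (proj X) = X"
proof -
  have jac: "jacobi_field M h J \<gamma> X" and z: "\<And>i. X i a = 0" "\<And>i. X i b = 0"
    using X by (auto simp: V_def)
  note along = along[OF jac]
  have \<alpha>1: "\<alpha>1 X t = 0" if t: "t \<in> J" for t
  proof -
    obtain i where i: "t \<in> N i" using exists_chart[OF t] by blast
    have "((\<lambda>s. 0) has_vector_derivative \<alpha>1 X t) (at t within J)"
      using has_vector_derivative_transform[OF t _ base_component_deriv(1)[OF jac i,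
            unfolded has_real_derivative_iff_has_vector_derivative], of "\<lambda>s. 0"] \<alpha>0 by simp
    then show ?thesis
      using vector_derivative_unique_within[OF nb[OF t]] has_vector_derivative_const by blast
  qed
  have DDY: "D (D (Y X)) i t + curvature (g i) (x i t) (Y X i t) (v i t) (v i t) + (2 * Q t * \<sigma> t) *\<^sub>R D (Y X) i t = 0"
    if t: "t \<in> N i" for t i
    using jacobi_equation_split(2)[OF jac t] t by (simp add: \<alpha>0 \<alpha>1)
  have Y_zero: "Y X i t = 0" if "t \<notin> N i" for i t
    using field_along_M(3)[OF along that] by simp
  let ?Z = "proj X"
  have Zr: "?Z i (r t) = Y X i t" if "t \<in> J" for i t
    using that by (simp add: proj_def r_in_K \<rho>_r)
  have in_J: "\<rho> s \<in> J" and \<gamma>F\<beta>: "\<gamma>F s = \<beta> (\<rho> s)" and r\<rho>: "r (\<rho> s) = s" if s: "s \<in> K" for s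
  proof -
    obtain t where t: "s = r t" "t \<in> J" using s[unfolded K_eq] by (rule imageE)
    then show "\<rho> s \<in> J" "\<gamma>F s = \<beta> (\<rho> s)" "r (\<rho> s) = s" by (simp_all add: \<rho>_r \<beta>_r)
  qed
  have \<rho>K: "\<rho> ` K \<subseteq> J" by (rule image_subsetI) (rule in_J)
  have \<rho>d: "(\<rho> has_real_derivative inverse (r' (\<rho> s))) (at s within K)" if s: "s \<in> K" for s
    using \<rho>_deriv[OF in_J[OF s]] by (simp add: r\<rho>[OF s])
  have chart: "\<rho> s \<in> N i" if "s \<in> K" "\<gamma>F s \<in> chart_dom F i" for s i
    using that in_J \<gamma>F\<beta> by simp
  have Z_d: "?Z i differentiable (at s within K)" and DZ: "DK ?Z i s = inverse (r' (\<rho> s)) *\<^sub>R D (Y X) i (\<rho> s)"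
    if s: "s \<in> K" "\<gamma>F s \<in> chart_dom F i" for s i
  proof -
    note n = chart[OF s]
    have \<beta>s: "\<beta> (\<rho> s) \<in> chart_dom F i" using n by simp
    note rep = covariant_derivative_reparametrized[of s K \<beta> \<rho> i "inverse (r' (\<rho> s))" J \<gamma>F "Y X" "\<lambda>_. 1" 0 ?Z,
        OF nbK[OF s(1)] s(1) \<beta>s \<rho>d[OF s(1)] \<rho>K nb[OF in_J[OF s(1)]] \<beta>_curve \<gamma>F\<beta> Y_differentiable[OF jac n] DERIV_const]
    show "?Z i differentiable (at s within K)" by (rule rep(1)) (simp_all add: proj_def)
    have "DK ?Z i s = 0 *\<^sub>R Y X i (\<rho> s) + (1 * inverse (r' (\<rho> s))) *\<^sub>R D (Y X) i (\<rho> s)"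
      by (rule rep(2)) (simp_all add: proj_def)
    then show "DK ?Z i s = inverse (r' (\<rho> s)) *\<^sub>R D (Y X) i (\<rho> s)" by simp
  qed
  have DZ': "DK ?Z i s = inverse (r' (\<rho> s)) *\<^sub>R D (Y X) i (\<rho> s)" if s: "s \<in> K" for s i
  proof (cases "\<gamma>F s \<in> chart_dom F i")
    case False
    then show ?thesis by (simp add: covariant_derivative_def \<gamma>F\<beta>[OF s])
  qed (rule DZ[OF s])
  have DZ_d: "DK ?Z i differentiable (at s within K)"
    and equation: "DK (DK ?Z) i s + curvature (g i) (chart F i (\<gamma>F s)) (?Z i s) (T i s) (T i s) = 0"
    if s: "s \<in> K" "\<gamma>F s \<in> chart_dom F i" for s i
  proof -
    note n = chart[OF s]
    define t where "t = \<rho> s"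
    have t: "t \<in> J" "t \<in> N i" "r t = s" using n r\<rho>[OF s(1)] by (simp_all add: t_def)
    have x: "x i t \<in> U i" using t(2) by auto
    have \<beta>s: "\<beta> (\<rho> s) \<in> chart_dom F i" using n by simp
    have nz: "r' t \<noteq> 0" by (rule r'_nonzero[OF t(1)])
    have "((\<lambda>u. r' (\<rho> u)) has_real_derivative - (2 * Q t * \<sigma> t * r' t) * inverse (r' t)) (at s within K)"
      using DERIV_image_chain[OF has_field_derivative_subset[OF r'_deriv[OF t(1)[unfolded t_def]] \<rho>K] \<rho>d[OF s(1)]]
      by (simp add: o_def t_def)
    \<comment> \<open>The factor \<open>1 / r'\<close> has derivative
      \<open>2 Q \<sigma> / r'^2\<close> in the parameter of the fiber geodesic: \<open>r''\<close>
      and the chain rule contribute one factor each. This is the coefficient that completes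
      \<open>D (D (Y X))\<close> to the left side of \<open>DDY\<close> without its curvature
      term.\<close>
    then have c: "((\<lambda>u. inverse (r' (\<rho> u))) has_real_derivative 2 * Q t * \<sigma> t * (inverse (r' t) * inverse (r' t))) (at s within K)"
      by (rule derivative_eq_intros) (use nz in \<open>auto simp: t_def field_simps\<close>)
    note rep = covariant_derivative_reparametrized[of s K \<beta> \<rho> i "inverse (r' (\<rho> s))" J \<gamma>F "D (Y X)" _ _ "DK ?Z",
        OF nbK[OF s(1)] s(1) \<beta>s \<rho>d[OF s(1)] \<rho>K nb[OF in_J[OF s(1)]] \<beta>_curve \<gamma>F\<beta> DY_differentiable[OF jac n] c DZ']
    show "DK ?Z i differentiable (at s within K)" by (rule rep(1))
    have "DK (DK ?Z) i s = (2 * Q t * \<sigma> t * (inverse (r' t) * inverse (r' t))) *\<^sub>R D (Y X) i t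
        + (inverse (r' t) * inverse (r' t)) *\<^sub>R D (D (Y X)) i t"
      unfolding t_def by (rule rep(2)[unfolded t_def])
    also have "\<dots> = (inverse (r' t) * inverse (r' t)) *\<^sub>R (D (D (Y X)) i t + (2 * Q t * \<sigma> t) *\<^sub>R D (Y X) i t)"
      by (simp add: scaleR_add_right algebra_simps)
    also have "D (D (Y X)) i t + (2 * Q t * \<sigma> t) *\<^sub>R D (Y X) i t = - curvature (g i) (x i t) (Y X i t) (v i t) (v i t)"
      using DDY[OF t(2)] by (simp add: eq_neg_iff_add_eq_0 algebra_simps)
    also have "curvature (g i) (x i t) (Y X i t) (v i t) (v i t)
        = (r' t * r' t) *\<^sub>R curvature (g i) (x i t) (Y X i t) (T i s) (T i s)"
      unfolding v_T[OF t(1)] t(3) by (rule C.curvature_rescale[OF x])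
    finally have "DK (DK ?Z) i s = - ((inverse (r' t) * inverse (r' t) * (r' t * r' t)) *\<^sub>R
        curvature (g i) (x i t) (Y X i t) (T i s) (T i s))"
      by simp
    moreover have "inverse (r' t) * inverse (r' t) * (r' t * r' t) = 1" using nz by (simp add: field_simps)
    ultimately have "DK (DK ?Z) i s = - curvature (g i) (x i t) (Y X i t) (T i s) (T i s)"
      by simp
    moreover have "?Z i s = Y X i t" "chart F i (\<gamma>F s) = x i t"
      using s(1) \<gamma>F\<beta> by (simp_all add: proj_def t_def)
    ultimately show "DK (DK ?Z) i s + curvature (g i) (chart F i (\<gamma>F s)) (?Z i s) (T i s) (T i s) = 0"
      by simp
  qed
  have "field_along F K \<gamma>F ?Z"
    unfolding field_along_def
  proof (intro conjI allI ballI impI)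
    fix i s assume "\<not> (s \<in> K \<and> \<gamma>F s \<in> chart_dom F i)"
    then show "?Z i s = 0"
      using Y_zero[of "\<rho> s" i] \<gamma>F\<beta>[of s] by (auto simp: proj_def)
  next
    fix i j s assume s: "s \<in> K" "\<gamma>F s \<in> chart_dom F i \<inter> chart_dom F j"
    then have "\<rho> s \<in> J" "\<beta> (\<rho> s) \<in> chart_dom F i \<inter> chart_dom F j" using in_J \<gamma>F\<beta> by simp_all
    then have "Y X j (\<rho> s) = frechet_derivative (transition F i j) (at (x i (\<rho> s))) (Y X i (\<rho> s))"
      using field_along_M(1)[OF along] unfolding field_along_def by blast
    then show "?Z j s = frechet_derivative (transition F i j) (at (chart F i (\<gamma>F s))) (?Z i s)"
      using s(1) \<gamma>F\<beta>[OF s(1)] by (simp add: proj_def)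
  qed
  then have "jacobi_field F g K \<gamma>F ?Z"
    unfolding jacobi_field_def differentiable_field_def
    by (intro conjI allI ballI impI) (simp_all add: Z_d DZ_d equation)
  then show "proj X \<in> VF"
    using Zr J(2,3) z by (simp add: VF_def)
  show "lift (proj X) = X"
  proof (intro ext)
    fix i t show "lift (proj X) i t = X i t"
    proof (cases "t \<in> N i")
      case True
      then have "X i t = (0, Y X i t)" using field_along_M(2)[OF along True] \<alpha>0[of t] by (simp add: prod_eq_iff)
      then show ?thesis using True Zr[of t i] by (simp add: lift_def)
    next
      case False
      then show ?thesis
        using field_along_M(3)[OF along False] Zr[of t i] by (simp add: lift_def zero_prod_def)
    qed
  qed
qed

section \<open>The codimension of the lifted fields and the comparison of multiplicities\<close>

lemma \<alpha>1_lift: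
  assumes "t \<in> J"
  shows "\<alpha>1 (lift Z) t = 0"
proof -
  have "\<alpha> (lift Z) = (\<lambda>t. 0)" by (simp add: \<alpha>_def lift_def fun_eq_iff)
  then show ?thesis
    using vector_derivative_within[OF nb[OF assms] has_vector_derivative_const, of 0] by (simp add: \<alpha>1_def)
qed

lemma \<alpha>1_linear:
  assumes X: "X \<in> V" and X': "X' \<in> V"
  shows "\<alpha>1 (X + X') a = \<alpha>1 X a + \<alpha>1 X' a" and "\<alpha>1 (c *\<^sub>R X) a = c * \<alpha>1 X a"
proof -
  obtain i where i: "a \<in> N i" using exists_chart[OF J(2)] by blast
  have d: "(\<alpha> X has_vector_derivative \<alpha>1 X a) (at a within J)" "(\<alpha> X' has_vector_derivative \<alpha>1 X' a) (at a within J)"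
    using base_component_deriv(1)[OF _ i] X X' by (auto simp: V_def has_real_derivative_iff_has_vector_derivative)
  have "\<alpha> (X + X') = (\<lambda>t. \<alpha> X t + \<alpha> X' t)" "\<alpha> (c *\<^sub>R X) = (\<lambda>t. c *\<^sub>R \<alpha> X t)"
    by (simp_all add: \<alpha>_def plus_fun_def scaleR_fun_def fun_eq_iff)
  then show "\<alpha>1 (X + X') a = \<alpha>1 X a + \<alpha>1 X' a" "\<alpha>1 (c *\<^sub>R X) a = c * \<alpha>1 X a"
    using vector_derivative_within[OF nb[OF J(2)] has_vector_derivative_add[OF d]]
      vector_derivative_within[OF nb[OF J(2)] has_vector_derivative_scaleR[OF DERIV_const d(1), of c]]
    by (simp_all add: \<alpha>1_def)
qed

text \<open>Identifies the fiber fields with the kernel of a real functional on \<open>V\<close>.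
  Vanishing of \<open>\<alpha>1\<close> at \<open>a\<close> spreads to \<open>\<alpha> = 0\<close>
  on \<open>J\<close>, and then the field is the lift of its projection.\<close>

lemma lift_image: "lift ` VF = {X \<in> V. \<alpha>1 X a = 0}"
proof
  show "lift ` VF \<subseteq> {X \<in> V. \<alpha>1 X a = 0}" using lift_mem \<alpha>1_lift[OF J(2)] by blast
  show "{X \<in> V. \<alpha>1 X a = 0} \<subseteq> lift ` VF"
  proof
    fix X assume "X \<in> {X \<in> V. \<alpha>1 X a = 0}"
    then have X: "X \<in> V" and \<alpha>1: "\<alpha>1 X a = 0" by auto
    have tan: "tangential_jacobi J a b G Q W \<sigma> e (\<alpha> X) (\<alpha>1 X) (\<phi> X) (\<psi> X)"
      by (rule tangential) (use X in \<open>auto simp: V_def\<close>)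
    have "\<alpha> X t = 0" if "t \<in> J" for t
      by (rule tangential_jacobi.vanishes_if_derivative_vanishes[OF tan \<alpha>1 that])
    from proj_mem[OF X this] show "X \<in> lift ` VF" by (metis imageI)
  qed
qed

lemma dim_lift: "dim (lift ` VF) = dim VF"
proof (rule dim_image_inj_on)
  show "linear lift"
    by (rule linearI) (auto simp: lift_def plus_fun_def scaleR_fun_def fun_eq_iff zero_prod_def)
  \<comment> \<open>\<open>lift\<close> sees the values on \<open>K\<close> only. The elements of
    \<open>VF\<close> vanish outside \<open>K\<close>, and this persists in their span, where
    \<open>lift\<close> is therefore injective.\<close>
  have "subspace {Z :: 'i \<Rightarrow> real \<Rightarrow> 'e. \<forall>i s. s \<notin> K \<longrightarrow> Z i s = 0}"
    by (rule subspaceI) (auto simp: plus_fun_def scaleR_fun_def zero_fun_def)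
  moreover have "VF \<subseteq> {Z. \<forall>i s. s \<notin> K \<longrightarrow> Z i s = 0}"
    by (auto simp: VF_def jacobi_field_def field_along_def)
  ultimately have sp: "span VF \<subseteq> {Z. \<forall>i s. s \<notin> K \<longrightarrow> Z i s = 0}"
    by (rule span_minimal[rotated])
  show "inj_on lift (span VF)"
  proof (rule inj_onI, intro ext)
    fix Z Z' i s assume "Z \<in> span VF" "Z' \<in> span VF" and eq: "lift Z = lift Z'"
    then have off: "Z i s = Z' i s" if "s \<notin> K" using sp that by (smt (verit) mem_Collect_eq subsetD)
    show "Z i s = Z' i s"
    proof (cases "s \<in> K")
      case True
      then obtain t where "t \<in> J" "s = r t" by (auto simp: K_eq)
      then show ?thesis using fun_cong[OF fun_cong[OF eq, of i], of t] by (simp add: lift_def)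
    qed (rule off)
  qed
qed

lemma dim_V: "dim V = dim VF \<or> dim V = Suc (dim VF)"
  using dim_kernel_functional[OF subspace_V, of "\<lambda>X. \<alpha>1 X a"] \<alpha>1_linear
  unfolding lift_image[symmetric] dim_lift by blast

lemma dim_V_regular:
  assumes "\<And>t. t \<in> J \<Longrightarrow> \<sigma> t \<noteq> 0"
  shows "dim V = dim VF"
proof -
  have "X \<in> lift ` VF" if X: "X \<in> V" for X
  proof -
    have tan: "tangential_jacobi J a b G Q W \<sigma> e (\<alpha> X) (\<alpha>1 X) (\<phi> X) (\<psi> X)"
      by (rule tangential) (use X in \<open>auto simp: V_def\<close>)
    have "\<alpha> X t = 0" if "t \<in> J" for t
      by (rule tangential_jacobi.vanishes_if_base_regular[OF tan assms that])
    from proj_mem[OF X this] show ?thesis by (metis imageI)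
  qed
  then have "V = lift ` VF" using lift_image by blast
  then show ?thesis using dim_lift by simp
qed

text \<open>Where \<open>\<sigma>\<close> vanishes, the velocity is tangent to the fiber and has
  square \<open>G^2 e > 0\<close>, so the curve is spacelike there.\<close>

lemma causal_regular:
  assumes "causal_curve M h J \<gamma>" and t: "t \<in> J"
  shows "\<sigma> t \<noteq> 0"
proof
  assume \<sigma>: "\<sigma> t = 0"
  obtain i where i: "t \<in> N i" using exists_chart[OF t] by blast
  then have "h i (chart M i (\<gamma> t)) (velocity M J \<gamma> i t) (velocity M J \<gamma> i t) \<le> 0"
    using assms in_chart unfolding causal_curve_def by blast
  then have "(G t)\<^sup>2 * e t \<le> 0"
    using i \<sigma> by (simp add: h_eq \<gamma>_eq velocity_M e_eq[OF i] G_def)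
  then show False using e_pos[OF t] G_pos[OF t] by (simp add: mult_le_0_iff)
qed

end

theorem theorem4:
  fixes F :: "('i, 'p, 'e::euclidean_space) manifold"
    and g :: "('i, 'e) metric"
    and I :: "real set" and f :: "real \<Rightarrow> real"
    and J :: "real set" and \<gamma> :: "real \<Rightarrow> real \<times> 'p" and a b :: real
    and \<tau>\<^sub>0 \<tau>\<^sub>0' :: real and x\<^sub>0 x\<^sub>0' :: 'p
    and K :: "real set" and \<gamma>F :: "real \<Rightarrow> 'p" and r :: "real \<Rightarrow> real"
    and m n :: nat
  assumes fiber: "riemannian_manifold F g" "DIM('e) = n"
    and base: "open I" "is_interval I" "I \<noteq> {}"
    and warping: "smooth_on I f" "\<forall>\<tau>\<in>I. 0 < f \<tau>"
    and param: "is_interval J" "a \<in> J" "b \<in> J" "a \<noteq> b"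
    and geod: "geodesic (grw_manifold I F) (grw_metric f g) J \<gamma>"
    and ends: "\<gamma> a = (\<tau>\<^sub>0, x\<^sub>0)" "\<gamma> b = (\<tau>\<^sub>0', x\<^sub>0')"
    and fiber_geod: "geodesic F g K \<gamma>F" "\<not> \<gamma>F constant_on K"
    and reparam: "reparametrization_of (snd \<circ> \<gamma>) J r \<gamma>F K"
    and mult: "m \<in> {0..n}"
      "conjugate_multiplicity (grw_manifold I F) (grw_metric f g) J \<gamma> a b = m"
  shows "\<exists>m'. conjugate_multiplicity F g K \<gamma>F (r a) (r b) = m' \<and>
           int m' \<in> {int m, int m - 1} \<and>
           (\<not> conjugate_along (grw_manifold I F) (grw_metric f g) J \<gamma> a b \<longrightarrow>
              \<not> conjugate_along F g K \<gamma>F (r a) (r b)) \<and>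
           (causal_curve (grw_manifold I F) (grw_metric f g) J \<gamma> \<or>
              (\<forall>t\<in>J. vector_derivative (\<lambda>s. fst (\<gamma> s)) (at t within J) \<noteq> 0) \<longrightarrow> m' = m)"
proof -
  interpret grw_geodesic F g I f J \<gamma> a b K \<gamma>F r
    by unfold_locales (use fiber(1) base(1) warping param geod fiber_geod reparam in auto)
  have m: "dim V = m"
    using mult(2) by (simp add: conjugate_multiplicity_def V_def)
  have m': "conjugate_multiplicity F g K \<gamma>F (r a) (r b) = dim VF"
    by (simp add: conjugate_multiplicity_def VF_def)
  have "dim V = dim VF"
    if "causal_curve M h J \<gamma> \<or> (\<forall>t\<in>J. vector_derivative (\<lambda>s. fst (\<gamma> s)) (at t within J) \<noteq> 0)"
  proof (rule dim_V_regular)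
    fix t assume "t \<in> J"
    then show "\<sigma> t \<noteq> 0"
      using that causal_regular by (auto simp: \<sigma>_def \<tau>_def[abs_def])
  qed
  \<comment> \<open>For \<open>m = 0\<close> the alternative \<open>dim V = Suc (dim VF)\<close> is
    impossible, which leaves \<open>m' = 0\<close> and gives the claim on non-conjugate
    points.\<close>
  then show ?thesis
    using dim_V m m' mult(2) by (auto simp: conjugate_along_def)
qed

end
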